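(* The operator $\log\mathcal{C}$ in $L^2(\mathbb{R})$ has a bounded inverse $(\log\mathcal{C})^{-1}$ that belongs to the algebra $\mathcal{A}_u$. Moreover, the scalar symbol of $(\log\mathcal{C})^{-1}$ is $$\varphi(s)=-\frac{1}{\log(\frac12-\imath s)}\quad(s\in\mathbb{R}).$$
   Context: The Cesàro operator $\mathcal{C}$ in $L^2(\mathbb{R})$ is $(\mathcal{C}f)(x)=\frac1x\int_0^x f(t)\,dt=\int_0^1 f(ux)\,du$, a bounded normal operator with spectrum $\{z\in\mathbb{C}:|z-1|=1\}$. For $\alpha>0$, $\mathcal{C}^\alpha$ is defined by the functional calculus for normal operators, with the branch of $z^\alpha$ on $\{\mathrm{Re}(z)>0\}$ such that $1^\alpha=1$ and with $0^\alpha:=0$; it equals the Hölder operator $(H_\alpha f)(x)=\frac{1}{\Gamma(\alpha)}\int_0^1(\log\frac1u)^{\alpha-1}f(ux)\,du$. With $\mathcal{C}^0=H_0:=I$, $(\mathcal{C}^\alpha)_{\alpha\ge0}$ is a strongly continuous semigroup in $L^2(\mathbb{R})$, and $\log\mathcal{C}$ denotes its generator. For a measurable $K$ on $\mathbb{R}$ with $K(u)|u|^{-1/2}\in L^1(\mathbb{R})$, $\mathcal{H}_K$ is the bounded operator in $L^2(\mathbb{R})$ given by $(\mathcal{H}_Kf)(x)=\int_{\mathbb{R}}K(u)f(ux)\,du$ ($K$ is determined a.e. by $\mathcal{H}_K$); $\mathcal{A}_u$ is the algebra of all such operators $\mathcal{H}_K$. The scalar symbol of $\mathcal{H}_K\in\mathcal{A}_u$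 is $\varphi(s)=\int_{\mathbb{R}}K(u)|u|^{-1/2-\imath s}\,du$, $s\in\mathbb{R}$, where $|u|^{-\imath s}=\exp(-\imath s\log|u|)$. The complex logarithm is the principal branch. *)

theory Defs
  imports "HOL-Analysis.Analysis"
begin

section \<open>The Hilbert space of square integrable functions on the real line\<close>

definition square_integrable :: "(real \<Rightarrow> complex) \<Rightarrow> bool" where
  "square_integrable f \<longleftrightarrow>
     f \<in> borel_measurable lborel \<and> integrable lborel (\<lambda>x. (cmod (f x))\<^sup>2)"

lemma square_integrable_zero: "square_integrable (\<lambda>_. 0)"
  by (simp add: square_integrable_def)

lemma square_integrable_add:
  assumes "square_integrable f" "square_integrable g"
  shows "square_integrable (\<lambda>x. f x + g x)"
proof -
  have [measurable]: "f \<in> borel_measurable lborel" "g \<in> borel_measurable lborel"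
    using assms by (auto simp: square_integrable_def)
  have "integrable lborel (\<lambda>x. 2 * (cmod (f x))\<^sup>2 + 2 * (cmod (g x))\<^sup>2)"
    using assms by (auto simp: square_integrable_def)
  then have "integrable lborel (\<lambda>x. (cmod (f x + g x))\<^sup>2)"
  proof (rule Bochner_Integration.integrable_bound)
    show "AE x in lborel. norm ((cmod (f x + g x))\<^sup>2)
            \<le> norm (2 * (cmod (f x))\<^sup>2 + 2 * (cmod (g x))\<^sup>2)"
    proof (rule AE_I2)
      fix x
      have "(cmod (f x + g x))\<^sup>2 \<le> (cmod (f x) + cmod (g x))\<^sup>2"
        by (intro power_mono norm_triangle_ineq) auto
      also have "\<dots> \<le> 2 * (cmod (f x))\<^sup>2 + 2 * (cmod (g x))\<^sup>2"
        using sum_squares_bound[of "cmod (f x)" "cmod (g x)"] by (simp add: power2_sum)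
      finally show "norm ((cmod (f x + g x))\<^sup>2)
            \<le> norm (2 * (cmod (f x))\<^sup>2 + 2 * (cmod (g x))\<^sup>2)"
        by simp
    qed
  qed measurable
  then show ?thesis by (simp add: square_integrable_def)
qed

lemma square_integrable_mult:
  assumes "square_integrable f"
  shows "square_integrable (\<lambda>x. c * f x)"
  using assms by (auto simp: square_integrable_def norm_mult power_mult_distrib)

lemma borel_measurable_cnj [measurable (raw)]:
  fixes f :: "'a \<Rightarrow> complex"
  assumes "f \<in> borel_measurable M"
  shows "(\<lambda>x. cnj (f x)) \<in> borel_measurable M"
  using assms
  by (rule borel_measurable_continuous_on[rotated]) (intro continuous_intros)

lemma square_integrable_inner:
  assumes "square_integrable f" "square_integrable g"
  shows "integrable lborel (\<lambda>x. f x * cnj (g x))"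
proof -
  have [measurable]: "f \<in> borel_measurable lborel" "g \<in> borel_measurable lborel"
    using assms by (auto simp: square_integrable_def)
  have "integrable lborel (\<lambda>x. (cmod (f x))\<^sup>2 + (cmod (g x))\<^sup>2)"
    using assms by (auto simp: square_integrable_def)
  then show ?thesis
  proof (rule Bochner_Integration.integrable_bound)
    show "AE x in lborel. norm (f x * cnj (g x))
            \<le> norm ((cmod (f x))\<^sup>2 + (cmod (g x))\<^sup>2)"
    proof (rule AE_I2)
      fix x
      have "2 * (cmod (f x) * cmod (g x)) \<le> (cmod (f x))\<^sup>2 + (cmod (g x))\<^sup>2"
        using sum_squares_bound[of "cmod (f x)" "cmod (g x)"] by simp
      moreover have "0 \<le> cmod (f x) * cmod (g x)"
        by simp
      ultimately show "norm (f x * cnj (g x)) \<le> norm ((cmod (f x))\<^sup>2 + (cmod (g x))\<^sup>2)"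
        unfolding norm_mult complex_mod_cnj real_norm_def by linarith
    qed
  qed measurable
qed

text \<open>Elements of \<open>l2\<close> are classes of square integrable functions modulo equality almost
  everywhere; \<open>rep_l2\<close> picks a representative and \<open>abs_l2\<close> forms the class of a function.
  On functions that are not square integrable \<open>abs_l2\<close> is unspecified.\<close>

definition l2_eq :: "(real \<Rightarrow> complex) \<Rightarrow> (real \<Rightarrow> complex) \<Rightarrow> bool" where
  "l2_eq f g \<longleftrightarrow>
     square_integrable f \<and> square_integrable g \<and> (AE x in lborel. f x = g x)"

quotient_type l2 = "real \<Rightarrow> complex" / partial: l2_eq
  morphisms rep_l2 abs_l2
proof (rule part_equivpI)
  show "\<exists>f. l2_eq f f"
    using square_integrable_zero by (auto simp: l2_eq_def)
  show "symp l2_eq"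
    by (auto simp: symp_def l2_eq_def)
  show "transp l2_eq"
    unfolding transp_def l2_eq_def by (auto elim: eventually_elim2)
qed

lift_definition scaleC :: "complex \<Rightarrow> l2 \<Rightarrow> l2" is "\<lambda>c f x. c * f x"
  unfolding l2_eq_def by (auto intro: square_integrable_mult)

lift_definition cinner :: "l2 \<Rightarrow> l2 \<Rightarrow> complex" is
  "\<lambda>f g. LINT x|lborel. f x * cnj (g x)"
  unfolding l2_eq_def
  by (intro integral_cong_AE borel_measurable_times borel_measurable_cnj)
    (auto simp: square_integrable_def)

instantiation l2 :: ab_group_add
begin

lift_definition zero_l2 :: l2 is "\<lambda>_. 0"
  using square_integrable_zero by (simp add: l2_eq_def)

lift_definition plus_l2 :: "l2 \<Rightarrow> l2 \<Rightarrow> l2" is "\<lambda>f g x. f x + g x"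
  unfolding l2_eq_def by (auto intro: square_integrable_add)

lift_definition uminus_l2 :: "l2 \<Rightarrow> l2" is "\<lambda>f x. - f x"
  unfolding l2_eq_def using square_integrable_mult[where c = "-1"] by auto

lift_definition minus_l2 :: "l2 \<Rightarrow> l2 \<Rightarrow> l2" is "\<lambda>f g x. f x - g x"
  unfolding l2_eq_def
  using square_integrable_add[OF _ square_integrable_mult[where c = "-1"]] by auto

instance
  by standard
    (transfer; auto simp: l2_eq_def algebra_simps
       intro: square_integrable_add square_integrable_zero
         square_integrable_mult[where c = "-1", simplified]
         square_integrable_add[OF _ square_integrable_mult[where c = "-1"], simplified])+

end

lemma cinner_add_left: "cinner (f + g) h = cinner f h + cinner g h"
proof (transfer, unfold l2_eq_def)
  fix f g h :: "real \<Rightarrow> complex"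
  assume "square_integrable f \<and> square_integrable f \<and> (AE x in lborel. f x = f x)"
    "square_integrable g \<and> square_integrable g \<and> (AE x in lborel. g x = g x)"
    "square_integrable h \<and> square_integrable h \<and> (AE x in lborel. h x = h x)"
  then show "(LINT x|lborel. (f x + g x) * cnj (h x)) =
      (LINT x|lborel. f x * cnj (h x)) + (LINT x|lborel. g x * cnj (h x))"
    by (simp add: distrib_right square_integrable_inner)
qed

lemma cinner_scaleC_left: "cinner (scaleC c f) g = c * cinner f g"
  by transfer (simp add: mult.assoc)

lemma cinner_commute: "cinner f g = cnj (cinner g f)"
  by transfer (simp add: mult.commute flip: Bochner_Integration.integral_cnj)

lemma cinner_self_nonneg: "0 \<le> Re (cinner f f)"
  by transfer (simp add: complex_mult_cnj flip: cmod_power2 of_real_power)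

lemma cinner_self_eq_zero_iff: "Re (cinner f f) = 0 \<longleftrightarrow> f = 0"
proof (transfer, unfold l2_eq_def)
  fix f :: "real \<Rightarrow> complex"
  assume "square_integrable f \<and> square_integrable f \<and> (AE x in lborel. f x = f x)"
  then have f: "square_integrable f" by simp
  have "Re (LINT x|lborel. f x * cnj (f x)) = (LINT x|lborel. (cmod (f x))\<^sup>2)"
    by (simp add: complex_mult_cnj flip: cmod_power2 of_real_power)
  moreover have "(LINT x|lborel. (cmod (f x))\<^sup>2) = 0 \<longleftrightarrow> (AE x in lborel. (cmod (f x))\<^sup>2 = 0)"
    using f by (intro integral_nonneg_eq_0_iff_AE) (auto simp: square_integrable_def)
  ultimately show "(Re (LINT x|lborel. f x * cnj (f x)) = 0) =
      (square_integrable f \<and> square_integrable (\<lambda>_. 0) \<and> (AE x in lborel. f x = 0))"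
    using f square_integrable_zero by simp
qed

instantiation l2 :: real_vector
begin

definition scaleR_l2 :: "real \<Rightarrow> l2 \<Rightarrow> l2" where
  "scaleR_l2 r f = scaleC (complex_of_real r) f"

instance
proof
  fix f g :: l2 and a b :: real
  have *: "scaleC (c + d) u = scaleC c u + scaleC d u"
    "scaleC c (u + v) = scaleC c u + scaleC c v"
    "scaleC c (scaleC d u) = scaleC (c * d) u" "scaleC 1 u = u" for c d u v
    by (transfer; auto simp: l2_eq_def algebra_simps
          intro: square_integrable_add square_integrable_mult)+
  show "a *\<^sub>R (f + g) = a *\<^sub>R f + a *\<^sub>R g" "(a + b) *\<^sub>R f = a *\<^sub>R f + b *\<^sub>R f"
    "a *\<^sub>R b *\<^sub>R f = (a * b) *\<^sub>R f" "1 *\<^sub>R f = f"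
    by (simp_all add: scaleR_l2_def *)
qed

end

instantiation l2 :: real_inner
begin

definition inner_l2 :: "l2 \<Rightarrow> l2 \<Rightarrow> real" where
  "inner_l2 f g = Re (cinner f g)"

definition norm_l2 :: "l2 \<Rightarrow> real" where
  "norm_l2 f = sqrt (f \<bullet> f)"

definition sgn_l2 :: "l2 \<Rightarrow> l2" where
  "sgn_l2 f = f /\<^sub>R norm f"

definition dist_l2 :: "l2 \<Rightarrow> l2 \<Rightarrow> real" where
  "dist_l2 f g = norm (f - g)"

definition uniformity_l2 :: "(l2 \<times> l2) filter" where
  "uniformity_l2 = (INF e\<in>{0<..}. principal {(x, y). dist x y < e})"

definition open_l2 :: "l2 set \<Rightarrow> bool" where
  "open_l2 S = (\<forall>x\<in>S. \<forall>\<^sub>F (x', y) in uniformity. x' = x \<longrightarrow> y \<in> S)"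

instance
proof
  fix f g h :: l2 and a :: real
  show "f \<bullet> g = g \<bullet> f"
    unfolding inner_l2_def by (subst cinner_commute) simp
  show "(f + g) \<bullet> h = f \<bullet> h + g \<bullet> h" "(a *\<^sub>R f) \<bullet> g = a * (f \<bullet> g)"
    "0 \<le> f \<bullet> f" "f \<bullet> f = 0 \<longleftrightarrow> f = 0"
    by (simp_all add: inner_l2_def scaleR_l2_def cinner_add_left cinner_scaleC_left
        cinner_self_nonneg cinner_self_eq_zero_iff)
qed (simp_all add: norm_l2_def sgn_l2_def dist_l2_def uniformity_l2_def open_l2_def)

end


section \<open>Operators\<close>

text \<open>\<^const>\<open>bounded_linear\<close> only refers to the real vector space structure.\<close>

definition bounded_clinear :: "(l2 \<Rightarrow> l2) \<Rightarrow> bool" where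
  "bounded_clinear T \<longleftrightarrow> bounded_linear T \<and> (\<forall>c f. T (scaleC c f) = scaleC c (T f))"

definition spectrum :: "(l2 \<Rightarrow> l2) \<Rightarrow> complex set" where
  "spectrum T = {z. \<not> (\<exists>S. bounded_clinear S \<and>
     (\<forall>f. S (scaleC z f - T f) = f) \<and> (\<forall>f. scaleC z (S f) - T (S f) = f))}"

text \<open>The continuous functional calculus of a bounded normal operator \<open>T\<close> is the unique unital
  \<open>*\<close>-homomorphism from the continuous functions on the spectrum of \<open>T\<close> to the bounded
  operators that maps the identity function to \<open>T\<close>. Functions on the spectrum are represented
  by functions on the whole plane, of which only the values on the spectrum matter.\<close>

definition functional_calculus ::
    "(l2 \<Rightarrow> l2) \<Rightarrow> ((complex \<Rightarrow> complex) \<Rightarrow> l2 \<Rightarrow> l2) \<Rightarrow> bool" where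
  "functional_calculus T \<Phi> \<longleftrightarrow>
     (\<forall>p. continuous_on (spectrum T) p \<longrightarrow> bounded_clinear (\<Phi> p)) \<and>
     (\<forall>p q. continuous_on (spectrum T) p \<and> (\<forall>z\<in>spectrum T. p z = q z) \<longrightarrow> \<Phi> p = \<Phi> q) \<and>
     (\<forall>p q. continuous_on (spectrum T) p \<and> continuous_on (spectrum T) q \<longrightarrow>
        (\<forall>f. \<Phi> (\<lambda>z. p z + q z) f = \<Phi> p f + \<Phi> q f) \<and>
        (\<forall>f. \<Phi> (\<lambda>z. p z * q z) f = \<Phi> p (\<Phi> q f))) \<and>
     (\<forall>c p. continuous_on (spectrum T) p \<longrightarrow> (\<forall>f. \<Phi> (\<lambda>z. c * p z) f = scaleC c (\<Phi> p f))) \<and>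
     (\<forall>p. continuous_on (spectrum T) p \<longrightarrow>
        (\<forall>f g. cinner (\<Phi> p f) g = cinner f (\<Phi> (\<lambda>z. cnj (p z)) g))) \<and>
     \<Phi> (\<lambda>_. 1) = id \<and> \<Phi> (\<lambda>z. z) = T"

definition apply_fun :: "(complex \<Rightarrow> complex) \<Rightarrow> (l2 \<Rightarrow> l2) \<Rightarrow> l2 \<Rightarrow> l2" where
  "apply_fun p T = (THE S. \<exists>\<Phi>. functional_calculus T \<Phi> \<and> S = \<Phi> p)"

definition generator_dom :: "(real \<Rightarrow> l2 \<Rightarrow> l2) \<Rightarrow> l2 set" where
  "generator_dom S = {f. \<exists>g. ((\<lambda>h. (S h f - f) /\<^sub>R h) \<longlongrightarrow> g) (at_right 0)}"

definition generator :: "(real \<Rightarrow> l2 \<Rightarrow> l2) \<Rightarrow> l2 \<Rightarrow> l2" where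
  "generator S f = Lim (at_right 0) (\<lambda>h. (S h f - f) /\<^sub>R h)"

text \<open>\<open>R\<close> is a bounded inverse of the operator \<open>A\<close> with domain \<open>D\<close>.\<close>

definition is_bounded_inverse :: "l2 set \<Rightarrow> (l2 \<Rightarrow> l2) \<Rightarrow> (l2 \<Rightarrow> l2) \<Rightarrow> bool" where
  "is_bounded_inverse D A R \<longleftrightarrow> bounded_clinear R \<and>
     (\<forall>g. R g \<in> D \<and> A (R g) = g) \<and> (\<forall>f\<in>D. R (A f) = f)"


section \<open>The Cesaro operator and its logarithm\<close>

definition cesaro :: "l2 \<Rightarrow> l2" where
  "cesaro f = abs_l2 (\<lambda>x. complex_of_real (1 / x) * (LBINT t=0..ereal x. rep_l2 f t))"

text \<open>\<open>(powr)\<close> is the principal branch off zero, and \<open>0 powr a = 0\<close>.\<close>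

definition cesaro_power :: "real \<Rightarrow> l2 \<Rightarrow> l2" where
  "cesaro_power \<alpha> =
     (if \<alpha> = 0 then id else apply_fun (\<lambda>z. z powr complex_of_real \<alpha>) cesaro)"

definition log_cesaro_dom :: "l2 set" where
  "log_cesaro_dom = generator_dom cesaro_power"

definition log_cesaro :: "l2 \<Rightarrow> l2" where
  "log_cesaro = generator cesaro_power"


section \<open>The algebra of Hausdorff operators\<close>

definition admissible_kernel :: "(real \<Rightarrow> complex) \<Rightarrow> bool" where
  "admissible_kernel K \<longleftrightarrow> K \<in> borel_measurable lborel \<and>
     integrable lborel (\<lambda>u. K u * complex_of_real (\<bar>u\<bar> powr (-1/2)))"

definition hausdorff_op :: "(real \<Rightarrow> complex) \<Rightarrow> l2 \<Rightarrow> l2" where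
  "hausdorff_op K f = abs_l2 (\<lambda>x. LINT u|lborel. K u * rep_l2 f (u * x))"

definition hausdorff_algebra :: "(l2 \<Rightarrow> l2) set" where
  "hausdorff_algebra = {hausdorff_op K |K. admissible_kernel K}"

text \<open>The kernel of an operator in the algebra is unique up to equality almost everywhere, so
  the choice of the kernel does not affect the symbol.\<close>

definition kernel_of :: "(l2 \<Rightarrow> l2) \<Rightarrow> real \<Rightarrow> complex" where
  "kernel_of T = (SOME K. admissible_kernel K \<and> T = hausdorff_op K)"

definition scalar_symbol :: "(l2 \<Rightarrow> l2) \<Rightarrow> real \<Rightarrow> complex" where
  "scalar_symbol T s = (LINT u|lborel. kernel_of T u *
     (complex_of_real (\<bar>u\<bar> powr (-1/2)) * exp (- \<i> * complex_of_real s * complex_of_real (ln \<bar>u\<bar>))))"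

end

theory Submission
  imports Defs "HOL-Complex_Analysis.Complex_Analysis"
begin

text \<open>
  On functions that behave like \<open>\<bar>x\<bar> powr (-1/2 - \<i> s)\<close>, and on their products with the sign function, the
  Cesaro operator \<open>C\<close> is multiplication by \<open>z = 1 / w\<close> with \<open>w = 1/2 - \<i> s\<close>. So \<open>C\<^sup>h\<close> is multiplication
  by \<open>z\<^sup>h\<close>, the generator \<open>log C\<close> is multiplication by \<open>Ln z = - Ln w\<close>, and its inverse has to be
  \<open>R = r(C)\<close> with \<open>r z = 1 / Ln z\<close>. This function is bounded and continuous on the circle
  \<open>\<bar>z - 1\<bar> = 1\<close>: the only zero \<open>1\<close> of \<open>Ln\<close> is not on the circle, and \<open>1 / Ln z\<close> tends to \<open>0\<close> as \<open>z\<close> tends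
  to \<open>0\<close>. What remains is to make sense of \<open>r(C)\<close>, to compare it with the generator, and to recognise it
  as a Hausdorff operator.

  \<^emph>\<open>Functions of \<open>C\<close>.\<close> The kernel of \<open>C\<close> is the indicator function of the unit interval, and the kernel of its
  adjoint \<open>A\<close> is \<open>1 / u\<close> for \<open>u > 1\<close>. Convolution of the two gives \<open>A C = C A = A + C\<close>, that is, \<open>U = C - 1\<close> is
  unitary. Instead of a spectral measure, averages over roots of unity are used: for \<open>\<omega>\<^sup>N = 1\<close> the
  vectors \<open>(1/N) (\<Sum>j<N. \<omega>\<^sup>-\<^sup>j U\<^sup>j f)\<close> add up to \<open>f\<close>, satisfy a Parseval identity, and are eigenvectors of \<open>U\<close>
  for the eigenvalue \<open>\<omega>\<close> up to \<open>2 \<parallel>f\<parallel> / N\<close>. For operators \<open>S = p(C)\<close> and \<open>T = q(C)\<close>, characterised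
  in \<open>calc_def\<close> by their action on such approximate eigenvectors, \<open>\<langle>S f, T f\<rangle>\<close> is therefore a limit of weighted
  sums of values of \<open>p\<close> and \<open>cnj q\<close> on the circle (\<open>calc_trace_pair\<close>). This gives \<open>\<parallel>S f\<parallel> \<le> sup \<bar>p\<bar> \<parallel>f\<parallel>\<close>
  (\<open>calc_bound\<close>), and with the Stone--Weierstrass theorem and the completeness of the space a continuous
  functional calculus, which is the only one (\<open>functional_calculus_unique\<close>). Truncations of the functions
  above show that the spectrum is the whole circle (\<open>spectrum_cesaro\<close>).

  \<^emph>\<open>The generator.\<close> The difference quotients satisfy \<open>(C\<^sup>h - 1) / h R = m\<^sub>h(C)\<close> with
  \<open>m\<^sub>h z = (z\<^sup>h - 1) / (h Ln z)\<close>. The functions \<open>m\<^sub>h\<close> are uniformly bounded for \<open>h \<le> 1\<close>, and \<open>z m\<^sub>h z\<close> converges to \<open>z\<close> uniformly on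
  the circle. Since \<open>C\<close> has dense range (\<open>cesaro_range_dense\<close>), \<open>m\<^sub>h(C)\<close> converges strongly to the identity
  (\<open>log_quotient_tendsto\<close>), which says that \<open>R\<close> is the inverse of \<open>log C\<close>.

  \<^emph>\<open>The kernel.\<close> The residue theorem on long rectangles in the strip \<open>\<bar>Im \<zeta>\<bar> \<le> \<pi>\<close> yields the representation
  \<open>1 / Ln z = cnj z - \<integral> exp y / (\<pi>\<^sup>2 + y\<^sup>2) * z / (1 + exp y * z) dy\<close> on the circle (\<open>inv_log_integral\<close>).
  Here \<open>cnj z\<close> belongs to the adjoint \<open>A\<close>, and \<open>z / (1 + a z)\<close> belongs to the Hausdorff operator with
  kernel \<open>u powr a\<close> on the unit interval. So \<open>R\<close> is a superposition of Hausdorff operators with explicit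
  kernels, hence a Hausdorff operator itself (\<open>inv_log_hausdorff\<close>). Its symbol at \<open>s\<close> is the limit of
  \<open>\<langle>R e, e\<rangle>\<close> along truncations \<open>e\<close> of \<open>\<bar>x\<bar> powr (-1/2 - \<i> s)\<close>, and the functional calculus evaluates this limit
  to \<open>r (1 / w) = - 1 / Ln w\<close>.
\<close>

section \<open>The complex Hilbert space\<close>

lemma scaleC_add_right: "scaleC c (f + g) = scaleC c f + scaleC c g"
  by transfer (auto simp: l2_eq_def algebra_simps intro: square_integrable_add square_integrable_mult)

lemma scaleC_add_left: "scaleC (c + d) f = scaleC c f + scaleC d f"
  by transfer (auto simp: l2_eq_def algebra_simps intro: square_integrable_add square_integrable_mult)

lemma scaleC_scaleC [simp]: "scaleC c (scaleC d f) = scaleC (c * d) f"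
  by transfer (auto simp: l2_eq_def algebra_simps intro: square_integrable_mult)

lemma scaleC_one [simp]: "scaleC 1 f = f"
  by transfer (auto simp: l2_eq_def)

lemma scaleR_scaleC: "r *\<^sub>R f = scaleC (complex_of_real r) f"
  by (simp add: scaleR_l2_def)

lemma scaleC_minus_right: "scaleC c (f - g) = scaleC c f - scaleC c g"
  using scaleC_add_right[of c "f - g" g] by simp

lemma scaleC_minus_left: "scaleC (c - d) f = scaleC c f - scaleC d f"
  using scaleC_add_left[of "c - d" d f] by simp

lemma scaleC_zero_left [simp]: "scaleC 0 f = 0"
  using scaleC_minus_left[of 0 0 f] by simp

lemma scaleC_zero_right [simp]: "scaleC c 0 = 0"
  using scaleC_minus_right[of c 0 0] by simp

lemma scaleC_uminus_left [simp]: "scaleC (- c) f = - scaleC c f"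
  using scaleC_minus_left[of 0 c f] by simp

lemma scaleC_uminus_right [simp]: "scaleC c (- f) = - scaleC c f"
  using scaleC_minus_right[of c 0 f] by simp

lemma scaleC_sum_right: "scaleC c (sum f A) = (\<Sum>i\<in>A. scaleC c (f i))"
  by (induction A rule: infinite_finite_induct) (simp_all add: scaleC_add_right)

lemma cinner_add_right: "cinner f (g + h) = cinner f g + cinner f h"
  by (metis cinner_add_left cinner_commute complex_cnj_add)

lemma cinner_scaleC_right: "cinner f (scaleC c g) = cnj c * cinner f g"
  by (metis cinner_scaleC_left cinner_commute complex_cnj_mult)

lemma cinner_zero_left [simp]: "cinner 0 g = 0"
  using cinner_scaleC_left[of 0 0 g] by simp

lemma cinner_zero_right [simp]: "cinner g 0 = 0"
  using cinner_scaleC_right[of g 0 0] by simp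

lemma cinner_minus_left: "cinner (f - g) h = cinner f h - cinner g h"
  using cinner_add_left[of "f - g" g h] by simp

lemma cinner_minus_right: "cinner f (g - h) = cinner f g - cinner f h"
  using cinner_add_right[of f "g - h" h] by simp

lemma cinner_sum_left: "cinner (sum f A) g = (\<Sum>i\<in>A. cinner (f i) g)"
  by (induction A rule: infinite_finite_induct) (simp_all add: cinner_add_left)

lemma cinner_sum_right: "cinner g (sum f A) = (\<Sum>i\<in>A. cinner g (f i))"
  by (induction A rule: infinite_finite_induct) (simp_all add: cinner_add_right)

lemma cinner_self: "cinner f f = complex_of_real ((norm f)\<^sup>2)"
proof -
  have "Im (cinner f f) = 0"
    using arg_cong[OF cinner_commute[of f f], of Im] by simp
  moreover have "Re (cinner f f) = (norm f)\<^sup>2"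
    by (simp add: power2_norm_eq_inner inner_l2_def)
  ultimately show ?thesis
    by (simp add: complex_eq_iff)
qed

lemma norm_scaleC [simp]: "norm (scaleC c f) = cmod c * norm f"
proof -
  have "complex_of_real ((norm (scaleC c f))\<^sup>2) = (c * cnj c) * complex_of_real ((norm f)\<^sup>2)"
    unfolding cinner_self[symmetric] cinner_scaleC_left cinner_scaleC_right by (simp add: mult.assoc)
  also have "\<dots> = complex_of_real ((cmod c * norm f)\<^sup>2)"
    by (simp only: complex_norm_square[symmetric] of_real_mult power_mult_distrib of_real_power)
  finally have "(norm (scaleC c f))\<^sup>2 = (cmod c * norm f)\<^sup>2"
    by (simp only: of_real_eq_iff)
  then show ?thesis
    by (rule power2_eq_imp_eq) auto
qed

text \<open>The Cauchy--Schwarz inequality of the real inner product bounds only the real part of \<open>cinner f g\<close>; the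
  factor \<open>u\<close> rotates \<open>cinner f g\<close> onto the positive real axis.\<close>

lemma cmod_cinner_le: "cmod (cinner f g) \<le> norm f * norm g"
proof (cases "cinner f g = 0")
  case False
  define u where "u = cnj (cinner f g) / of_real (cmod (cinner f g))"
  have u: "cmod u = 1"
    using False by (simp add: u_def norm_divide)
  have "u * cinner f g = complex_of_real (cmod (cinner f g))"
    using False by (simp add: u_def complex_norm_square[symmetric] power2_eq_square field_simps)
  then have "cmod (cinner f g) = scaleC u f \<bullet> g"
    by (simp add: inner_l2_def cinner_scaleC_left)
  also have "\<dots> \<le> norm (scaleC u f) * norm g"
    by (rule norm_cauchy_schwarz)
  finally show ?thesis
    using u by simp
qed simp

lemma cinner_eqI:
  assumes "\<And>g. cinner f g = cinner h g"
  shows "f = h"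
proof -
  have "cinner (f - h) (f - h) = 0"
    using assms by (simp only: cinner_minus_left) simp
  then show ?thesis by (simp add: cinner_self)
qed

lemma bounded_clinearI:
  assumes "\<And>f g. S (f + g) = S f + S g" "\<And>c f. S (scaleC c f) = scaleC c (S f)"
    "\<And>f. norm (S f) \<le> K * norm f"
  shows "bounded_clinear S"
  unfolding bounded_clinear_def
  using assms by (auto intro!: bounded_linear_intro[where K = K] simp: scaleR_scaleC mult.commute)

lemma bounded_clinear_add: "bounded_clinear S \<Longrightarrow> S (f + g) = S f + S g"
  unfolding bounded_clinear_def by (auto simp: linear_simps)

lemma bounded_clinear_diff: "bounded_clinear S \<Longrightarrow> S (f - g) = S f - S g"
  unfolding bounded_clinear_def by (auto simp: linear_simps)

lemma bounded_clinear_zero: "bounded_clinear S \<Longrightarrow> S 0 = 0"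
  unfolding bounded_clinear_def by (auto simp: linear_simps)

lemma bounded_clinear_scaleC: "bounded_clinear S \<Longrightarrow> S (scaleC c f) = scaleC c (S f)"
  unfolding bounded_clinear_def by auto

lemma bounded_clinear_sum: "bounded_clinear S \<Longrightarrow> S (sum f A) = (\<Sum>i\<in>A. S (f i))"
  by (induction A rule: infinite_finite_induct) (simp_all add: bounded_clinear_add bounded_clinear_zero)

lemma bounded_clinear_ex_bound:
  "bounded_clinear S \<Longrightarrow> \<exists>B\<ge>0. \<forall>f. norm (S f) \<le> B * norm f"
  using bounded_linear.nonneg_bounded[of S]
  unfolding bounded_clinear_def by (simp add: mult.commute)

lemma bounded_clinear_tendsto:
  assumes "bounded_clinear S" "(f \<longlongrightarrow> g) F"
  shows "((\<lambda>x. S (f x)) \<longlongrightarrow> S g) F"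
  using assms unfolding bounded_clinear_def by (auto intro: bounded_linear.tendsto)

lemma bounded_clinear_scaleC_const: "bounded_clinear (scaleC c)"
  by (rule bounded_clinearI[where K = "cmod c"]) (simp_all add: scaleC_add_right mult.commute)

lemma bounded_clinear_id: "bounded_clinear id" "bounded_clinear (\<lambda>f. f)"
  by (rule bounded_clinearI[where K = 1]; simp)+

lemma bounded_clinear_plus:
  assumes "bounded_clinear S" "bounded_clinear T"
  shows "bounded_clinear (\<lambda>f. S f + T f)"
  using assms unfolding bounded_clinear_def
  by (auto intro: bounded_linear_add simp: scaleC_add_right)

lemma bounded_clinear_minus:
  assumes "bounded_clinear S" "bounded_clinear T"
  shows "bounded_clinear (\<lambda>f. S f - T f)"
  using assms unfolding bounded_clinear_def
  by (auto intro: bounded_linear_sub simp: scaleC_minus_right)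

lemma bounded_clinear_compose:
  assumes "bounded_clinear S" "bounded_clinear T"
  shows "bounded_clinear (\<lambda>f. S (T f))"
  using assms unfolding bounded_clinear_def
  by (auto intro: bounded_linear_compose)

text \<open>Polarisation: the diagonal values at \<open>f + g\<close> and \<open>f + \<i> g\<close> give \<open>s f g + s g f = 0\<close> and
  \<open>s f g - s g f = 0\<close>. An operator on a complex space is thus determined by its quadratic form.\<close>

lemma sesquilinear_eq_0:
  fixes s :: "l2 \<Rightarrow> l2 \<Rightarrow> complex"
  assumes add: "\<And>f g h. s (f + g) h = s f h + s g h" "\<And>f g h. s h (f + g) = s h f + s h g"
    and scale: "\<And>c f g. s (scaleC c f) g = c * s f g" "\<And>c f g. s f (scaleC c g) = cnj c * s f g"
    and diag: "\<And>f. s f f = 0"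
  shows "s f g = 0"
proof -
  have expand: "s (f + h) (f + h) = s f f + s f h + s h f + s h h" for h
    by (simp only: add add_ac)
  have "s f g + s g f = 0"
    using expand[of g] by (simp add: diag)
  moreover have "s f g - s g f = 0"
    using expand[of "scaleC \<i> g"] by (simp add: diag scale)
  ultimately show ?thesis by (simp add: complex_eq_iff)
qed

lemma bounded_clinear_eqI:
  assumes S: "bounded_clinear S" and T: "bounded_clinear T" and diag: "\<And>f. cinner (S f) f = cinner (T f) f"
  shows "S = T"
proof
  fix f
  have "cinner (S f) g - cinner (T f) g = 0" for g
    by (rule sesquilinear_eq_0[where s = "\<lambda>f g. cinner (S f) g - cinner (T f) g"])
      (simp_all add: bounded_clinear_add[OF S] bounded_clinear_add[OF T] bounded_clinear_scaleC[OF S]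
        bounded_clinear_scaleC[OF T] cinner_add_left cinner_add_right cinner_scaleC_left
        cinner_scaleC_right diag algebra_simps)
  then show "S f = T f"
    by (intro cinner_eqI) simp
qed

subsection \<open>Representatives\<close>

lemma square_integrable_rep [simp, intro]: "square_integrable (rep_l2 f)"
  using Quotient_rep_reflp[OF Quotient_l2, of f] by (simp add: l2_eq_def)

lemma rep_l2_measurable [measurable]: "rep_l2 f \<in> borel_measurable borel"
  using square_integrable_rep[of f] by (simp add: square_integrable_def)

lemma abs_rep_l2 [simp]: "abs_l2 (rep_l2 f) = f"
  using Quotient_abs_rep[OF Quotient_l2] .

lemma rep_abs_l2:
  assumes "square_integrable F"
  shows "AE x in lborel. rep_l2 (abs_l2 F) x = F x"
  using Quotient_rep_abs[OF Quotient_l2, of F] assms by (simp add: l2_eq_def)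

lemma abs_l2_eqI:
  assumes "square_integrable F" "square_integrable G" "AE x in lborel. F x = G x"
  shows "abs_l2 F = abs_l2 G"
  using Quotient_rel_abs[OF Quotient_l2, of F G] assms by (simp add: l2_eq_def)

lemma abs_l2_eq_iff:
  assumes "square_integrable F"
  shows "abs_l2 F = f \<longleftrightarrow> (AE x in lborel. F x = rep_l2 f x)"
proof
  assume "abs_l2 F = f"
  then show "AE x in lborel. F x = rep_l2 f x"
    using rep_abs_l2[OF assms] by (auto elim: eventually_mono)
next
  assume "AE x in lborel. F x = rep_l2 f x"
  then show "abs_l2 F = f"
    using abs_l2_eqI[OF assms square_integrable_rep[of f]] by simp
qed

lemma rep_plus_l2: "AE x in lborel. rep_l2 (f + g) x = rep_l2 f x + rep_l2 g x"
  unfolding plus_l2.abs_eq[of "rep_l2 f" "rep_l2 g", unfolded l2_eq_def abs_rep_l2, simplified]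
  by (intro rep_abs_l2 square_integrable_add) auto

lemma rep_minus_l2: "AE x in lborel. rep_l2 (f - g) x = rep_l2 f x - rep_l2 g x"
proof -
  have "AE x in lborel. rep_l2 (f - g) x + rep_l2 g x = rep_l2 f x"
    using rep_plus_l2[of "f - g" g] by (auto elim: eventually_mono)
  then show ?thesis
    by (auto elim!: eventually_mono simp: eq_diff_eq)
qed

lemma cinner_rep: "cinner f g = (LINT x|lborel. rep_l2 f x * cnj (rep_l2 g x))"
  using cinner.abs_eq[of "rep_l2 f" "rep_l2 g"] by (simp add: l2_eq_def)

lemma cinner_abs:
  assumes "square_integrable F" "square_integrable G"
  shows "cinner (abs_l2 F) (abs_l2 G) = (LINT x|lborel. F x * cnj (G x))"
  using assms by (subst cinner.abs_eq) (auto simp: l2_eq_def)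

lemma norm_abs_l2:
  assumes "square_integrable F"
  shows "(norm (abs_l2 F))\<^sup>2 = (LINT x|lborel. (cmod (F x))\<^sup>2)"
proof -
  have "complex_of_real ((norm (abs_l2 F))\<^sup>2) = (LINT x|lborel. F x * cnj (F x))"
    by (simp only: cinner_self[symmetric] cinner_abs[OF assms assms])
  also have "\<dots> = complex_of_real (LINT x|lborel. (cmod (F x))\<^sup>2)"
    by (simp add: complex_norm_square[symmetric] del: of_real_power)
  finally show ?thesis by (simp only: of_real_eq_iff)
qed

lemma norm_rep_l2: "(norm f)\<^sup>2 = (LINT x|lborel. (cmod (rep_l2 f x))\<^sup>2)"
  using norm_abs_l2[OF square_integrable_rep[of f]] by simp

lemma square_integrable_iff_nn:
  assumes "F \<in> borel_measurable borel"
  shows "square_integrable F \<longleftrightarrow> (\<integral>\<^sup>+x. ennreal ((cmod (F x))\<^sup>2) \<partial>lborel) < \<infinity>"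
  using assms unfolding square_integrable_def by (simp add: integrable_iff_bounded)

lemma nn_integral_rep_l2: "(\<integral>\<^sup>+x. ennreal ((cmod (rep_l2 f x))\<^sup>2) \<partial>lborel) = ennreal ((norm f)\<^sup>2)"
  unfolding norm_rep_l2
  by (intro nn_integral_eq_integral) (use square_integrable_rep[of f] in \<open>auto simp: square_integrable_def\<close>)

subsection \<open>Completeness\<close>

text \<open>Fatou's lemma turns a bound on the distances along the sequence into one for the pointwise limit.\<close>

lemma square_integrable_limit:
  assumes meas [measurable]: "F \<in> borel_measurable borel"
    and conv: "AE x in lborel. (\<lambda>m. rep_l2 (X m) x) \<longlonglongrightarrow> F x"
    and bound: "\<forall>\<^sub>F m in sequentially. norm (X m - g) \<le> e"
    and "e \<ge> 0"
  shows "(\<integral>\<^sup>+x. ennreal ((cmod (F x - rep_l2 g x))\<^sup>2) \<partial>lborel) \<le> ennreal (e\<^sup>2)"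
proof -
  have "AE x in lborel. \<forall>m. rep_l2 (X m - g) x = rep_l2 (X m) x - rep_l2 g x"
    unfolding AE_all_countable using rep_minus_l2 by auto
  with conv have "AE x in lborel. ennreal ((cmod (F x - rep_l2 g x))\<^sup>2)
      = liminf (\<lambda>m. ennreal ((cmod (rep_l2 (X m - g) x))\<^sup>2))"
  proof eventually_elim
    case (elim x)
    then have "(\<lambda>m. ennreal ((cmod (rep_l2 (X m - g) x))\<^sup>2)) \<longlonglongrightarrow> ennreal ((cmod (F x - rep_l2 g x))\<^sup>2)"
      by (auto intro!: tendsto_intros)
    from lim_imp_Liminf[OF _ this] show ?case
      by simp
  qed
  then have "(\<integral>\<^sup>+x. ennreal ((cmod (F x - rep_l2 g x))\<^sup>2) \<partial>lborel)
      = (\<integral>\<^sup>+x. liminf (\<lambda>m. ennreal ((cmod (rep_l2 (X m - g) x))\<^sup>2)) \<partial>lborel)"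
    by (rule nn_integral_cong_AE)
  also have "\<dots> \<le> liminf (\<lambda>m. \<integral>\<^sup>+x. ennreal ((cmod (rep_l2 (X m - g) x))\<^sup>2) \<partial>lborel)"
    by (rule nn_integral_liminf) measurable
  also have "\<dots> = liminf (\<lambda>m. ennreal ((norm (X m - g))\<^sup>2))"
    by (simp add: nn_integral_rep_l2)
  also have "\<dots> \<le> liminf (\<lambda>m::nat. ennreal (e\<^sup>2))"
    by (intro Liminf_mono eventually_mono[OF bound] ennreal_leI power_mono) auto
  also have "\<dots> = ennreal (e\<^sup>2)"
    by (simp add: Liminf_const)
  finally show ?thesis .
qed

text \<open>The pointwise part of the Riesz--Fischer theorem. If consecutive distances are at most \<open>2\<^sup>-\<^sup>n\<close>, the
  series of \<open>2\<^sup>n\<close> times the squared increments has finite integral, so almost everywhere the increments decay geometrically.\<close>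

lemma fast_Cauchy_pointwise:
  fixes X :: "nat \<Rightarrow> l2"
  assumes "\<And>n. norm (X (Suc n) - X n) \<le> (1/2) ^ n"
  shows "AE x in lborel. convergent (\<lambda>n. rep_l2 (X n) x)"
proof -
  define d where "d n x = cmod (rep_l2 (X (Suc n) - X n) x)" for n x
  have [measurable]: "d n \<in> borel_measurable borel" for n
    unfolding d_def by measurable
  have "(\<integral>\<^sup>+x. (\<Sum>n. ennreal (2 ^ n * (d n x)\<^sup>2)) \<partial>lborel) = (\<Sum>n. \<integral>\<^sup>+x. ennreal (2 ^ n * (d n x)\<^sup>2) \<partial>lborel)"
    by (rule nn_integral_suminf) measurable
  also have "\<dots> = (\<Sum>n. ennreal (2 ^ n * (norm (X (Suc n) - X n))\<^sup>2))"
    by (simp add: ennreal_mult nn_integral_cmult d_def nn_integral_rep_l2)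
  also have "\<dots> \<le> (\<Sum>n. ennreal ((1/2) ^ n))"
  proof (intro suminf_le ennreal_leI)
    fix n
    have "2 ^ n * (norm (X (Suc n) - X n))\<^sup>2 \<le> 2 ^ n * ((1/2) ^ n)\<^sup>2"
      using assms[of n] by (intro mult_left_mono power_mono) auto
    also have "\<dots> = (1/2) ^ n"
      by (simp add: power2_eq_square power_divide)
    finally show "2 ^ n * (norm (X (Suc n) - X n))\<^sup>2 \<le> (1/2) ^ n" .
  qed auto
  also have "\<dots> = ennreal (\<Sum>n. (1/2) ^ n)"
    by (intro suminf_ennreal2) (auto simp: summable_geometric)
  also have "\<dots> < \<infinity>" by simp
  finally have "AE x in lborel. (\<Sum>n. ennreal (2 ^ n * (d n x)\<^sup>2)) \<noteq> \<infinity>"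
    by (intro nn_integral_PInf_AE) auto
  moreover have "AE x in lborel. \<forall>n. rep_l2 (X (Suc n) - X n) x = rep_l2 (X (Suc n)) x - rep_l2 (X n) x"
    unfolding AE_all_countable using rep_minus_l2 by auto
  ultimately show ?thesis
  proof eventually_elim
    case (elim x)
    have "summable (\<lambda>n. 2 ^ n * (d n x)\<^sup>2)"
      using elim(1) by (intro summable_suminf_not_top) (auto simp: d_def)
    then have "(\<lambda>n. 2 ^ n * (d n x)\<^sup>2) \<longlonglongrightarrow> 0"
      by (rule summable_LIMSEQ_zero)
    then have "\<forall>\<^sub>F n in sequentially. 2 ^ n * (d n x)\<^sup>2 < 1"
      by (rule order_tendstoD) simp
    then have "\<forall>\<^sub>F n in sequentially. norm (rep_l2 (X (Suc n)) x - rep_l2 (X n) x) \<le> (sqrt (1/2)) ^ n"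
    proof eventually_elim
      case (elim n)
      have "(d n x)\<^sup>2 \<le> (1/2) ^ n"
        using elim by (simp add: field_simps power_divide)
      also have "\<dots> = (sqrt (1/2))\<^sup>2 ^ n"
        by simp
      also have "\<dots> = (sqrt (1/2) ^ n)\<^sup>2"
        by (simp only: power_mult[symmetric] mult.commute)
      finally have "d n x \<le> sqrt (1/2) ^ n"
        by (rule power2_le_imp_le) simp
      then show ?case
        using \<open>\<forall>n. rep_l2 (X (Suc n) - X n) x = _\<close> by (simp add: d_def)
    qed
    moreover have "summable (\<lambda>n. sqrt (1/2) ^ n)"
      by (intro summable_geometric) (simp add: real_sqrt_divide)
    ultimately have "summable (\<lambda>n. rep_l2 (X (Suc n)) x - rep_l2 (X n) x)"
      by (rule summable_comparison_test_ev)
    then obtain L where "(\<lambda>n. rep_l2 (X n) x - rep_l2 (X 0) x) \<longlonglongrightarrow> L"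
      unfolding summable_def sums_def
      by (auto simp: sum_lessThan_telescope[where f = "\<lambda>n. rep_l2 (X n) x"])
    from tendsto_add[OF this tendsto_const[of "rep_l2 (X 0) x"]] show ?case
      by (auto intro: convergentI)
  qed
qed

text \<open>A sufficiently sparse subsequence converges almost everywhere, and by Fatou's lemma its pointwise
  limit is the limit of the whole Cauchy sequence in the norm.\<close>

instance l2 :: banach
proof
  fix X :: "nat \<Rightarrow> l2"
  assume X: "Cauchy X"
  have "\<exists>r. strict_mono r \<and> (\<forall>n. norm (X (r (Suc n)) - X (r n)) \<le> (1/2) ^ n)"
  proof -
    have "\<exists>M. \<forall>m\<ge>M. \<forall>k\<ge>M. norm (X m - X k) < (1/2) ^ n" for n
      using X unfolding Cauchy_iff by (metis zero_less_divide_1_iff zero_less_numeral zero_less_power)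
    then obtain M where M: "\<And>n m k. m \<ge> M n \<Longrightarrow> k \<ge> M n \<Longrightarrow> norm (X m - X k) < (1/2) ^ n"
      by metis
    define r where "r = rec_nat (M 0) (\<lambda>n p. max (Suc p) (M (Suc n)))"
    have rS: "r (Suc n) = max (Suc (r n)) (M (Suc n))" for n
      by (simp add: r_def)
    have "r n \<ge> M n" for n
      by (cases n) (simp_all add: r_def)
    moreover have "strict_mono r"
      by (rule strict_monoI_Suc) (simp add: rS)
    ultimately show ?thesis
      using M by (metis less_eq_real_def rS max.cobounded1 Suc_leD order_trans)
  qed
  then obtain r where r: "strict_mono r" "\<And>n. norm (X (r (Suc n)) - X (r n)) \<le> (1/2) ^ n"
    by blast
  define F where "F x = lim (\<lambda>n. rep_l2 (X (r n)) x)" for x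
  have [measurable]: "F \<in> borel_measurable borel"
    unfolding F_def by (intro borel_measurable_lim_metric) measurable
  have conv: "AE x in lborel. (\<lambda>n. rep_l2 (X (r n)) x) \<longlonglongrightarrow> F x"
    using fast_Cauchy_pointwise[of "\<lambda>n. X (r n)", OF r(2)]
    by eventually_elim (simp add: F_def convergent_LIMSEQ_iff)
  have key: "\<forall>\<^sub>F k in sequentially. (\<integral>\<^sup>+x. ennreal ((cmod (F x - rep_l2 (X k) x))\<^sup>2) \<partial>lborel) \<le> ennreal (e\<^sup>2)"
    if "e > 0" for e
  proof -
    obtain M where M: "\<And>m k. m \<ge> M \<Longrightarrow> k \<ge> M \<Longrightarrow> norm (X m - X k) < e"
      using X \<open>e > 0\<close> unfolding Cauchy_iff by metis
    have "r m \<ge> M" if "m \<ge> M" for m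
      using seq_suble[OF r(1), of m] that by simp
    then have "\<forall>\<^sub>F m in sequentially. norm (X (r m) - X k) \<le> e" if "k \<ge> M" for k
      using M that by (intro eventually_sequentiallyI[of M]) (auto intro: less_imp_le)
    then show ?thesis
      using \<open>e > 0\<close> square_integrable_limit[OF _ conv] by (intro eventually_sequentiallyI[of M]) auto
  qed
  obtain k where k: "(\<integral>\<^sup>+x. ennreal ((cmod (F x - rep_l2 (X k) x))\<^sup>2) \<partial>lborel) \<le> ennreal (1\<^sup>2)"
    using eventually_happens[OF key[of 1]] by auto
  then have "square_integrable (\<lambda>x. F x - rep_l2 (X k) x)"
    by (subst square_integrable_iff_nn) (auto intro: le_less_trans)
  from square_integrable_add[OF this square_integrable_rep[of "X k"]]
  have F: "square_integrable F" by simp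
  have "\<forall>\<^sub>F k in sequentially. norm (X k - abs_l2 F) < e" if "e > 0" for e
    using key[OF half_gt_zero[OF that]]
  proof eventually_elim
    case (elim k)
    have "AE x in lborel. rep_l2 (X k - abs_l2 F) x = rep_l2 (X k) x - F x"
      using rep_minus_l2[of "X k" "abs_l2 F"] rep_abs_l2[OF F] by eventually_elim simp
    then have "(\<integral>\<^sup>+x. ennreal ((cmod (rep_l2 (X k - abs_l2 F) x))\<^sup>2) \<partial>lborel)
        = (\<integral>\<^sup>+x. ennreal ((cmod (F x - rep_l2 (X k) x))\<^sup>2) \<partial>lborel)"
      by (intro nn_integral_cong_AE) (auto elim!: eventually_mono simp: norm_minus_commute)
    with elim have "ennreal ((norm (X k - abs_l2 F))\<^sup>2) \<le> ennreal ((e/2)\<^sup>2)"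
      by (simp add: nn_integral_rep_l2)
    then have "(norm (X k - abs_l2 F))\<^sup>2 \<le> (e/2)\<^sup>2"
      using \<open>e > 0\<close> by (subst (asm) ennreal_le_iff) auto
    then have "norm (X k - abs_l2 F) \<le> e/2"
      by (rule power2_le_imp_le) (use \<open>e > 0\<close> in simp)
    then show ?case using \<open>e > 0\<close> by simp
  qed
  then have "X \<longlonglongrightarrow> abs_l2 F"
    by (simp add: tendsto_iff dist_norm)
  then show "convergent X"
    by (rule convergentI)
qed

section \<open>Dilations\<close>

lemma AE_dilation:
  fixes u :: real
  assumes "AE x in lborel. P x" "u \<noteq> 0"
  shows "AE x in lborel. P (u * x)"
proof -
  obtain N where N: "N \<in> null_sets lborel" "{x \<in> space lborel. \<not> P x} \<subseteq> N"
    using assms(1) by (auto elim!: AE_E3 simp: eventually_ae_filter)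
  have "AE x in lborel. x \<notin> N"
    by (rule AE_not_in[OF N(1)])
  then have "AE x in lborel. 0 + u * x \<notin> N"
    using N(1) by (intro AE_borel_affine[OF assms(2)]) auto
  then show ?thesis
    using N(2) by (auto elim!: eventually_mono)
qed

lemma AE_neq_0: "AE u in lborel. u \<noteq> (0::real)"
  by (rule AE_lborel_singleton)

lemma square_integrable_dilation:
  assumes "square_integrable F" "u \<noteq> 0"
  shows "square_integrable (\<lambda>x. F (u * x))"
  using assms lborel_integrable_real_affine[of "\<lambda>x. (cmod (F x))\<^sup>2" u 0]
  by (auto simp: square_integrable_def)

lemma powr_squared: "(x powr a)\<^sup>2 = x powr (2 * a)" for x a :: real
  by (simp add: power2_eq_square flip: powr_add)

lemma powr_minus_half_squared: "(\<bar>u\<bar> powr (-1/2))\<^sup>2 = 1 / \<bar>u\<bar>" for u :: real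
  by (simp only: powr_squared) (simp add: powr_minus_divide)

text \<open>Composition with a dilation. At \<open>u = 0\<close> it would be a constant, in general not square integrable;
  the value \<open>0\<close> there makes \<open>norm_dil\<close> and \<open>dil_dil\<close> hold for all arguments.\<close>

definition dil :: "real \<Rightarrow> l2 \<Rightarrow> l2" where
  "dil u f = (if u = 0 then 0 else abs_l2 (\<lambda>x. rep_l2 f (u * x)))"

lemma dil_0 [simp]: "dil 0 f = 0"
  by (simp add: dil_def)

lemma rep_dil: "u \<noteq> 0 \<Longrightarrow> AE x in lborel. rep_l2 (dil u f) x = rep_l2 f (u * x)"
  unfolding dil_def by (auto intro: rep_abs_l2 square_integrable_dilation)

lemma cinner_dil:
  assumes "u \<noteq> 0"
  shows "cinner (dil u f) g = (LINT x|lborel. rep_l2 f (u * x) * cnj (rep_l2 g x))"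
  unfolding cinner_rep
  by (rule integral_cong_AE; (measurable)?) (use rep_dil[OF assms, of f] in \<open>auto elim!: eventually_mono\<close>)

lemma cinner_dil_right:
  assumes "u \<noteq> 0"
  shows "cinner f (dil u g) = (LINT x|lborel. rep_l2 f x * cnj (rep_l2 g (u * x)))"
  unfolding cinner_rep
  by (rule integral_cong_AE; (measurable)?) (use rep_dil[OF assms, of g] in \<open>auto elim!: eventually_mono\<close>)

lemma cinner_dil_adjoint:
  assumes "u \<noteq> 0"
  shows "cinner (dil u f) g = complex_of_real (1 / \<bar>u\<bar>) * cinner f (dil (1/u) g)"
  unfolding cinner_dil[OF assms] using assms
  by (subst lborel_integral_real_affine[where t = 0 and c = "1/u"])
    (simp_all add: cinner_dil_right scaleR_conv_of_real)

lemma dil_dil: "dil u (dil v f) = dil (u * v) f"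
proof (cases "u = 0 \<or> v = 0")
  case True
  have "dil u 0 = 0" if "u \<noteq> 0"
    using rep_dil[OF that, of 0] AE_dilation[OF rep_abs_l2[OF square_integrable_zero] that]
      square_integrable_dilation[OF square_integrable_rep that, of 0] square_integrable_zero that
    unfolding dil_def zero_l2_def by (auto intro!: abs_l2_eqI)
  with True show ?thesis by (cases "u = 0") auto
next
  case False
  then have "AE x in lborel. rep_l2 (dil u (dil v f)) x = rep_l2 f (u * v * x)"
    using rep_dil[of u "dil v f"] AE_dilation[OF rep_dil[of v f], of u]
    by (auto simp: algebra_simps elim: eventually_elim2)
  then have "abs_l2 (rep_l2 (dil u (dil v f))) = abs_l2 (\<lambda>x. rep_l2 f (u * v * x))"
    using False by (intro abs_l2_eqI square_integrable_rep square_integrable_dilation) auto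
  then show ?thesis
    using False by (simp add: dil_def)
qed

lemma dil_1 [simp]: "dil 1 f = f"
  by (simp add: dil_def)

lemma norm_dil: "norm (dil u f) = \<bar>u\<bar> powr (-1/2) * norm f"
proof (cases "u = 0")
  case False
  have "complex_of_real ((norm (dil u f))\<^sup>2) = complex_of_real (1/\<bar>u\<bar> * (norm f)\<^sup>2)"
    using False unfolding cinner_self[symmetric] cinner_dil_adjoint[OF False]
    by (simp add: dil_dil cinner_self)
  then have "(norm (dil u f))\<^sup>2 = 1/\<bar>u\<bar> * (norm f)\<^sup>2"
    by (simp only: of_real_eq_iff)
  also have "\<dots> = (\<bar>u\<bar> powr (-1/2) * norm f)\<^sup>2"
    by (simp only: power_mult_distrib powr_minus_half_squared)
  finally show ?thesis
    by (rule power2_eq_imp_eq) auto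
qed simp

lemma cmod_cinner_dil_le: "cmod (cinner (dil u f) g) \<le> \<bar>u\<bar> powr (-1/2) * (norm f * norm g)"
  using cmod_cinner_le[of "dil u f" g] by (simp add: norm_dil mult.assoc)

lemma cinner_dil_measurable [measurable]: "(\<lambda>u. cinner (dil u f) g) \<in> borel_measurable borel"
proof -
  have "(\<lambda>u. cinner (dil u f) g)
      = (\<lambda>u. if u = 0 then 0 else LINT x|lborel. rep_l2 f (u * x) * cnj (rep_l2 g x))"
    by (auto simp: cinner_dil)
  also have "\<dots> \<in> borel_measurable borel" by measurable
  finally show ?thesis .
qed

lemma dil_add: "dil u (f + g) = dil u f + dil u g"
proof (cases "u = 0")
  case False
  then show ?thesis
    by (intro cinner_eqI) (simp add: cinner_dil_adjoint cinner_add_left distrib_left)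
qed simp

lemma dil_scaleC: "dil u (scaleC c f) = scaleC c (dil u f)"
proof (cases "u = 0")
  case False
  then show ?thesis
    by (intro cinner_eqI) (simp add: cinner_dil_adjoint cinner_scaleC_left)
qed simp

section \<open>Hausdorff operators\<close>

lemma admissible_kernel_iff:
  assumes [measurable]: "K \<in> borel_measurable borel"
  shows "admissible_kernel K \<longleftrightarrow> integrable lborel (\<lambda>u. cmod (K u) * \<bar>u\<bar> powr (-1/2))"
proof -
  have "integrable lborel (\<lambda>u. K u * complex_of_real (\<bar>u\<bar> powr (-1/2)))
      \<longleftrightarrow> integrable lborel (\<lambda>u. norm (K u * complex_of_real (\<bar>u\<bar> powr (-1/2))))"
    by (intro iffI integrable_norm) (auto intro: integrable_norm_cancel)
  then show ?thesis
    by (simp add: admissible_kernel_def norm_mult)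
qed

lemma admissible_measurable: "admissible_kernel K \<Longrightarrow> K \<in> borel_measurable borel"
  by (simp add: admissible_kernel_def)

lemma admissible_integrable: "admissible_kernel K \<Longrightarrow> integrable lborel (\<lambda>u. cmod (K u) * \<bar>u\<bar> powr (-1/2))"
  using admissible_kernel_iff[of K] by (simp add: admissible_measurable)

lemma admissible_kernel_diff:
  assumes "admissible_kernel K" "admissible_kernel L"
  shows "admissible_kernel (\<lambda>u. K u - L u)"
  using assms unfolding admissible_kernel_def by (auto simp: left_diff_distrib)

text \<open>The Cauchy--Schwarz inequality for functions, obtained from the one in the Hilbert space by passing to
  absolute values.\<close>

lemma integral_cmod_mult_le:
  assumes "square_integrable F" "square_integrable G"
  shows "integrable lborel (\<lambda>x. cmod (F x) * cmod (G x))"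
    and "(LINT x|lborel. cmod (F x) * cmod (G x))\<^sup>2
      \<le> (LINT x|lborel. (cmod (F x))\<^sup>2) * (LINT x|lborel. (cmod (G x))\<^sup>2)"
proof -
  let ?F = "\<lambda>x. complex_of_real (cmod (F x))" and ?G = "\<lambda>x. complex_of_real (cmod (G x))"
  have sq: "square_integrable ?F" "square_integrable ?G"
    using assms by (auto simp: square_integrable_def)
  have "integrable lborel (\<lambda>x. complex_of_real (cmod (F x) * cmod (G x)))"
    using square_integrable_inner[OF sq] by simp
  then show "integrable lborel (\<lambda>x. cmod (F x) * cmod (G x))"
    by (simp only: complex_of_real_integrable_eq)
  have "\<bar>LINT x|lborel. cmod (F x) * cmod (G x)\<bar> = cmod (cinner (abs_l2 ?F) (abs_l2 ?G))"
    by (simp add: cinner_abs[OF sq] flip: of_real_mult)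
  also have "\<dots> \<le> norm (abs_l2 ?F) * norm (abs_l2 ?G)"
    by (rule cmod_cinner_le)
  finally have "(LINT x|lborel. cmod (F x) * cmod (G x))\<^sup>2 \<le> (norm (abs_l2 ?F) * norm (abs_l2 ?G))\<^sup>2"
    using abs_le_square_iff by fastforce
  then show "(LINT x|lborel. cmod (F x) * cmod (G x))\<^sup>2
      \<le> (LINT x|lborel. (cmod (F x))\<^sup>2) * (LINT x|lborel. (cmod (G x))\<^sup>2)"
    by (simp add: power_mult_distrib norm_abs_l2[OF sq(1)] norm_abs_l2[OF sq(2)])
qed

lemma integral_rep_dilation:
  assumes "u \<noteq> 0"
  shows "(LINT x|lborel. (cmod (rep_l2 f (u * x)))\<^sup>2) = (norm f)\<^sup>2 / \<bar>u\<bar>"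
  using assms lborel_integral_real_affine[of u "\<lambda>x. (cmod (rep_l2 f x))\<^sup>2" 0]
  by (simp add: norm_rep_l2 field_simps)

text \<open>Cauchy--Schwarz with the weights \<open>\<bar>K u\<bar> \<bar>u\<bar> powr (\<plusminus>1/2)\<close> bounds the square of the integral by
  \<open>\<integral> \<bar>K u\<bar> \<bar>u\<bar> powr (1/2) \<bar>f (u x)\<bar>\<^sup>2 du\<close>, which Fubini's theorem integrates over \<open>x\<close>.\<close>

lemma square_integrable_hausdorff:
  assumes "admissible_kernel K"
  shows "square_integrable (\<lambda>x. LINT u|lborel. K u * rep_l2 f (u * x))"
proof -
  note [measurable] = admissible_measurable[OF assms]
  define W where "W = (\<lambda>(u, x). cmod (K u) * \<bar>u\<bar> powr (1/2) * (cmod (rep_l2 f (u * x)))\<^sup>2)"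
  define A where "A = (LINT u|lborel. cmod (K u) * \<bar>u\<bar> powr (-1/2))"
  have Wnn: "W p \<ge> 0" for p
    by (auto simp: W_def split: prod.split)
  have intW: "integrable (lborel \<Otimes>\<^sub>M lborel) W"
  proof (rule lborel_pair.Fubini_integrable)
    show "W \<in> borel_measurable (lborel \<Otimes>\<^sub>M lborel)"
      unfolding W_def by measurable
    have "(LINT x|lborel. norm (W (u, x))) = cmod (K u) * \<bar>u\<bar> powr (-1/2) * (norm f)\<^sup>2" for u
    proof (cases "u = 0")
      case False
      have "(LINT x|lborel. norm (W (u, x))) = cmod (K u) * (\<bar>u\<bar> powr (1/2) / \<bar>u\<bar>) * (norm f)\<^sup>2"
        by (simp add: W_def abs_mult integral_rep_dilation[OF False])
      also have "\<bar>u\<bar> powr (1/2) / \<bar>u\<bar> = \<bar>u\<bar> powr (-1/2)"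
        using False powr_diff[of "\<bar>u\<bar>" "1/2" 1] by simp
      finally show ?thesis .
    qed (simp add: W_def)
    then show "integrable lborel (\<lambda>u. LINT x|lborel. norm (W (u, x)))"
      using admissible_integrable[OF assms] by simp
    have "integrable lborel (\<lambda>x. W (u, x))" if "u \<noteq> 0" for u
      using square_integrable_dilation[OF square_integrable_rep that, of f]
      by (simp add: W_def square_integrable_def)
    then show "AE u in lborel. integrable lborel (\<lambda>x. W (u, x))"
      using AE_neq_0 by (auto elim!: eventually_mono)
  qed
  have bound: "(cmod (LINT u|lborel. K u * rep_l2 f (u * x)))\<^sup>2 \<le> A * (LINT u|lborel. W (u, x))"
    if x: "integrable lborel (\<lambda>u. W (u, x))" for x
  proof -
    let ?P = "\<lambda>u. complex_of_real (sqrt (cmod (K u)) * \<bar>u\<bar> powr (-1/4))"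
    let ?Q = "\<lambda>u. complex_of_real (sqrt (cmod (K u)) * \<bar>u\<bar> powr (1/4)) * rep_l2 f (u * x)"
    have P2: "(cmod (?P u))\<^sup>2 = cmod (K u) * \<bar>u\<bar> powr (-1/2)" for u
      by (simp add: norm_mult power_mult_distrib powr_squared)
    have Q2: "(cmod (?Q u))\<^sup>2 = W (u, x)" for u
      by (simp add: norm_mult power_mult_distrib W_def powr_squared)
    have PQ: "square_integrable ?P" "square_integrable ?Q"
      unfolding square_integrable_def P2 Q2 using x admissible_integrable[OF assms] by auto
    have PQ_eq: "AE u in lborel. norm (K u * rep_l2 f (u * x)) = cmod (?P u) * cmod (?Q u)"
      using AE_neq_0
    proof eventually_elim
      case (elim u)
      have "cmod (?P u) * cmod (?Q u)
          = (sqrt (cmod (K u)) * sqrt (cmod (K u))) * (\<bar>u\<bar> powr (-1/4) * \<bar>u\<bar> powr (1/4)) * cmod (rep_l2 f (u * x))"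
        by (simp add: norm_mult)
      also have "\<bar>u\<bar> powr (-1/4) * \<bar>u\<bar> powr (1/4) = 1"
        using elim by (simp only: powr_add[symmetric]) simp
      finally have *: "cmod (?P u) * cmod (?Q u) = sqrt (cmod (K u)) * sqrt (cmod (K u)) * 1 * cmod (rep_l2 f (u * x))" .
      show ?case unfolding * by (simp add: norm_mult)
    qed
    have "cmod (LINT u|lborel. K u * rep_l2 f (u * x)) \<le> (LINT u|lborel. norm (K u * rep_l2 f (u * x)))"
      by (rule integral_norm_bound)
    also have "\<dots> = (LINT u|lborel. cmod (?P u) * cmod (?Q u))"
      by (rule integral_cong_AE[OF _ _ PQ_eq]) measurable
    finally have "(cmod (LINT u|lborel. K u * rep_l2 f (u * x)))\<^sup>2 \<le> (LINT u|lborel. cmod (?P u) * cmod (?Q u))\<^sup>2"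
      by (rule power_mono) simp
    also have "\<dots> \<le> A * (LINT u|lborel. W (u, x))"
      using integral_cmod_mult_le(2)[OF PQ] by (simp only: P2 Q2 A_def)
    finally show ?thesis .
  qed
  show ?thesis
    unfolding square_integrable_def
  proof
    show "(\<lambda>x. LINT u|lborel. K u * rep_l2 f (u * x)) \<in> borel_measurable lborel"
      by measurable
    have "integrable lborel (\<lambda>x. A * (LINT u|lborel. W (u, x)))"
      using lborel_pair.integrable_snd[of "\<lambda>u x. W (u, x)"] intW by simp
    then show "integrable lborel (\<lambda>x. (cmod (LINT u|lborel. K u * rep_l2 f (u * x)))\<^sup>2)"
    proof (rule Bochner_Integration.integrable_bound)
      have "AE x in lborel. integrable lborel (\<lambda>u. W (u, x))"
        using lborel_pair.AE_integrable_snd[of "\<lambda>u x. W (u, x)"] intW by simp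
      then show "AE x in lborel. norm ((cmod (LINT u|lborel. K u * rep_l2 f (u * x)))\<^sup>2)
          \<le> norm (A * (LINT u|lborel. W (u, x)))"
        by eventually_elim (use bound in fastforce)
    qed measurable
  qed
qed

lemma admissible_cinner_dil_integrable:
  assumes "admissible_kernel K"
  shows "integrable lborel (\<lambda>u. K u * cinner (dil u f) g)"
    and "(LINT u|lborel. cmod (K u * cinner (dil u f) g))
      \<le> (LINT u|lborel. cmod (K u) * \<bar>u\<bar> powr (-1/2)) * (norm f * norm g)"
proof -
  note [measurable] = admissible_measurable[OF assms]
  have *: "cmod (K u * cinner (dil u f) g) \<le> cmod (K u) * \<bar>u\<bar> powr (-1/2) * (norm f * norm g)" for u
    using cmod_cinner_dil_le[of u f g] by (simp add: norm_mult mult_left_mono mult.assoc)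
  have i: "integrable lborel (\<lambda>u. cmod (K u) * \<bar>u\<bar> powr (-1/2) * (norm f * norm g))"
    using admissible_integrable[OF assms] by simp
  show int: "integrable lborel (\<lambda>u. K u * cinner (dil u f) g)"
    by (rule Bochner_Integration.integrable_bound[OF i])
      (use * in \<open>auto intro!: AE_I2 order_trans[OF _ abs_ge_self]\<close>)
  have "(LINT u|lborel. cmod (K u * cinner (dil u f) g))
      \<le> (LINT u|lborel. cmod (K u) * \<bar>u\<bar> powr (-1/2) * (norm f * norm g))"
    by (rule integral_mono) (use int i * in auto)
  then show "(LINT u|lborel. cmod (K u * cinner (dil u f) g))
      \<le> (LINT u|lborel. cmod (K u) * \<bar>u\<bar> powr (-1/2)) * (norm f * norm g)"
    by simp
qed

text \<open>The weak form turns every statement about Hausdorff operators into one about integrals against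
  the scalar functions \<open>u \<mapsto> \<langle>dil u f, g\<rangle>\<close>.\<close>

lemma cinner_hausdorff:
  assumes "admissible_kernel K"
  shows "cinner (hausdorff_op K f) g = (LINT u|lborel. K u * cinner (dil u f) g)"
proof -
  note [measurable] = admissible_measurable[OF assms]
  let ?F = "\<lambda>u x. K u * rep_l2 f (u * x) * cnj (rep_l2 g x)"
  have norm_int: "(LINT x|lborel. norm (?F u x)) \<le> cmod (K u) * \<bar>u\<bar> powr (-1/2) * (norm f * norm g)"
    and int: "integrable lborel (?F u)" if "u \<noteq> 0" for u
  proof -
    note sq = square_integrable_dilation[OF square_integrable_rep[of f] that] square_integrable_rep[of g]
    have "(LINT x|lborel. cmod (rep_l2 f (u * x)) * cmod (rep_l2 g x))\<^sup>2 \<le> (\<bar>u\<bar> powr (-1/2) * (norm f * norm g))\<^sup>2"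
    proof -
      have "(LINT x|lborel. cmod (rep_l2 f (u * x)) * cmod (rep_l2 g x))\<^sup>2 \<le> (norm f)\<^sup>2 / \<bar>u\<bar> * (norm g)\<^sup>2"
        using integral_cmod_mult_le(2)[OF sq] by (simp add: integral_rep_dilation[OF that] norm_rep_l2)
      also have "(norm f)\<^sup>2 / \<bar>u\<bar> * (norm g)\<^sup>2 = (\<bar>u\<bar> powr (-1/2) * (norm f * norm g))\<^sup>2"
        unfolding power_mult_distrib powr_minus_half_squared by simp
      finally show ?thesis .
    qed
    then have "(LINT x|lborel. cmod (rep_l2 f (u * x)) * cmod (rep_l2 g x)) \<le> \<bar>u\<bar> powr (-1/2) * (norm f * norm g)"
      by (rule power2_le_imp_le) simp
    then have "cmod (K u) * (LINT x|lborel. cmod (rep_l2 f (u * x)) * cmod (rep_l2 g x))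
        \<le> cmod (K u) * (\<bar>u\<bar> powr (-1/2) * (norm f * norm g))"
      by (rule mult_left_mono) simp
    then show "(LINT x|lborel. norm (?F u x)) \<le> cmod (K u) * \<bar>u\<bar> powr (-1/2) * (norm f * norm g)"
      by (simp add: norm_mult mult.assoc)
    have "integrable lborel (\<lambda>x. K u * (rep_l2 f (u * x) * cnj (rep_l2 g x)))"
      using square_integrable_inner[OF sq] by simp
    then show "integrable lborel (?F u)" by (simp add: mult.assoc)
  qed
  have prod: "integrable (lborel \<Otimes>\<^sub>M lborel) (case_prod ?F)"
  proof (rule lborel_pair.Fubini_integrable)
    have "integrable lborel (\<lambda>u. cmod (K u) * \<bar>u\<bar> powr (-1/2) * (norm f * norm g))"
      using admissible_integrable[OF assms] by simp
    then show "integrable lborel (\<lambda>u. LINT x|lborel. norm (case_prod ?F (u, x)))"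
    proof (rule Bochner_Integration.integrable_bound)
      show "AE u in lborel. norm (LINT x|lborel. norm (case_prod ?F (u, x)))
          \<le> norm (cmod (K u) * \<bar>u\<bar> powr (-1/2) * (norm f * norm g))"
        using AE_neq_0 by eventually_elim (use norm_int in \<open>auto simp: integral_nonneg_AE abs_mult\<close>)
    qed measurable
    show "AE u in lborel. integrable lborel (\<lambda>x. case_prod ?F (u, x))"
      using AE_neq_0 by eventually_elim (use int in auto)
  qed measurable
  have "cinner (hausdorff_op K f) g = (LINT x|lborel. (LINT u|lborel. ?F u x))"
    unfolding cinner_rep hausdorff_op_def
  proof (rule integral_cong_AE; (measurable)?)
    show "AE x in lborel. rep_l2 (abs_l2 (\<lambda>x. LINT u|lborel. K u * rep_l2 f (u * x))) x * cnj (rep_l2 g x)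
        = (LINT u|lborel. ?F u x)"
      using rep_abs_l2[OF square_integrable_hausdorff[OF assms, of f]] by eventually_elim simp
  qed
  also have "\<dots> = (LINT u|lborel. (LINT x|lborel. ?F u x))"
    by (rule lborel_pair.Fubini_integral[OF prod])
  also have "\<dots> = (LINT u|lborel. K u * cinner (dil u f) g)"
  proof (rule integral_cong_AE; (measurable)?)
    show "AE u in lborel. (LINT x|lborel. ?F u x) = K u * cinner (dil u f) g"
      using AE_neq_0 by eventually_elim (simp add: cinner_dil mult.assoc)
  qed
  finally show ?thesis .
qed

lemma bounded_clinear_hausdorff:
  assumes "admissible_kernel K"
  shows "bounded_clinear (hausdorff_op K)"
proof (rule bounded_clinearI)
  note int = admissible_cinner_dil_integrable(1)[OF assms]
  fix f g c
  show "hausdorff_op K (f + g) = hausdorff_op K f + hausdorff_op K g"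
    using int by (intro cinner_eqI) (simp add: cinner_hausdorff[OF assms] cinner_add_left dil_add ring_distribs)
  show "hausdorff_op K (scaleC c f) = scaleC c (hausdorff_op K f)"
    by (intro cinner_eqI)
      (simp add: cinner_hausdorff[OF assms] cinner_scaleC_left dil_scaleC mult.left_commute[of _ c])
  let ?A = "LINT u|lborel. cmod (K u) * \<bar>u\<bar> powr (-1/2)" and ?g = "hausdorff_op K f"
  have "norm ?g * norm ?g = cmod (cinner ?g ?g)"
    by (simp add: cinner_self power2_eq_square norm_mult)
  also have "\<dots> \<le> (LINT u|lborel. cmod (K u * cinner (dil u f) ?g))"
    unfolding cinner_hausdorff[OF assms] by (rule integral_norm_bound)
  also have "\<dots> \<le> ?A * (norm f * norm ?g)"
    by (rule admissible_cinner_dil_integrable(2)[OF assms])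
  finally have "norm ?g * norm ?g \<le> (?A * norm f) * norm ?g"
    by (simp add: mult.assoc)
  moreover have "0 \<le> ?A * norm f"
    by (intro mult_nonneg_nonneg integral_nonneg_AE) auto
  ultimately show "norm ?g \<le> ?A * norm f"
    by (cases "norm ?g = 0") (auto simp: mult_le_cancel_right)
qed

lemma hausdorff_eqI:
  assumes "admissible_kernel K" "\<And>f g. cinner (S f) g = (LINT u|lborel. K u * cinner (dil u f) g)"
  shows "S = hausdorff_op K"
  by (intro ext cinner_eqI) (simp add: assms cinner_hausdorff)

lemma hausdorff_op_diff:
  assumes "admissible_kernel K" "admissible_kernel L"
  shows "hausdorff_op (\<lambda>u. K u - L u) f = hausdorff_op K f - hausdorff_op L f"
proof -
  have "(\<lambda>f. hausdorff_op K f - hausdorff_op L f) = hausdorff_op (\<lambda>u. K u - L u)"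
    by (rule hausdorff_eqI[OF admissible_kernel_diff[OF assms]])
      (simp add: cinner_minus_left cinner_hausdorff assms left_diff_distrib
        admissible_cinner_dil_integrable(1))
  then show ?thesis by metis
qed

lemma hausdorff_op_cmult:
  assumes "admissible_kernel K"
  shows "admissible_kernel (\<lambda>u. c * K u)" "hausdorff_op (\<lambda>u. c * K u) f = scaleC c (hausdorff_op K f)"
proof -
  show adm: "admissible_kernel (\<lambda>u. c * K u)"
    using assms unfolding admissible_kernel_def by (auto simp: mult.assoc)
  have "(\<lambda>f. scaleC c (hausdorff_op K f)) = hausdorff_op (\<lambda>u. c * K u)"
    by (rule hausdorff_eqI[OF adm]) (simp add: cinner_scaleC_left cinner_hausdorff assms mult.assoc)
  then show "hausdorff_op (\<lambda>u. c * K u) f = scaleC c (hausdorff_op K f)" by metis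
qed

lemma cinner_dil_hausdorff:
  assumes "admissible_kernel K" "v \<noteq> 0"
  shows "cinner (dil v (hausdorff_op K f)) g = (LINT u|lborel. K u * cinner (dil (v * u) f) g)"
proof -
  have "cinner (dil v (hausdorff_op K f)) g
      = (LINT u|lborel. K u * (complex_of_real (1 / \<bar>v\<bar>) * cinner (dil u f) (dil (1/v) g)))"
    unfolding cinner_dil_adjoint[OF assms(2)] cinner_hausdorff[OF assms(1)]
    by (subst integral_mult_right_zero[symmetric]) (simp only: mult.left_commute)
  then show ?thesis
    by (simp only: cinner_dil_adjoint[OF assms(2), symmetric] dil_dil)
qed

lemma dil_hausdorff:
  assumes "admissible_kernel K"
  shows "dil v (hausdorff_op K f) = hausdorff_op K (dil v f)"
proof (cases "v = 0")
  case True
  then show ?thesis by (simp add: bounded_clinear_zero[OF bounded_clinear_hausdorff[OF assms]])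
next
  case False
  show ?thesis
    by (intro cinner_eqI)
      (simp add: cinner_dil_hausdorff[OF assms False] cinner_hausdorff[OF assms] dil_dil mult.commute)
qed

text \<open>An operator that has an adjoint can be moved inside the integral that defines a Hausdorff
  operator, and it meets only dilations there.\<close>

lemma hausdorff_commute:
  assumes "admissible_kernel K" "admissible_kernel L"
    and adjoint: "\<And>f g. cinner (hausdorff_op K f) g = cinner f (S g)"
  shows "hausdorff_op L (hausdorff_op K f) = hausdorff_op K (hausdorff_op L f)"
  by (intro cinner_eqI) (simp add: cinner_hausdorff[OF assms(2)] dil_hausdorff[OF assms(1)] adjoint)

text \<open>A superposition of Hausdorff operators is the Hausdorff operator of the superposed kernel. Both
  claims are Fubini's theorem for \<open>k y u * x u\<close> with a factor \<open>x\<close> bounded by a multiple of \<open>\<bar>u\<bar> powr (-1/2)\<close>: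
  the first with this power itself, the second with \<open>x u = cinner (dil u f) g\<close>.\<close>

lemma hausdorff_mixture:
  fixes k :: "real \<Rightarrow> real \<Rightarrow> complex"
  assumes k [measurable]: "case_prod k \<in> borel_measurable (borel \<Otimes>\<^sub>M borel)"
    and adm: "\<And>y. admissible_kernel (k y)"
    and bound: "\<And>y. (LINT u|lborel. cmod (k y u) * \<bar>u\<bar> powr (-1/2)) \<le> b y" and b: "integrable lborel b"
  shows "admissible_kernel (\<lambda>u. LINT y|lborel. k y u)"
    and "cinner (hausdorff_op (\<lambda>u. LINT y|lborel. k y u) f) g = (LINT y|lborel. cinner (hausdorff_op (k y) f) g)"
proof -
  have prod: "integrable (lborel \<Otimes>\<^sub>M lborel) (\<lambda>(y, u). k y u * x u)"
    if [measurable]: "x \<in> borel_measurable borel" and x: "\<And>u. cmod (x u) \<le> \<bar>u\<bar> powr (-1/2) * c" for x :: "real \<Rightarrow> complex" and c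
  proof (rule lborel_pair.Fubini_integrable)
    have le: "cmod (k y u * x u) \<le> cmod (k y u) * \<bar>u\<bar> powr (-1/2) * c" for y u
      using mult_left_mono[OF x[of u], of "cmod (k y u)"] by (simp add: norm_mult mult.assoc)
    have i: "integrable lborel (\<lambda>u. cmod (k y u) * \<bar>u\<bar> powr (-1/2) * c)" for y
      using admissible_integrable[OF adm] by simp
    have int: "integrable lborel (\<lambda>u. k y u * x u)" for y
      by (rule Bochner_Integration.integrable_bound[OF i])
        (use le in \<open>auto intro!: AE_I2 order_trans[OF _ abs_ge_self]\<close>)
    then show "AE y in lborel. integrable lborel (\<lambda>u. case (y, u) of (y, u) \<Rightarrow> k y u * x u)" by simp
    have c: "c \<ge> 0" using order_trans[OF norm_ge_zero x[of 1]] by simp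
    have "integrable lborel (\<lambda>y. b y * c)" using b by simp
    then show "integrable lborel (\<lambda>y. LINT u|lborel. norm (case (y, u) of (y, u) \<Rightarrow> k y u * x u))"
    proof (rule Bochner_Integration.integrable_bound)
      show "AE y in lborel. norm (LINT u|lborel. norm (case (y, u) of (y, u) \<Rightarrow> k y u * x u)) \<le> norm (b y * c)"
      proof (rule AE_I2)
        fix y
        have "(LINT u|lborel. norm (k y u * x u)) \<le> (LINT u|lborel. cmod (k y u) * \<bar>u\<bar> powr (-1/2) * c)"
          by (rule integral_mono[OF integrable_norm[OF int] i le])
        also have "\<dots> \<le> b y * c"
          using bound[of y] c by (simp add: mult_right_mono)
        finally have "(LINT u|lborel. norm (k y u * x u)) \<le> b y * c" .
        moreover have "0 \<le> (LINT u|lborel. norm (k y u * x u))"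
          by (intro integral_nonneg_AE) auto
        ultimately show "norm (LINT u|lborel. norm (case (y, u) of (y, u) \<Rightarrow> k y u * x u)) \<le> norm (b y * c)"
          by (simp del: norm_mult)
      qed
    qed measurable
  qed measurable
  let ?K = "\<lambda>u. LINT y|lborel. k y u"
  let ?x = "\<lambda>u::real. complex_of_real (\<bar>u\<bar> powr (-1/2))"
  have "integrable (lborel \<Otimes>\<^sub>M lborel) (\<lambda>(y, u). k y u * ?x u)"
    by (rule prod[where c = 1]) auto
  from lborel_pair.integrable_snd[OF this] have "integrable lborel (\<lambda>u. ?K u * ?x u)"
    by (simp only: integral_mult_left_zero)
  then show adm': "admissible_kernel ?K"
    by (simp add: admissible_kernel_def)
  let ?y = "\<lambda>u. cinner (dil u f) g"
  have P: "integrable (lborel \<Otimes>\<^sub>M lborel) (\<lambda>(y, u). k y u * ?y u)"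
    by (rule prod[where c = "norm f * norm g"]) (measurable, rule cmod_cinner_dil_le)
  have "cinner (hausdorff_op ?K f) g = (LINT u|lborel. LINT y|lborel. k y u * ?y u)"
    unfolding cinner_hausdorff[OF adm'] by (simp only: integral_mult_left_zero)
  also have "\<dots> = (LINT y|lborel. LINT u|lborel. k y u * ?y u)"
    by (rule lborel_pair.Fubini_integral[OF P])
  finally show "cinner (hausdorff_op ?K f) g = (LINT y|lborel. cinner (hausdorff_op (k y) f) g)"
    by (simp only: cinner_hausdorff[OF adm])
qed

text \<open>The product of two operators has the multiplicative convolution of the kernels as its kernel:
  it is the superposition over \<open>v\<close>, with weight \<open>L v\<close>, of the operators \<open>dil v\<close> after the first factor.\<close>

lemma hausdorff_comp_eqI:
  assumes K: "admissible_kernel K" and L: "admissible_kernel L"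
    and M: "admissible_kernel M"
      "\<And>t. t \<noteq> 0 \<Longrightarrow> (LINT v|lborel. K (t / v) * L v / complex_of_real \<bar>v\<bar>) = M t"
  shows "hausdorff_op L (hausdorff_op K f) = hausdorff_op M f"
proof -
  note [measurable] = admissible_measurable[OF K] admissible_measurable[OF L] admissible_measurable[OF M(1)]
  let ?k = "\<lambda>v t. K (t / v) * L v / complex_of_real \<bar>v\<bar>"
  let ?w = "\<lambda>u. cmod (K u) * \<bar>u\<bar> powr (-1/2)"
  have scale: "?k v (v * u) = K u * L v / complex_of_real \<bar>v\<bar>"
    "cmod (?k v (v * u)) * \<bar>v * u\<bar> powr (-1/2) = cmod (L v) * \<bar>v\<bar> powr (-1/2) / \<bar>v\<bar> * ?w u" if "v \<noteq> 0" for v u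
    using that by (simp_all add: norm_mult norm_divide abs_mult powr_mult)
  have w: "integrable lborel (\<lambda>t. cmod (?k v t) * \<bar>t\<bar> powr (-1/2))
      \<and> (LINT t|lborel. cmod (?k v t) * \<bar>t\<bar> powr (-1/2)) = cmod (L v) * \<bar>v\<bar> powr (-1/2) * integral\<^sup>L lborel ?w" for v
  proof (cases "v = 0")
    case False
    let ?h = "\<lambda>t. cmod (?k v t) * \<bar>t\<bar> powr (-1/2)"
    have "integrable lborel (\<lambda>u. ?h (v * u))"
      unfolding scale(2)[OF False] using admissible_integrable[OF K] by simp
    then have "integrable lborel ?h"
      using lborel_integrable_real_affine_iff[of v ?h 0] False by simp
    moreover have "integral\<^sup>L lborel ?h = \<bar>v\<bar> * (LINT u|lborel. ?h (v * u))"
      using lborel_integral_real_affine[of v ?h 0] False by simp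
    then have "integral\<^sup>L lborel ?h = cmod (L v) * \<bar>v\<bar> powr (-1/2) * integral\<^sup>L lborel ?w"
      unfolding scale(2)[OF False] using False by simp
    ultimately show ?thesis ..
  qed simp
  have k: "case_prod ?k \<in> borel_measurable (borel \<Otimes>\<^sub>M borel)" "\<And>v. admissible_kernel (?k v)"
    using w by (measurable, subst admissible_kernel_iff, auto)
  have b: "integrable lborel (\<lambda>v. cmod (L v) * \<bar>v\<bar> powr (-1/2) * integral\<^sup>L lborel ?w)"
    using admissible_integrable[OF L] by simp
  note mix = hausdorff_mixture[OF k _ b]
  show ?thesis
  proof (rule cinner_eqI)
    fix g
    have slice: "L v * cinner (dil v (hausdorff_op K f)) g = cinner (hausdorff_op (?k v) f) g" if "v \<noteq> 0" for v
    proof -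
      have "cinner (hausdorff_op (?k v) f) g = \<bar>v\<bar> *\<^sub>R (LINT u|lborel. ?k v (v * u) * cinner (dil (v * u) f) g)"
        unfolding cinner_hausdorff[OF k(2)]
        using lborel_integral_real_affine[of v "\<lambda>t. ?k v t * cinner (dil t f) g" 0] that by simp
      also have "\<dots> = (LINT u|lborel. L v * (K u * cinner (dil (v * u) f) g))"
        unfolding scale(1)[OF that] integral_scaleR_right[symmetric]
        using that by (intro Bochner_Integration.integral_cong) (auto simp: scaleR_conv_of_real)
      finally show ?thesis
        by (simp only: cinner_dil_hausdorff[OF K that] integral_mult_right_zero)
    qed
    have "cinner (hausdorff_op L (hausdorff_op K f)) g = (LINT v|lborel. cinner (hausdorff_op (?k v) f) g)"
      unfolding cinner_hausdorff[OF L]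
    proof (rule integral_cong_AE)
      show "AE v in lborel. L v * cinner (dil v (hausdorff_op K f)) g = cinner (hausdorff_op (?k v) f) g"
        using AE_neq_0 by eventually_elim (rule slice)
      show "(\<lambda>v. cinner (hausdorff_op (?k v) f) g) \<in> borel_measurable lborel"
        unfolding cinner_hausdorff[OF k(2)] by measurable
    qed measurable
    also have "\<dots> = cinner (hausdorff_op (\<lambda>t. LINT v|lborel. ?k v t) f) g"
      using mix(2) w by simp
    also have "\<dots> = (LINT t|lborel. (LINT v|lborel. ?k v t) * cinner (dil t f) g)"
      using cinner_hausdorff[OF mix(1)] w by simp
    also have "\<dots> = (LINT t|lborel. M t * cinner (dil t f) g)"
      by (rule integral_cong_AE; (measurable)?) (use AE_neq_0 M(2) in \<open>auto elim!: eventually_mono\<close>)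
    finally show "cinner (hausdorff_op L (hausdorff_op K f)) g = cinner (hausdorff_op M f) g"
      by (simp only: cinner_hausdorff[OF M(1)])
  qed
qed

section \<open>The Cesaro operator, its adjoint and resolvents\<close>

text \<open>A nonnegative function with a gauge integral is Lebesgue integrable with the same integral; improper
  integrals of powers are evaluated in this way.\<close>

lemma nonneg_has_integral_lborel:
  fixes f :: "real \<Rightarrow> real"
  assumes [measurable]: "f \<in> borel_measurable borel" "S \<in> sets borel"
    and nonneg: "\<And>x. x \<in> S \<Longrightarrow> 0 \<le> f x" and int: "(f has_integral I) S"
  shows "integrable lborel (\<lambda>x. indicator S x * f x)" "(LINT x|lborel. indicator S x * f x) = I"
proof -
  have *: "((\<lambda>x. indicator S x * f x) has_integral I) UNIV"
  proof -
    have "(\<lambda>x. indicator S x * f x) = (\<lambda>x. if x \<in> S then f x else 0)"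
      by (auto simp: indicator_def)
    then show ?thesis
      using int by (simp only: has_integral_restrict_UNIV)
  qed
  have "0 \<le> I"
    by (rule has_integral_nonneg[OF int nonneg])
  have "integral\<^sup>N lborel (\<lambda>x. indicator S x * f x) = I"
    by (rule nn_integral_has_integral_lborel[OF _ _ *]) (use nonneg in \<open>auto simp: indicator_def\<close>)
  then have "has_bochner_integral lborel (\<lambda>x. indicator S x * f x) I"
    by (intro has_bochner_integral_nn_integral) (use nonneg \<open>0 \<le> I\<close> in \<open>auto simp: indicator_def\<close>)
  then show "integrable lborel (\<lambda>x. indicator S x * f x)" "(LINT x|lborel. indicator S x * f x) = I"
    by (auto simp: has_bochner_integral_iff)
qed

definition res_kernel :: "real \<Rightarrow> real \<Rightarrow> complex" where
  "res_kernel a u = (if 0 < u \<and> u \<le> 1 then complex_of_real (u powr a) else 0)"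

definition adj_kernel :: "real \<Rightarrow> complex" where
  "adj_kernel u = (if 1 < u then complex_of_real (1 / u) else 0)"

lemma res_kernel_measurable [measurable]: "case_prod res_kernel \<in> borel_measurable (borel \<Otimes>\<^sub>M borel)"
  unfolding res_kernel_def by measurable

lemma res_kernel_measurable' [measurable]: "res_kernel a \<in> borel_measurable borel"
  unfolding res_kernel_def by measurable

lemma adj_kernel_measurable [measurable]: "adj_kernel \<in> borel_measurable borel"
  unfolding adj_kernel_def by measurable

lemma res_kernel_weight:
  assumes "a \<ge> 0"
  shows "integrable lborel (\<lambda>u. cmod (res_kernel a u) * \<bar>u\<bar> powr (-1/2))"
    and "(LINT u|lborel. cmod (res_kernel a u) * \<bar>u\<bar> powr (-1/2)) = 1 / (a + 1/2)"
proof -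
  have eq: "cmod (res_kernel a u) * \<bar>u\<bar> powr (-1/2) = indicator {0..1} u * u powr (a - 1/2)" for u
    using powr_add[of u a "-1/2"] by (auto simp: res_kernel_def indicator_def)
  have "((\<lambda>u. u powr (a - 1/2)) has_integral (1 / (a + 1/2))) {0..1}"
    using has_integral_powr_from_0[of "a - 1/2" 1] assms by (simp add: add.commute)
  from nonneg_has_integral_lborel[OF _ _ _ this]
  show "integrable lborel (\<lambda>u. cmod (res_kernel a u) * \<bar>u\<bar> powr (-1/2))"
    "(LINT u|lborel. cmod (res_kernel a u) * \<bar>u\<bar> powr (-1/2)) = 1 / (a + 1/2)"
    unfolding eq by simp_all
qed

lemma admissible_res_kernel: "a \<ge> 0 \<Longrightarrow> admissible_kernel (res_kernel a)"
  using res_kernel_weight by (subst admissible_kernel_iff) auto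

lemma admissible_adj_kernel: "admissible_kernel adj_kernel"
proof (subst admissible_kernel_iff)
  have "((\<lambda>u::real. u powr (-3/2)) has_integral 2) {1..}"
    using has_integral_powr_to_inf[of "-3/2" 1] by simp
  from nonneg_has_integral_lborel(1)[OF _ _ _ this]
  have "integrable lborel (\<lambda>u::real. indicator {1..} u * u powr (-3/2))"
    by simp
  then show "integrable lborel (\<lambda>u. cmod (adj_kernel u) * \<bar>u\<bar> powr (-1/2))"
  proof (rule Bochner_Integration.integrable_bound)
    have "cmod (adj_kernel u) * \<bar>u\<bar> powr (-1/2) = indicator {1<..} u * u powr (-3/2)" for u
      using powr_add[of u "-1" "-1/2"]
      by (auto simp: adj_kernel_def indicator_def powr_minus_divide norm_divide)
    then show "AE u in lborel. norm (cmod (adj_kernel u) * \<bar>u\<bar> powr (-1/2))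
        \<le> norm (indicator {1..} u * u powr (-3/2))"
      by (intro AE_I2) (auto simp: indicator_def)
  qed measurable
qed measurable

text \<open>The kernel \<open>res_kernel a\<close> has the symbol \<open>1 / (a + w)\<close> with \<open>w = 1/2 - \<i> s\<close>, and the Cesaro operator, which is the
  case \<open>a = 0\<close>, has the symbol \<open>1 / w\<close>. So \<open>resolvent a\<close> is, up to sign, the resolvent at \<open>- a\<close> of the
  unbounded inverse of the Cesaro operator.\<close>

definition resolvent :: "real \<Rightarrow> l2 \<Rightarrow> l2" where
  "resolvent a = hausdorff_op (res_kernel a)"

definition cesaro_adj :: "l2 \<Rightarrow> l2" where
  "cesaro_adj = hausdorff_op adj_kernel"

text \<open>The substitution \<open>t = u x\<close>, for both signs of \<open>x\<close>, turns the mean value into a Hausdorff integral. The two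
  may differ at \<open>x = 0\<close>.\<close>

lemma square_integrable_cesaro:
    "square_integrable (\<lambda>x. complex_of_real (1 / x) * (LBINT t=0..ereal x. rep_l2 f t))" (is ?sq)
  and cesaro_eq_hausdorff_pointwise: "cesaro f = hausdorff_op (res_kernel 0) f"
proof -
  let ?c = "\<lambda>x. complex_of_real (1 / x) * (LBINT t=0..ereal x. rep_l2 f t)"
  let ?h = "\<lambda>x. LINT u|lborel. res_kernel 0 u * rep_l2 f (u * x)"
  have eq: "?c x = ?h x" if "x \<noteq> 0" for x
  proof -
    have AE1: "AE u in lborel. u \<noteq> (1::real)"
      by (rule AE_lborel_singleton)
    have "(LBINT t=0..ereal x. rep_l2 f t)
        = complex_of_real (sgn x) * (LINT t|lborel. indicator {t. 0 < t / x \<and> t / x < 1} t *\<^sub>R rep_l2 f t)"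
    proof (cases "x > 0")
      case True
      then have "einterval 0 (ereal x) = {t. 0 < t / x \<and> t / x < 1}"
        by (auto simp: einterval_def zero_ereal_def field_simps)
      with True show ?thesis
        by (simp add: interval_lebesgue_integral_def set_lebesgue_integral_def)
    next
      case False
      with that have "x < 0" by simp
      then have "einterval (ereal x) 0 = {t. 0 < t / x \<and> t / x < 1}"
        by (auto simp: einterval_def zero_ereal_def field_simps)
      with \<open>x < 0\<close> show ?thesis
        by (simp add: interval_lebesgue_integral_def set_lebesgue_integral_def)
    qed
    also have "\<dots> = complex_of_real (sgn x) * (\<bar>x\<bar> *\<^sub>R (LINT u|lborel. indicator {t. 0 < t / x \<and> t / x < 1} (x * u) *\<^sub>R rep_l2 f (x * u)))"
      by (subst lborel_integral_real_affine[OF that, where t = 0]) simp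
    also have "(LINT u|lborel. indicator {t. 0 < t / x \<and> t / x < 1} (x * u) *\<^sub>R rep_l2 f (x * u)) = ?h x"
    proof (rule integral_cong_AE; (measurable)?)
      show "AE u in lborel. indicator {t. 0 < t / x \<and> t / x < 1} (x * u) *\<^sub>R rep_l2 f (x * u)
          = res_kernel 0 u * rep_l2 f (u * x)"
        using AE1 by eventually_elim (use that in \<open>auto simp: indicator_def res_kernel_def mult.commute\<close>)
    qed
    finally show ?thesis
      using that by (simp add: scaleR_conv_of_real sgn_if split: if_splits)
  qed
  have sq: "square_integrable ?h"
    by (rule square_integrable_hausdorff[OF admissible_res_kernel]) simp
  have ae: "AE x in lborel. ?c x = ?h x"
    using AE_neq_0 by eventually_elim (rule eq)
  have "?c = (\<lambda>x. if x = 0 then 0 else ?h x)"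
    using eq by (auto simp: fun_eq_iff)
  moreover have "(\<lambda>x. if x = 0 then 0 else ?h x) \<in> borel_measurable borel"
    by measurable
  ultimately have meas [measurable]: "?c \<in> borel_measurable borel"
    by simp
  have "integrable lborel (\<lambda>x. (cmod (?c x))\<^sup>2)"
  proof (rule integrable_cong_AE_imp)
    show "integrable lborel (\<lambda>x. (cmod (?h x))\<^sup>2)"
      using sq by (simp add: square_integrable_def)
    show "AE x in lborel. (cmod (?h x))\<^sup>2 = (cmod (?c x))\<^sup>2"
      using ae by eventually_elim simp
  qed measurable
  with meas show ?sq
    unfolding square_integrable_def by (simp only: measurable_lborel2 simp_thms)
  with sq show "cesaro f = hausdorff_op (res_kernel 0) f"
    unfolding cesaro_def hausdorff_op_def by (intro abs_l2_eqI ae)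
qed

lemma cesaro_eq_hausdorff: "cesaro = hausdorff_op (res_kernel 0)"
  by (rule ext) (rule cesaro_eq_hausdorff_pointwise)

lemma bounded_clinear_cesaro: "bounded_clinear cesaro"
  unfolding cesaro_eq_hausdorff by (intro bounded_clinear_hausdorff admissible_res_kernel) simp

lemma bounded_clinear_adj: "bounded_clinear cesaro_adj"
  unfolding cesaro_adj_def by (intro bounded_clinear_hausdorff admissible_adj_kernel)

lemma bounded_clinear_resolvent: "a \<ge> 0 \<Longrightarrow> bounded_clinear (resolvent a)"
  unfolding resolvent_def by (intro bounded_clinear_hausdorff admissible_res_kernel)

text \<open>The substitution \<open>u = 1 / v\<close> on the real line without \<open>0\<close>. It relates the kernel of a Hausdorff operator to the
  kernel of the adjoint operator.\<close>

lemma lborel_integral_reciprocal_real: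
  fixes F :: "real \<Rightarrow> real"
  assumes F: "integrable lborel F"
  shows "integrable lborel (\<lambda>v. 1 / v\<^sup>2 * F (1 / v))" "(LINT v|lborel. 1 / v\<^sup>2 * F (1 / v)) = (LINT u|lborel. F u)"
proof -
  have [measurable]: "F \<in> borel_measurable borel" using F by auto
  let ?S = "UNIV - {0::real}" and ?g = "\<lambda>v::real. 1 / v"
  have img: "?g ` ?S = ?S"
    by (auto intro!: image_eqI[where x = "1 / _"])
  have leb: "set_integrable lebesgue ?S h \<longleftrightarrow> integrable lborel h"
    "(LINT v:?S|lebesgue. h v) = (LINT v|lborel. h v)"
    if [measurable]: "h \<in> borel_measurable borel" for h :: "real \<Rightarrow> real"
  proof -
    have ae: "AE v in lborel. indicator ?S v *\<^sub>R h v = h v"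
      using AE_neq_0 by eventually_elim simp
    have "set_integrable lebesgue ?S h \<longleftrightarrow> integrable lborel (\<lambda>v. indicator ?S v *\<^sub>R h v)"
      unfolding set_integrable_def by (rule integrable_completion) measurable
    also have "\<dots> \<longleftrightarrow> integrable lborel h"
      by (rule integrable_cong_AE[OF _ _ ae]) measurable
    finally show "set_integrable lebesgue ?S h \<longleftrightarrow> integrable lborel h" .
    have "(LINT v:?S|lebesgue. h v) = (LINT v|lborel. indicator ?S v *\<^sub>R h v)"
      unfolding set_lebesgue_integral_def by (rule integral_completion) measurable
    also have "\<dots> = (LINT v|lborel. h v)"
      by (rule integral_cong_AE[OF _ _ ae]) measurable
    finally show "(LINT v:?S|lebesgue. h v) = (LINT v|lborel. h v)" .
  qed
  have F': "F absolutely_integrable_on ?S"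
    using F by (simp add: leb)
  have "(\<lambda>v. \<bar>- 1 / v\<^sup>2\<bar> * F (?g v)) absolutely_integrable_on ?S \<and>
      integral ?S (\<lambda>v. \<bar>- 1 / v\<^sup>2\<bar> * F (?g v)) = integral ?S F"
  proof (rule has_absolute_integral_change_of_variables_1'[THEN iffD2, of ?S ?g "\<lambda>v. - 1 / v\<^sup>2"])
    show "(?g has_field_derivative - 1 / v\<^sup>2) (at v within ?S)" if "v \<in> ?S" for v
      using that by (auto intro!: derivative_eq_intros simp: power2_eq_square)
    show "F absolutely_integrable_on ?g ` ?S \<and> integral (?g ` ?S) F = integral ?S F"
      using F' by (simp only: img)
  qed (auto simp: inj_on_def)
  then have c: "(\<lambda>v. 1 / v\<^sup>2 * F (1 / v)) absolutely_integrable_on ?S"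
    "integral ?S (\<lambda>v. 1 / v\<^sup>2 * F (1 / v)) = integral ?S F"
    by simp_all
  show "integrable lborel (\<lambda>v. 1 / v\<^sup>2 * F (1 / v))"
    using c(1) by (subst (asm) leb) measurable
  show "(LINT v|lborel. 1 / v\<^sup>2 * F (1 / v)) = (LINT u|lborel. F u)"
    using c F' by (simp add: leb(2)[symmetric] set_lebesgue_integral_eq_integral)
qed

lemma lborel_integral_reciprocal:
  fixes F :: "real \<Rightarrow> complex"
  assumes "integrable lborel F"
  shows "(LINT v|lborel. complex_of_real (1 / v\<^sup>2) * F (1 / v)) = (LINT u|lborel. F u)"
proof -
  let ?a = "\<lambda>v. 1 / v\<^sup>2 * Re (F (1 / v))" and ?b = "\<lambda>v. 1 / v\<^sup>2 * Im (F (1 / v))"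
  have re: "integrable lborel (\<lambda>u. Re (F u))" and im: "integrable lborel (\<lambda>u. Im (F u))"
    using assms by auto
  note a = lborel_integral_reciprocal_real[OF re] and b = lborel_integral_reciprocal_real[OF im]
  have "complex_of_real (1 / v\<^sup>2) * F (1 / v) = complex_of_real (?a v) + \<i> * complex_of_real (?b v)" for v
    by (simp add: complex_eq_iff)
  then have "(LINT v|lborel. complex_of_real (1 / v\<^sup>2) * F (1 / v))
      = (LINT v|lborel. complex_of_real (?a v) + \<i> * complex_of_real (?b v))"
    by (simp only:)
  also have "\<dots> = complex_of_real (LINT u|lborel. Re (F u)) + \<i> * complex_of_real (LINT u|lborel. Im (F u))"
    using a b by (subst Bochner_Integration.integral_add)
      (simp_all only: integral_complex_of_real integral_mult_right_zero complex_of_real_integrable_eq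
        integrable_mult_right)
  also have "\<dots> = (LINT u|lborel. F u)"
    using assms by (simp add: complex_eq_iff)
  finally show ?thesis .
qed

text \<open>Moving a dilation to the other side of the inner product replaces \<open>u\<close> by \<open>1 / u\<close> and produces the factor
  \<open>1 / \<bar>u\<bar>\<close>; together with the Jacobian \<open>1 / v\<^sup>2\<close> of the reciprocal this leaves the kernel \<open>1 / v\<close> on \<open>v > 1\<close>.\<close>

lemma cinner_cesaro_adj: "cinner (cesaro f) g = cinner f (cesaro_adj g)"
proof -
  note adm0 = admissible_res_kernel[of 0, simplified] and adma = admissible_adj_kernel
  let ?F = "\<lambda>u. res_kernel 0 u * cinner (dil u f) g"
  have AE1: "AE v in lborel. v \<noteq> (1::real)"
    by (rule AE_lborel_singleton)
  have "cinner f (cesaro_adj g) = cnj (LINT v|lborel. adj_kernel v * cinner (dil v g) f)"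
    by (subst cinner_commute) (simp only: cesaro_adj_def cinner_hausdorff[OF adma])
  also have "\<dots> = (LINT v|lborel. cnj (adj_kernel v) * cinner f (dil v g))"
    by (simp add: Bochner_Integration.integral_cnj[symmetric] cinner_commute[symmetric])
  also have "\<dots> = (LINT v|lborel. complex_of_real (1 / v\<^sup>2) * ?F (1 / v))"
  proof (rule integral_cong_AE)
    have "cinner f (dil v g) = cnj (cinner (dil v g) f)" for v
      by (rule cinner_commute)
    then show "(\<lambda>v. cnj (adj_kernel v) * cinner f (dil v g)) \<in> borel_measurable lborel"
      by simp measurable
    show "AE v in lborel. cnj (adj_kernel v) * cinner f (dil v g) = complex_of_real (1 / v\<^sup>2) * ?F (1 / v)"
      using AE1
    proof eventually_elim
      case (elim v)
      show ?case
      proof (cases "v > 1")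
        case True
        then show ?thesis
          using cinner_dil_adjoint[of "1 / v" f g]
          by (simp add: adj_kernel_def res_kernel_def power2_eq_square)
      next
        case False
        then have "\<not> (0 < 1 / v \<and> 1 / v \<le> 1)"
          using elim by (auto simp: divide_simps split: if_splits)
        then have "res_kernel 0 (1 / v) = 0"
          by (simp only: res_kernel_def if_False)
        with False show ?thesis
          by (simp add: adj_kernel_def)
      qed
    qed
  qed measurable
  also have "\<dots> = (LINT u|lborel. ?F u)"
    by (rule lborel_integral_reciprocal[OF admissible_cinner_dil_integrable(1)[OF adm0]])
  finally show ?thesis
    by (simp add: cesaro_eq_hausdorff cinner_hausdorff[OF adm0])
qed

lemma adj_cesaro_commute: "cesaro_adj (cesaro f) = cesaro (cesaro_adj f)"
  unfolding cesaro_adj_def cesaro_eq_hausdorff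
  by (intro hausdorff_commute[where S = cesaro_adj] admissible_res_kernel admissible_adj_kernel)
    (simp_all add: cinner_cesaro_adj flip: cesaro_eq_hausdorff)

lemma resolvent_cesaro_commute: "a \<ge> 0 \<Longrightarrow> resolvent a (cesaro f) = cesaro (resolvent a f)"
  unfolding resolvent_def cesaro_eq_hausdorff
  by (intro hausdorff_commute[where S = cesaro_adj] admissible_res_kernel)
    (simp_all add: cinner_cesaro_adj flip: cesaro_eq_hausdorff)

text \<open>The resolvent identity, multiplied by \<open>a\<close> so that it includes the case \<open>a = 0\<close>. In terms of the symbols it
  reads \<open>a / (w (a + w)) = 1 / w - 1 / (a + w)\<close>.\<close>

lemma resolvent_identity:
  assumes "a \<ge> 0"
  shows "scaleC (complex_of_real a) (cesaro (resolvent a f)) = cesaro f - resolvent a f"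
proof (cases "a = 0")
  case False
  with assms have a: "a > 0" by simp
  note adm0 = admissible_res_kernel[of 0, simplified] and adma = admissible_res_kernel[OF assms]
  have "hausdorff_op (res_kernel a) (hausdorff_op (res_kernel 0) f)
      = hausdorff_op (\<lambda>t. complex_of_real (1/a) * (res_kernel 0 t - res_kernel a t)) f"
  proof (rule hausdorff_comp_eqI[OF adm0 adma])
    show "admissible_kernel (\<lambda>t. complex_of_real (1/a) * (res_kernel 0 t - res_kernel a t))"
      by (intro hausdorff_op_cmult admissible_kernel_diff adm0 adma)
    fix t :: real assume "t \<noteq> 0"
    show "(LINT v|lborel. res_kernel 0 (t / v) * res_kernel a v / complex_of_real \<bar>v\<bar>)
        = complex_of_real (1/a) * (res_kernel 0 t - res_kernel a t)"
    proof (cases "0 < t \<and> t \<le> 1")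
      case True
      have eq: "res_kernel 0 (t / v) * res_kernel a v / complex_of_real \<bar>v\<bar>
          = complex_of_real (indicator {t..1} v * v powr (a - 1))" for v
        using True by (auto simp: res_kernel_def indicator_def powr_diff zero_less_divide_iff)
      have int: "(LINT v|lborel. indicator {t..1} v * v powr (a - 1)) = (1 - t powr a) / a"
      proof (rule nonneg_has_integral_lborel(2))
        have "((\<lambda>v. v powr (a - 1)) has_integral (1 powr a / a - t powr a / a)) {t..1}"
        proof (rule fundamental_theorem_of_calculus)
          fix v assume "v \<in> {t..1}"
          then show "((\<lambda>v. v powr a / a) has_vector_derivative v powr (a - 1)) (at v within {t..1})"
            using True a unfolding has_real_derivative_iff_has_vector_derivative[symmetric]
            by (auto intro!: derivative_eq_intros)
        qed (use True in simp)
        then show "((\<lambda>v. v powr (a - 1)) has_integral ((1 - t powr a) / a)) {t..1}"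
          by (simp add: diff_divide_distrib)
      qed auto
      show ?thesis
        unfolding eq integral_complex_of_real int using True by (simp add: res_kernel_def)
    next
      case False
      with \<open>t \<noteq> 0\<close> have eq: "res_kernel 0 (t / v) * res_kernel a v / complex_of_real \<bar>v\<bar> = 0" for v
        by (auto simp: res_kernel_def divide_simps split: if_splits)
      show ?thesis
        unfolding eq using False by (auto simp: res_kernel_def)
    qed
  qed
  also have "\<dots> = scaleC (complex_of_real (1/a)) (cesaro f - resolvent a f)"
    unfolding hausdorff_op_cmult(2)[OF admissible_kernel_diff[OF adm0 adma]] hausdorff_op_diff[OF adm0 adma]
      cesaro_eq_hausdorff resolvent_def ..
  finally have "cesaro (resolvent a f) = scaleC (complex_of_real (1/a)) (cesaro f - resolvent a f)"
    unfolding resolvent_cesaro_commute[OF assms, symmetric]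
    by (simp only: cesaro_eq_hausdorff resolvent_def)
  then show ?thesis
    using a by simp
qed (simp add: cesaro_eq_hausdorff resolvent_def)

text \<open>With the next identity and \<open>adj_cesaro_commute\<close>, the operator \<open>cesaro - id\<close> has the inverse
  \<open>cesaro_adj - id\<close>, and as \<open>cesaro_adj\<close> is the adjoint of \<open>cesaro\<close>, it is unitary.\<close>

lemma adj_cesaro: "cesaro_adj (cesaro f) = cesaro_adj f + cesaro f"
proof -
  note adm0 = admissible_res_kernel[of 0, simplified] and adma = admissible_adj_kernel
  have adms: "admissible_kernel (\<lambda>t. adj_kernel t - complex_of_real (-1) * res_kernel 0 t)"
    by (intro hausdorff_op_cmult admissible_kernel_diff adm0 adma)
  have "cesaro_adj (cesaro f) = hausdorff_op (\<lambda>t. adj_kernel t - complex_of_real (-1) * res_kernel 0 t) f"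
    unfolding adj_cesaro_commute unfolding cesaro_adj_def cesaro_eq_hausdorff
  proof (rule hausdorff_comp_eqI[OF adma adm0 adms])
    fix t :: real assume t: "t \<noteq> 0"
    have AE1: "AE v in lborel. v \<noteq> t"
      by (rule AE_lborel_singleton)
    have eq: "(LINT v|lborel. adj_kernel (t / v) * res_kernel 0 v / complex_of_real \<bar>v\<bar>)
        = (LINT v|lborel. complex_of_real (indicator {0<..min 1 t} v * (1 / t)))"
    proof (rule integral_cong_AE; (measurable)?)
      show "AE v in lborel. adj_kernel (t / v) * res_kernel 0 v / complex_of_real \<bar>v\<bar>
          = complex_of_real (indicator {0<..min 1 t} v * (1 / t))"
        using AE1 by eventually_elim
          (use t in \<open>auto simp: adj_kernel_def res_kernel_def indicator_def field_simps split: if_splits\<close>)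
    qed
    also have "\<dots> = complex_of_real (measure lborel {0<..min 1 t} * (1 / t))"
      by simp
    also have "\<dots> = adj_kernel t - complex_of_real (-1) * res_kernel 0 t"
      using t by (auto simp: adj_kernel_def res_kernel_def min_def)
    finally show "(LINT v|lborel. adj_kernel (t / v) * res_kernel 0 v / complex_of_real \<bar>v\<bar>)
        = adj_kernel t - complex_of_real (-1) * res_kernel 0 t" .
  qed
  also have "\<dots> = cesaro_adj f - scaleC (complex_of_real (-1)) (cesaro f)"
    by (simp only: hausdorff_op_diff hausdorff_op_cmult adma adm0 cesaro_adj_def cesaro_eq_hausdorff)
  finally show ?thesis by simp
qed

text \<open>The positive and the negative part of \<open>G\<close> are densities of finite measures that agree on all half-lines, so
  the measures are equal, and with them the densities.\<close>

lemma AE_zero_if_integrals_zero: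
  fixes G :: "real \<Rightarrow> real"
  assumes G: "integrable lborel G" and zero: "\<And>x. (LINT t|lborel. indicator {x<..} t * G t) = 0"
  shows "AE t in lborel. G t = 0"
proof -
  have [measurable]: "G \<in> borel_measurable borel" using G by auto
  let ?M = "\<lambda>H. density lborel (\<lambda>t. ennreal (H t))"
  have fin: "(\<integral>\<^sup>+t. ennreal (H t) * indicator {x<..} t \<partial>lborel) < \<infinity>" if "integrable lborel H" for H :: "real \<Rightarrow> real" and x
  proof -
    have "(\<integral>\<^sup>+t. ennreal (H t) * indicator {x<..} t \<partial>lborel) \<le> (\<integral>\<^sup>+t. ennreal (norm (H t)) \<partial>lborel)"
      by (intro nn_integral_mono) (auto simp: indicator_def intro: ennreal_leI)
    also have "\<dots> < \<infinity>"
      using that by (simp add: integrable_iff_bounded)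
    finally show ?thesis .
  qed
  have fin': "(\<integral>\<^sup>+t. ennreal (G t) * indicator {x<..} t \<partial>lborel) < \<infinity>"
    "(\<integral>\<^sup>+t. ennreal (- G t) * indicator {x<..} t \<partial>lborel) < \<infinity>" for x
    using fin[of G x] fin[of "\<lambda>t. - G t" x] G by auto
  have "?M G = ?M (\<lambda>t. - G t)"
  proof (rule measure_eqI_lessThan)
    fix x
    show "emeasure (?M G) {x<..} < \<infinity>"
      using fin'(1) by (simp add: emeasure_density)
    have "integrable lborel (\<lambda>t. indicator {x<..} t * G t)"
      using integrable_mult_indicator[OF _ G, of "{x<..}"] by simp
    from real_lebesgue_integral_def[OF this]
    have "enn2real (\<integral>\<^sup>+t. ennreal (indicator {x<..} t * G t) \<partial>lborel)
        = enn2real (\<integral>\<^sup>+t. ennreal (- (indicator {x<..} t * G t)) \<partial>lborel)"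
      by (simp add: zero)
    moreover have "(\<lambda>t. ennreal (indicator {x<..} t * G t)) = (\<lambda>t. ennreal (G t) * indicator {x<..} t)"
      "(\<lambda>t. ennreal (- (indicator {x<..} t * G t))) = (\<lambda>t. ennreal (- G t) * indicator {x<..} t)"
      by (auto simp: indicator_def)
    ultimately have "ennreal (enn2real (\<integral>\<^sup>+t. ennreal (G t) * indicator {x<..} t \<partial>lborel))
        = ennreal (enn2real (\<integral>\<^sup>+t. ennreal (- G t) * indicator {x<..} t \<partial>lborel))"
      by (simp only:)
    then have "(\<integral>\<^sup>+t. ennreal (G t) * indicator {x<..} t \<partial>lborel)
        = (\<integral>\<^sup>+t. ennreal (- G t) * indicator {x<..} t \<partial>lborel)"
      using fin'(1)[of x] fin'(2)[of x] by (simp only: ennreal_enn2real infinity_ennreal_def)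
    then show "emeasure (?M G) {x<..} = emeasure (?M (\<lambda>t. - G t)) {x<..}"
      by (simp add: emeasure_density)
  qed simp_all
  then have "AE t in lborel. ennreal (G t) = ennreal (- G t)"
    by (intro sigma_finite_measure.density_unique[OF sigma_finite_lborel]) simp_all
  then show ?thesis
  proof eventually_elim
    case (elim t)
    then show ?case
      by (cases "G t \<ge> 0") (auto simp: ennreal_neg)
  qed
qed

lemma rep_l2_set_integrable: "set_integrable lborel {a..b} (rep_l2 f)"
  unfolding set_integrable_def
proof (rule Bochner_Integration.integrable_bound)
  show "integrable lborel (\<lambda>x. indicator {a..b} x + (cmod (rep_l2 f x))\<^sup>2 :: real)"
    using square_integrable_rep[of f] by (auto simp: square_integrable_def emeasure_lborel_Icc_eq)
  show "AE x in lborel. norm (indicator {a..b} x *\<^sub>R rep_l2 f x)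
      \<le> norm (indicator {a..b} x + (cmod (rep_l2 f x))\<^sup>2 :: real)"
  proof (rule AE_I2)
    fix x
    have "cmod (rep_l2 f x) \<le> 1 + (cmod (rep_l2 f x))\<^sup>2"
      using zero_le_power2[of "cmod (rep_l2 f x) - 1/2"] by (simp add: power2_eq_square algebra_simps)
    then show "norm (indicator {a..b} x *\<^sub>R rep_l2 f x)
      \<le> norm (indicator {a..b} x + (cmod (rep_l2 f x))\<^sup>2 :: real)"
      by (simp add: indicator_def)
  qed
qed measurable

text \<open>If \<open>cesaro f = 0\<close>, the continuous function \<open>x \<mapsto> \<integral>\<^sub>0\<^sup>x f\<close> vanishes almost everywhere, hence
  everywhere, so that \<open>f\<close> has integral \<open>0\<close> over every interval.\<close>

lemma cesaro_eq_0_imp: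
  assumes "cesaro f = 0"
  shows "f = 0"
proof -
  have "AE x in lborel. complex_of_real (1 / x) * (LBINT t=0..ereal x. rep_l2 f t) = rep_l2 0 x"
    using assms unfolding cesaro_def by (simp only: abs_l2_eq_iff[OF square_integrable_cesaro])
  moreover have "AE x in lborel. rep_l2 0 x = 0"
    unfolding zero_l2_def by (rule rep_abs_l2[OF square_integrable_zero])
  ultimately have ae0: "AE x in lborel. (LBINT t=0..ereal x. rep_l2 f t) = 0"
    using AE_neq_0 by eventually_elim auto
  have J0: "integral {- real n..x} (rep_l2 f) = 0" if x: "x \<in> {- real n..real n}" for n x
  proof (cases "n = 0")
    case True
    with x show ?thesis by simp
  next
    case False
    define J where "J x = integral {- real n..x} (rep_l2 f)" for x
    have int: "rep_l2 f integrable_on {a..b}" for a b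
      by (rule set_borel_integral_eq_integral(1)[OF rep_l2_set_integrable])
    have cont: "continuous_on {- real n..real n} J"
      unfolding J_def by (rule indefinite_integral_continuous_1[OF int])
    have eq: "(LBINT t=0..ereal x. rep_l2 f t) = J x - J 0" if "x \<in> {- real n<..<real n}" for x
    proof (cases "x \<ge> 0")
      case True
      have "(LBINT t=0..ereal x. rep_l2 f t) = integral {0..x} (rep_l2 f)"
        using interval_integral_eq_integral[of 0 x "rep_l2 f"] True rep_l2_set_integrable
        by (simp add: zero_ereal_def)
      moreover have "J 0 + integral {0..x} (rep_l2 f) = J x"
        unfolding J_def using True by (intro Henstock_Kurzweil_Integration.integral_combine int) auto
      ultimately show ?thesis by (simp add: algebra_simps)
    next
      case False
      have "(LBINT t=0..ereal x. rep_l2 f t) = - integral {x..0} (rep_l2 f)"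
        using interval_integral_eq_integral[of x 0 "rep_l2 f"] False rep_l2_set_integrable
        by (subst interval_integral_endpoints_reverse) (simp add: zero_ereal_def)
      moreover have "J x + integral {x..0} (rep_l2 f) = J 0"
        unfolding J_def using False that by (intro Henstock_Kurzweil_Integration.integral_combine int) auto
      ultimately show ?thesis by (simp add: algebra_simps)
    qed
    have "AE x in lborel. x \<in> {- real n<..<real n} \<longrightarrow> x \<in> {x \<in> {- real n..real n}. J x = J 0}"
      using ae0 by eventually_elim (auto simp: eq)
    then have ae: "AE x\<in>{- real n<..<real n} in lebesgue. x \<in> {x \<in> {- real n..real n}. J x = J 0}"
      by (rule AE_completion)
    have closed: "closed {x \<in> {- real n..real n}. J x = J 0}"
      by (rule continuous_closed_preimage_constant[OF cont closed_atLeastAtMost])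
    have "{- real n<..<real n} \<subseteq> {x \<in> {- real n..real n}. J x = J 0}"
      by (intro subsetI mem_closed_if_AE_lebesgue_open[OF open_greaterThanLessThan closed ae])
    then have "closure {- real n<..<real n} \<subseteq> {x \<in> {- real n..real n}. J x = J 0}"
      by (rule closure_minimal[OF _ closed])
    moreover have "closure {- real n<..<real n} = {- real n..real n}"
      using False by (intro closure_greaterThanLessThan) simp
    ultimately have "J x = J 0" if "x \<in> {- real n..real n}" for x
      using that by blast
    from this[OF x] this[of "- real n"] have "J x = J (- real n)"
      by simp
    then show ?thesis by (simp add: J_def)
  qed
  have "AE t in lborel. indicator {- real n..real n} t *\<^sub>R rep_l2 f t = 0" for n
  proof -
    let ?G = "\<lambda>t. indicator {- real n..real n} t *\<^sub>R rep_l2 f t"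
    have G: "integrable lborel ?G"
      using rep_l2_set_integrable[of "- real n" "real n" f] by (simp add: set_integrable_def)
    have zero: "(LINT t|lborel. indicator {x<..} t *\<^sub>R ?G t) = 0" for x
    proof -
      define y where "y = max x (- real n)"
      have int: "rep_l2 f integrable_on {a..b}" for a b
        by (rule set_borel_integral_eq_integral(1)[OF rep_l2_set_integrable])
      have ne: "AE t in lborel. t \<noteq> y"
        by (rule AE_lborel_singleton)
      have "(LINT t|lborel. indicator {x<..} t *\<^sub>R ?G t) = (LINT t|lborel. indicator {y..real n} t *\<^sub>R rep_l2 f t)"
      proof (rule integral_cong_AE; (measurable)?)
        show "AE t in lborel. indicator {x<..} t *\<^sub>R ?G t = indicator {y..real n} t *\<^sub>R rep_l2 f t"
          using ne by eventually_elim (auto simp: y_def indicator_def)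
      qed
      also have "\<dots> = integral {y..real n} (rep_l2 f)"
        using set_borel_integral_eq_integral(2)[OF rep_l2_set_integrable, of y "real n" f]
        by (simp add: set_lebesgue_integral_def)
      also have "\<dots> = 0"
      proof (cases "y \<le> real n")
        case True
        then have "integral {- real n..y} (rep_l2 f) + integral {y..real n} (rep_l2 f)
            = integral {- real n..real n} (rep_l2 f)"
          by (intro Henstock_Kurzweil_Integration.integral_combine int) (auto simp: y_def)
        then show ?thesis
          using J0[of y n] J0[of "real n" n] True by (simp add: y_def)
      qed simp
      finally show ?thesis .
    qed
    have zi: "integrable lborel (\<lambda>t. indicator {x<..} t *\<^sub>R ?G t)" for x
      by (rule integrable_mult_indicator[OF _ G]) simp
    have re: "AE t in lborel. Re (?G t) = 0"
    proof (rule AE_zero_if_integrals_zero)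
      fix x
      show "(LINT t|lborel. indicator {x<..} t * Re (?G t)) = 0"
        using integral_Re[OF zi, of x] zero[of x] by (simp add: mult.assoc)
    qed (rule integrable_Re[OF G])
    have im: "AE t in lborel. Im (?G t) = 0"
    proof (rule AE_zero_if_integrals_zero)
      fix x
      show "(LINT t|lborel. indicator {x<..} t * Im (?G t)) = 0"
        using integral_Im[OF zi, of x] zero[of x] by (simp add: mult.assoc)
    qed (rule integrable_Im[OF G])
    from re im show ?thesis
      by eventually_elim (simp add: complex_eq_iff)
  qed
  then have "AE t in lborel. \<forall>n. indicator {- real n..real n} t *\<^sub>R rep_l2 f t = 0"
    unfolding AE_all_countable by simp
  then have "AE t in lborel. 0 = rep_l2 f t"
  proof eventually_elim
    case (elim t)
    obtain n where "\<bar>t\<bar> \<le> real n" using real_arch_simple by blast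
    with elim[rule_format, of n] show ?case by (simp add: abs_le_iff)
  qed
  then show ?thesis
    using abs_l2_eq_iff[OF square_integrable_zero, of f] by (simp add: zero_l2_def)
qed

section \<open>Scalar symbols\<close>

text \<open>The symbol as a function of the kernel; by \<open>scalar_symbol_hausdorff\<close> below, any kernel of the operator
  computes its symbol.\<close>

definition symbol :: "(real \<Rightarrow> complex) \<Rightarrow> real \<Rightarrow> complex" where
  "symbol K s = (LINT u|lborel. K u *
     (complex_of_real (\<bar>u\<bar> powr (-1/2)) * exp (- \<i> * complex_of_real s * complex_of_real (ln \<bar>u\<bar>))))"

text \<open>The function \<open>\<bar>x\<bar> powr (-1/2 - \<i> s)\<close> is an eigenfunction of all dilations but just fails to be square integrable at
  \<open>0\<close> and at infinity. Cutting off \<open>[-1, 1]\<close> and lowering the exponent by \<open>d\<close> repairs this, and the factor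
  \<open>sqrt d\<close> normalises the result.\<close>

definition wave_fun :: "real \<Rightarrow> real \<Rightarrow> real \<Rightarrow> complex" where
  "wave_fun d s x = (if 1 < \<bar>x\<bar> then complex_of_real (sqrt d * \<bar>x\<bar> powr (- 1/2 - d))
     * exp (- \<i> * complex_of_real s * complex_of_real (ln \<bar>x\<bar>)) else 0)"

lemma wave_fun_measurable [measurable]: "wave_fun d s \<in> borel_measurable borel"
  unfolding wave_fun_def by measurable

lemma tail_integral:
  fixes d m :: real
  assumes "d > 0" "m > 0"
  shows "integrable lborel (\<lambda>x. if m < \<bar>x\<bar> then \<bar>x\<bar> powr (- 1 - 2 * d) else 0)" (is "integrable _ ?q")
    and "(LINT x|lborel. (if m < \<bar>x\<bar> then \<bar>x\<bar> powr (- 1 - 2 * d) else 0)) = m powr (- 2 * d) / d"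
proof -
  let ?r = "\<lambda>x::real. indicator {m..} x * x powr (- 1 - 2 * d)"
  have "((\<lambda>x. x powr (- 1 - 2 * d)) has_integral (m powr (- 2 * d) / (2 * d))) {m..}"
    using has_integral_powr_to_inf[of "- 1 - 2 * d" m] assms by simp
  from nonneg_has_integral_lborel[OF _ _ _ this]
  have r: "integrable lborel ?r" "(LINT x|lborel. ?r x) = m powr (- 2 * d) / (2 * d)"
    by simp_all
  have r': "integrable lborel (\<lambda>x. ?r (- x))" "(LINT x|lborel. ?r (- x)) = m powr (- 2 * d) / (2 * d)"
    using lborel_integrable_real_affine[OF r(1), of "-1" 0] lborel_integral_real_affine[of "-1" ?r 0] r(2)
    by simp_all
  have s: "integrable lborel (\<lambda>x. ?r x + ?r (- x))" "(LINT x|lborel. ?r x + ?r (- x)) = m powr (- 2 * d) / d"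
    using r r' by (simp_all add: field_simps)
  have "AE x in lborel. x \<noteq> m \<and> x \<noteq> - m"
    using AE_lborel_singleton[of m] AE_lborel_singleton[of "- m"] by eventually_elim simp
  then have ae: "AE x in lborel. ?r x + ?r (- x) = ?q x"
    by eventually_elim (use assms in \<open>auto simp: indicator_def\<close>)
  show "integrable lborel ?q"
    by (rule integrable_cong_AE_imp[OF s(1) _ ae]) measurable
  have "(LINT x|lborel. ?r x + ?r (- x)) = integral\<^sup>L lborel ?q"
    by (rule integral_cong_AE[OF _ _ ae]) measurable
  with s(2) show "integral\<^sup>L lborel ?q = m powr (- 2 * d) / d"
    by simp
qed

lemma square_integrable_wave_fun:
  assumes "d > 0"
  shows "square_integrable (wave_fun d s)"
proof -
  have "(cmod (wave_fun d s x))\<^sup>2 = d * (if 1 < \<bar>x\<bar> then \<bar>x\<bar> powr (- 1 - 2 * d) else 0)" for x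
    using assms by (simp add: wave_fun_def norm_mult power_mult_distrib powr_squared algebra_simps)
  then show ?thesis
    using tail_integral(1)[OF assms, of 1] by (simp add: square_integrable_def)
qed

lemma cinner_dil_wave_fun:
  assumes "d > 0" "u \<noteq> 0"
  shows "cinner (dil u (abs_l2 (wave_fun d s))) (abs_l2 (wave_fun d s))
    = complex_of_real (\<bar>u\<bar> powr (- 1/2 - d) * max 1 (1 / \<bar>u\<bar>) powr (- 2 * d))
      * exp (- \<i> * complex_of_real s * complex_of_real (ln \<bar>u\<bar>))"
proof -
  let ?e = "\<lambda>x. exp (- \<i> * complex_of_real s * complex_of_real (ln \<bar>x\<bar>))"
  \<comment> \<open>both \<open>wave_fun d s x\<close> and its dilation are nonzero precisely for \<open>\<bar>x\<bar> > ?m\<close>\<close>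
  let ?m = "max 1 (1 / \<bar>u\<bar>)"
  let ?q = "\<lambda>x. if ?m < \<bar>x\<bar> then \<bar>x\<bar> powr (- 1 - 2 * d) else 0"
  have pt: "wave_fun d s (u * x) * cnj (wave_fun d s x)
      = complex_of_real (d * \<bar>u\<bar> powr (- 1/2 - d)) * ?e u * complex_of_real (?q x)" for x
  proof (cases "?m < \<bar>x\<bar>")
    case True
    then have x: "1 < \<bar>x\<bar>" "1 < \<bar>u * x\<bar>" "x \<noteq> 0"
      using assms(2) by (auto simp: abs_mult field_simps)
    have "?e (u * x) * cnj (?e x) = ?e u"
      using x assms(2) unfolding exp_cnj exp_add[symmetric]
      by (intro arg_cong[where f = exp]) (simp add: abs_mult ln_mult algebra_simps)
    moreover have "(sqrt d * \<bar>u * x\<bar> powr (- 1/2 - d)) * (sqrt d * \<bar>x\<bar> powr (- 1/2 - d))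
        = (sqrt d * sqrt d) * \<bar>u\<bar> powr (- 1/2 - d) * (\<bar>x\<bar> powr (- 1/2 - d) * \<bar>x\<bar> powr (- 1/2 - d))"
      by (simp add: abs_mult powr_mult)
    then have "(sqrt d * \<bar>u * x\<bar> powr (- 1/2 - d)) * (sqrt d * \<bar>x\<bar> powr (- 1/2 - d))
        = d * \<bar>u\<bar> powr (- 1/2 - d) * \<bar>x\<bar> powr (- 1 - 2 * d)"
      using assms(1) by (simp flip: powr_add)
    moreover have "wave_fun d s (u * x) * cnj (wave_fun d s x)
        = complex_of_real ((sqrt d * \<bar>u * x\<bar> powr (- 1/2 - d)) * (sqrt d * \<bar>x\<bar> powr (- 1/2 - d)))
          * (?e (u * x) * cnj (?e x))"
      using x by (simp add: wave_fun_def)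
    ultimately have "wave_fun d s (u * x) * cnj (wave_fun d s x)
        = complex_of_real (d * \<bar>u\<bar> powr (- 1/2 - d) * \<bar>x\<bar> powr (- 1 - 2 * d)) * ?e u"
      by (simp only:)
    then show ?thesis
      using True by simp
  next
    case False
    then have "\<not> (1 < \<bar>u * x\<bar> \<and> 1 < \<bar>x\<bar>)"
      using assms(2) by (auto simp: abs_mult field_simps max_def split: if_splits)
    with False show ?thesis
      by (auto simp: wave_fun_def)
  qed
  have rep: "AE x in lborel. rep_l2 (abs_l2 (wave_fun d s)) x = wave_fun d s x"
    by (rule rep_abs_l2[OF square_integrable_wave_fun[OF assms(1)]])
  have "cinner (dil u (abs_l2 (wave_fun d s))) (abs_l2 (wave_fun d s))
      = (LINT x|lborel. wave_fun d s (u * x) * cnj (wave_fun d s x))"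
    unfolding cinner_dil[OF assms(2)]
    by (rule integral_cong_AE; (measurable)?)
      (use rep AE_dilation[OF rep assms(2)] in eventually_elim, simp)
  also have "\<dots> = complex_of_real (d * \<bar>u\<bar> powr (- 1/2 - d)) * ?e u * complex_of_real (?m powr (- 2 * d) / d)"
    unfolding pt integral_mult_right_zero integral_complex_of_real
    using tail_integral(2)[OF assms(1), of ?m] by simp
  finally show ?thesis
    using assms(1) by (simp add: field_simps)
qed

definition wave :: "real \<Rightarrow> nat \<Rightarrow> l2" where
  "wave s n = abs_l2 (wave_fun (1 / real (Suc n)) s)"

lemma norm_wave [simp]: "norm (wave s n) = 1"
proof -
  have "complex_of_real ((norm (wave s n))\<^sup>2) = complex_of_real 1"
    unfolding cinner_self[symmetric] wave_def using cinner_dil_wave_fun[of "1 / real (Suc n)" 1 s] by simp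
  then have "(norm (wave s n))\<^sup>2 = 1\<^sup>2" by (simp only: of_real_eq_iff one_power2)
  then show ?thesis by (rule power2_eq_imp_eq) auto
qed

text \<open>In the limit the waves are eigenvectors of the dilations, so they recover the symbol of an operator
  without reference to its kernel. The limit may be taken under the integral because
  \<open>\<bar>cinner (dil u e) e\<bar> \<le> \<bar>u\<bar> powr (-1/2)\<close> for unit vectors \<open>e\<close>.\<close>

lemma wave_symbol:
  assumes "admissible_kernel K"
  shows "(\<lambda>n. cinner (hausdorff_op K (wave s n)) (wave s n)) \<longlonglongrightarrow> symbol K s"
  unfolding symbol_def cinner_hausdorff[OF assms]
proof (rule integral_dominated_convergence)
  note [measurable] = admissible_measurable[OF assms]
  show "integrable lborel (\<lambda>u. cmod (K u) * \<bar>u\<bar> powr (-1/2))"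
    by (rule admissible_integrable[OF assms])
  show "(\<lambda>u. K u * (complex_of_real (\<bar>u\<bar> powr (-1/2)) * exp (- \<i> * complex_of_real s * complex_of_real (ln \<bar>u\<bar>))))
      \<in> borel_measurable lborel"
    "(\<lambda>u. K u * cinner (dil u (wave s n)) (wave s n)) \<in> borel_measurable lborel" for n
    by measurable
  let ?d = "\<lambda>n. 1 / real (Suc n)"
  have d0: "?d \<longlonglongrightarrow> 0"
    using LIMSEQ_inverse_real_of_nat by (simp add: inverse_eq_divide)
  show "AE u in lborel. (\<lambda>n. K u * cinner (dil u (wave s n)) (wave s n)) \<longlonglongrightarrow> K u *
      (complex_of_real (\<bar>u\<bar> powr (-1/2)) * exp (- \<i> * complex_of_real s * complex_of_real (ln \<bar>u\<bar>)))"
    using AE_neq_0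
  proof eventually_elim
    case (elim u)
    define M where "M = max 1 (1 / \<bar>u\<bar>)"
    have M: "M > 0" by (simp add: M_def)
    have "(\<lambda>n. \<bar>u\<bar> powr (- 1/2 - ?d n) * M powr (- 2 * ?d n)) \<longlonglongrightarrow> \<bar>u\<bar> powr (- 1/2 - 0) * M powr (- 2 * 0)"
      by (intro tendsto_intros d0) (use elim M in auto)
    then have "(\<lambda>n. \<bar>u\<bar> powr (- 1/2 - ?d n) * M powr (- 2 * ?d n)) \<longlonglongrightarrow> \<bar>u\<bar> powr (- 1/2)"
      using M by simp
    then have "(\<lambda>n. complex_of_real (\<bar>u\<bar> powr (- 1/2 - ?d n) * M powr (- 2 * ?d n))) \<longlonglongrightarrow> complex_of_real (\<bar>u\<bar> powr (- 1/2))"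
      by (rule tendsto_of_real)
    from tendsto_mult[OF tendsto_const tendsto_mult[OF this tendsto_const]]
    show ?case
      unfolding wave_def by (subst cinner_dil_wave_fun[OF _ elim]) (auto simp: M_def)
  qed
  show "AE u in lborel. norm (K u * cinner (dil u (wave s n)) (wave s n)) \<le> cmod (K u) * \<bar>u\<bar> powr (-1/2)" for n
    using cmod_cinner_dil_le[of _ "wave s n" "wave s n"] by (intro AE_I2) (simp add: norm_mult mult_left_mono)
qed

lemma scalar_symbol_hausdorff:
  assumes "admissible_kernel K"
  shows "scalar_symbol (hausdorff_op K) s = symbol K s"
proof -
  let ?L = "kernel_of (hausdorff_op K)"
  have L: "admissible_kernel ?L \<and> hausdorff_op K = hausdorff_op ?L"
    unfolding kernel_of_def by (rule someI[of _ K]) (simp add: assms)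
  have "symbol ?L s = symbol K s"
    using wave_symbol[of ?L s] wave_symbol[OF assms, of s] L by (auto intro: LIMSEQ_unique)
  then show ?thesis
    by (simp add: scalar_symbol_def symbol_def)
qed

lemma symbol_cesaro: "symbol (res_kernel 0) s = 1 / (1/2 - \<i> * complex_of_real s)"
proof -
  define w where "w = 1/2 - \<i> * complex_of_real s"
  have w: "Re w > 0" "w \<noteq> 0" by (auto simp: w_def complex_eq_iff)
  let ?F = "\<lambda>u. res_kernel 0 u *
     (complex_of_real (\<bar>u\<bar> powr (-1/2)) * exp (- \<i> * complex_of_real s * complex_of_real (ln \<bar>u\<bar>)))"
  let ?P = "\<lambda>u::real. complex_of_real u powr (w - 1)"
  have eq: "?F u = indicator {0..1} u *\<^sub>R ?P u" for u
  proof (cases "0 < u \<and> u \<le> 1")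
    case True
    then have "complex_of_real u powr (w - 1) = exp ((w - 1) * complex_of_real (ln u))"
      by (simp add: powr_def Ln_of_real)
    also have "(w - 1) * complex_of_real (ln u) = (- 1/2) * complex_of_real (ln u) + (- \<i> * complex_of_real s * complex_of_real (ln u))"
      by (simp add: w_def algebra_simps)
    also have "exp \<dots> = exp ((- 1/2) * complex_of_real (ln u)) * exp (- \<i> * complex_of_real s * complex_of_real (ln u))"
      by (rule exp_add)
    also have "exp ((- 1/2) * complex_of_real (ln u)) = complex_of_real (u powr (-1/2))"
      using True by (simp add: powr_def exp_of_real[symmetric])
    finally show ?thesis
      using True by (simp add: res_kernel_def)
  next
    case False
    then show ?thesis by (cases "u = 0") (auto simp: res_kernel_def indicator_def)
  qed
  have int: "integrable lborel ?F"
  proof (rule Bochner_Integration.integrable_bound[OF res_kernel_weight(1)[of 0]])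
    show "AE u in lborel. norm (?F u) \<le> norm (cmod (res_kernel 0 u) * \<bar>u\<bar> powr (-1/2))"
      by (intro AE_I2) (simp add: norm_mult)
  qed auto
  have int': "set_integrable lborel {0..1} ?P"
    using int unfolding set_integrable_def eq .
  have "(?P has_integral (complex_of_real 1 powr w / w - complex_of_real 0 powr w / w)) {0..1}"
  proof (rule fundamental_theorem_of_calculus_interior)
    show "continuous_on {0..1} (\<lambda>u. complex_of_real u powr w / w)"
      using w by (intro continuous_intros continuous_on_powr_complex) auto
    show "((\<lambda>u. complex_of_real u powr w / w) has_vector_derivative ?P u) (at u)" if "u \<in> {0<..<1}" for u
    proof -
      have "((\<lambda>z. z powr w / w) has_field_derivative ?P u) (at (complex_of_real u))"
        using that w by (auto intro!: derivative_eq_intros simp: complex_nonpos_Reals_iff)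
      from has_vector_derivative_real_field[OF this] show ?thesis .
    qed
  qed simp
  then have "integral {0..1} ?P = 1 / w"
    using w by (simp add: integral_unique)
  moreover have "symbol (res_kernel 0) s = (LINT u:{0..1}|lborel. ?P u)"
    unfolding symbol_def set_lebesgue_integral_def eq ..
  ultimately show ?thesis
    using set_borel_integral_eq_integral(2)[OF int'] by (simp add: w_def)
qed

section \<open>Operators that act as functions of the Cesaro operator\<close>

definition circ :: "complex set" where
  "circ = {z. cmod (z - 1) = 1}"

lemma circ_eq_sphere: "circ = sphere 1 1"
  by (auto simp: circ_def dist_norm norm_minus_commute)

lemma compact_circ: "compact circ"
  by (simp add: circ_eq_sphere)

lemma circ_norm: "z \<in> circ \<Longrightarrow> (cmod z)\<^sup>2 = 2 * Re z"
proof -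
  assume "z \<in> circ"
  then have "(Re z - 1)\<^sup>2 + (Im z)\<^sup>2 = 1"
    by (simp add: circ_def cmod_def)
  then show ?thesis
    by (simp add: cmod_power2 power2_diff)
qed

lemma circ_Re_nonneg: "z \<in> circ \<Longrightarrow> 0 \<le> Re z"
  using circ_norm[of z] zero_le_power2[of "cmod z"] by linarith

lemma circ_cnj: "z \<in> circ \<Longrightarrow> z * cnj z = z + cnj z"
  using circ_norm[of z] unfolding cmod_power2 by (simp add: complex_eq_iff power2_eq_square)

lemma circ_norm_le: "z \<in> circ \<Longrightarrow> cmod z \<le> 2"
  using norm_triangle_ineq[of "z - 1" 1] by (simp add: circ_def)

lemma ex_small_factor:
  fixes r K :: real
  assumes "r > 0" "K \<ge> 0"
  shows "\<exists>d>0. d * K < r"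
  using assms by (intro exI[of _ "r / (K + 1)"]) (simp add: field_simps)

text \<open>\<open>calc p S\<close> expresses that \<open>S\<close> is the function \<open>p\<close> of the Cesaro operator: vectors that nearly are
  eigenvectors of the Cesaro operator with eigenvalue \<open>z\<close> nearly are eigenvectors of \<open>S\<close> with
  eigenvalue \<open>p z\<close>, uniformly in \<open>z\<close>. The summand with \<open>r\<close> makes the notion stable under uniform limits.\<close>

definition calc :: "(complex \<Rightarrow> complex) \<Rightarrow> (l2 \<Rightarrow> l2) \<Rightarrow> bool" where
  "calc p S \<longleftrightarrow> bounded_clinear S \<and> (\<forall>f. S (cesaro f) = cesaro (S f)) \<and>
     (\<exists>B. \<forall>z\<in>circ. cmod (p z) \<le> B) \<and>
     (\<forall>r>0. \<exists>c. \<forall>z\<in>circ. \<forall>e. norm (S e - scaleC (p z) e) \<le> r * norm e + c * norm (cesaro e - scaleC z e))"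

lemma calcI:
  assumes "bounded_clinear S" "\<And>f. S (cesaro f) = cesaro (S f)"
    "\<And>z. z \<in> circ \<Longrightarrow> cmod (p z) \<le> B"
    "\<And>r. r > 0 \<Longrightarrow> \<exists>c. \<forall>z\<in>circ. \<forall>e. norm (S e - scaleC (p z) e) \<le> r * norm e + c * norm (cesaro e - scaleC z e)"
  shows "calc p S"
  using assms unfolding calc_def by blast

lemma calcI_linear:
  assumes "bounded_clinear S" "\<And>f. S (cesaro f) = cesaro (S f)"
    "\<And>z. z \<in> circ \<Longrightarrow> cmod (p z) \<le> B"
    "\<And>z e. z \<in> circ \<Longrightarrow> norm (S e - scaleC (p z) e) \<le> c * norm (cesaro e - scaleC z e)"
  shows "calc p S"
proof (rule calcI[OF assms(1-3)])
  fix r :: real assume "r > 0"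
  then have "norm (S e - scaleC (p z) e) \<le> r * norm e + c * norm (cesaro e - scaleC z e)" if "z \<in> circ" for z e
    using assms(4)[OF that, of e] mult_nonneg_nonneg[OF less_imp_le[OF \<open>r > 0\<close>] norm_ge_zero[of e]]
    by linarith
  then show "\<exists>c. \<forall>z\<in>circ. \<forall>e. norm (S e - scaleC (p z) e) \<le> r * norm e + c * norm (cesaro e - scaleC z e)"
    by blast
qed

lemma calc_bounded_clinear: "calc p S \<Longrightarrow> bounded_clinear S"
  and calc_commute: "calc p S \<Longrightarrow> S (cesaro f) = cesaro (S f)"
  by (simp_all add: calc_def)

lemma calc_approx:
  assumes "calc p S" "r > 0"
  obtains c where "c \<ge> 0"
    "\<And>z e. z \<in> circ \<Longrightarrow> norm (S e - scaleC (p z) e) \<le> r * norm e + c * norm (cesaro e - scaleC z e)"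
proof -
  obtain c where c: "\<And>z e. z \<in> circ \<Longrightarrow> norm (S e - scaleC (p z) e) \<le> r * norm e + c * norm (cesaro e - scaleC z e)"
    using assms unfolding calc_def by blast
  have "norm (S e - scaleC (p z) e) \<le> r * norm e + \<bar>c\<bar> * norm (cesaro e - scaleC z e)" if "z \<in> circ" for z e
    using c[OF that, of e] mult_right_mono[OF abs_ge_self[of c], of "norm (cesaro e - scaleC z e)"] by simp
  then show ?thesis
    by (intro that[of "\<bar>c\<bar>"]) auto
qed

lemma calc_bdd:
  assumes "calc p S"
  obtains B where "B \<ge> 0" "\<And>z. z \<in> circ \<Longrightarrow> cmod (p z) \<le> B"
proof -
  obtain B where B: "\<And>z. z \<in> circ \<Longrightarrow> cmod (p z) \<le> B"
    using assms unfolding calc_def by blast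
  then show ?thesis
    by (intro that[of "\<bar>B\<bar>"]) (auto intro: order_trans[OF _ abs_ge_self])
qed

lemma calc_cong:
  assumes "\<And>z. z \<in> circ \<Longrightarrow> p z = q z"
  shows "calc p S \<longleftrightarrow> calc q S"
  using assms by (simp add: calc_def)

lemma calc_const: "calc (\<lambda>_. a) (scaleC a)"
  by (rule calcI_linear[where B = "cmod a" and c = 0])
    (simp_all add: bounded_clinear_scaleC_const bounded_clinear_scaleC[OF bounded_clinear_cesaro])

lemma calc_one: "calc (\<lambda>_. 1) id"
  using calc_const[of 1] by (simp add: id_def scaleC_one[abs_def])

lemma calc_cesaro: "calc (\<lambda>z. z) cesaro"
  by (rule calcI_linear[where B = 2 and c = 1]) (simp_all add: bounded_clinear_cesaro circ_norm_le)

text \<open>On the circle \<open>(1 - z) (A - cnj z) = (A - 1) (C - z)\<close> for the Cesaro operator \<open>C\<close> and its adjoint \<open>A\<close>, because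
  \<open>A C = A + C\<close> and \<open>z cnj z = z + cnj z\<close>; moreover \<open>\<bar>1 - z\<bar> = 1\<close>.\<close>

lemma calc_adj: "calc cnj cesaro_adj"
proof -
  obtain B where B: "\<And>f. norm (cesaro_adj f) \<le> B * norm f"
    using bounded_clinear_ex_bound[OF bounded_clinear_adj] by blast
  show ?thesis
  proof (rule calcI_linear[where B = 2 and c = "B + 1"])
    show "bounded_clinear cesaro_adj" by (rule bounded_clinear_adj)
    show "cesaro_adj (cesaro f) = cesaro (cesaro_adj f)" for f by (rule adj_cesaro_commute)
    show "cmod (cnj z) \<le> 2" if "z \<in> circ" for z using circ_norm_le[OF that] by simp
    fix z e assume z: "z \<in> circ"
    define d where "d = cesaro e - scaleC z e"
    have "cesaro_adj d = cesaro_adj e + cesaro e - scaleC z (cesaro_adj e)"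
      by (simp add: d_def bounded_clinear_diff[OF bounded_clinear_adj] bounded_clinear_scaleC[OF bounded_clinear_adj] adj_cesaro)
    then have "scaleC (1 - z) (cesaro_adj e) = cesaro_adj d - d - scaleC z e"
      by (simp add: d_def scaleC_minus_left algebra_simps)
    moreover have "(1 - z) * cnj z = - z"
      using circ_cnj[OF z] by (simp add: algebra_simps)
    ultimately have "scaleC (1 - z) (cesaro_adj e - scaleC (cnj z) e) = cesaro_adj d - d"
      by (simp add: scaleC_minus_right)
    then have "cmod (1 - z) * norm (cesaro_adj e - scaleC (cnj z) e) = norm (cesaro_adj d - d)"
      by (metis norm_scaleC)
    moreover have "cmod (1 - z) = 1"
      using z by (simp add: circ_def norm_minus_commute)
    ultimately show "norm (cesaro_adj e - scaleC (cnj z) e) \<le> (B + 1) * norm (cesaro e - scaleC z e)"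
      using B[of d] norm_triangle_ineq4[of "cesaro_adj d" d] by (simp add: d_def[symmetric] algebra_simps)
  qed
qed

lemma calc_add:
  assumes S: "calc p S" and T: "calc q T"
  shows "calc (\<lambda>z. p z + q z) (\<lambda>f. S f + T f)"
proof -
  obtain B where B: "\<And>z. z \<in> circ \<Longrightarrow> cmod (p z) \<le> B"
    by (rule calc_bdd[OF S]) blast
  obtain B' where B': "\<And>z. z \<in> circ \<Longrightarrow> cmod (q z) \<le> B'"
    by (rule calc_bdd[OF T]) blast
  show ?thesis
  proof (rule calcI[where B = "B + B'"])
    show "bounded_clinear (\<lambda>f. S f + T f)"
      by (intro bounded_clinear_plus calc_bounded_clinear[OF S] calc_bounded_clinear[OF T])
    show "S (cesaro f) + T (cesaro f) = cesaro (S f + T f)" for f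
      by (simp add: calc_commute[OF S] calc_commute[OF T] bounded_clinear_add[OF bounded_clinear_cesaro])
    show "cmod (p z + q z) \<le> B + B'" if "z \<in> circ" for z
      using B[OF that] B'[OF that] by (intro norm_triangle_le) simp
    fix r :: real assume "r > 0"
    then have r: "r / 2 > 0" by simp
    obtain c where c: "\<And>z e. z \<in> circ \<Longrightarrow> norm (S e - scaleC (p z) e) \<le> r / 2 * norm e + c * norm (cesaro e - scaleC z e)"
      by (rule calc_approx[OF S r]) blast
    obtain c' where c': "\<And>z e. z \<in> circ \<Longrightarrow> norm (T e - scaleC (q z) e) \<le> r / 2 * norm e + c' * norm (cesaro e - scaleC z e)"
      by (rule calc_approx[OF T r]) blast
    have "norm (S e + T e - scaleC (p z + q z) e) \<le> r * norm e + (c + c') * norm (cesaro e - scaleC z e)"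
      if z: "z \<in> circ" for z e
    proof -
      have eq: "S e + T e - scaleC (p z + q z) e = (S e - scaleC (p z) e) + (T e - scaleC (q z) e)"
        by (simp add: scaleC_add_left)
      show ?thesis
        unfolding eq using c[OF z, of e] c'[OF z, of e] by (intro norm_triangle_le) (simp add: distrib_right)
    qed
    then show "\<exists>c. \<forall>z\<in>circ. \<forall>e. norm (S e + T e - scaleC (p z + q z) e) \<le> r * norm e + c * norm (cesaro e - scaleC z e)"
      by blast
  qed
qed

lemma calc_mult:
  assumes S: "calc p S" and T: "calc q T"
  shows "calc (\<lambda>z. p z * q z) (\<lambda>f. S (T f))"
proof -
  note bcS = calc_bounded_clinear[OF S]
  obtain B where B: "B \<ge> 0" "\<And>z. z \<in> circ \<Longrightarrow> cmod (p z) \<le> B"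
    by (rule calc_bdd[OF S]) blast
  obtain B' where B': "B' \<ge> 0" "\<And>z. z \<in> circ \<Longrightarrow> cmod (q z) \<le> B'"
    by (rule calc_bdd[OF T]) blast
  obtain M where M: "M \<ge> 0" "\<And>f. norm (S f) \<le> M * norm f"
    using bounded_clinear_ex_bound[OF bcS] by blast
  show ?thesis
  proof (rule calcI[where B = "B * B'"])
    show "bounded_clinear (\<lambda>f. S (T f))"
      by (rule bounded_clinear_compose[OF bcS calc_bounded_clinear[OF T]])
    show "S (T (cesaro f)) = cesaro (S (T f))" for f
      by (simp add: calc_commute[OF S] calc_commute[OF T])
    show "cmod (p z * q z) \<le> B * B'" if "z \<in> circ" for z
      using B(2)[OF that] B'(2)[OF that] B(1) by (simp add: norm_mult mult_mono)
    fix r :: real assume "r > 0"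
    obtain d where d: "d > 0" "d * (M + B') \<le> r"
      using ex_small_factor[OF \<open>r > 0\<close>, of "M + B'"] M(1) B'(1) by (auto intro: less_imp_le)
    obtain c where c: "\<And>z e. z \<in> circ \<Longrightarrow> norm (S e - scaleC (p z) e) \<le> d * norm e + c * norm (cesaro e - scaleC z e)"
      by (rule calc_approx[OF S d(1)]) blast
    obtain c' where c': "\<And>z e. z \<in> circ \<Longrightarrow> norm (T e - scaleC (q z) e) \<le> d * norm e + c' * norm (cesaro e - scaleC z e)"
      by (rule calc_approx[OF T d(1)]) blast
    have "norm (S (T e) - scaleC (p z * q z) e) \<le> r * norm e + (M * c' + B' * \<bar>c\<bar>) * norm (cesaro e - scaleC z e)"
      if z: "z \<in> circ" for z e
    proof -
      let ?d = "norm (cesaro e - scaleC z e)"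
      have "S (T e) - scaleC (p z * q z) e = S (T e - scaleC (q z) e) + scaleC (q z) (S e - scaleC (p z) e)"
        by (simp add: bounded_clinear_diff[OF bcS] bounded_clinear_scaleC[OF bcS] scaleC_minus_right mult.commute)
      then have "norm (S (T e) - scaleC (p z * q z) e)
          \<le> norm (S (T e - scaleC (q z) e)) + norm (scaleC (q z) (S e - scaleC (p z) e))"
        by (simp only: norm_triangle_ineq)
      also have "\<dots> \<le> M * (d * norm e + c' * ?d) + B' * (d * norm e + \<bar>c\<bar> * ?d)"
      proof (rule add_mono)
        show "norm (S (T e - scaleC (q z) e)) \<le> M * (d * norm e + c' * ?d)"
          using M(2)[of "T e - scaleC (q z) e"] mult_left_mono[OF c'[OF z, of e] M(1)] by linarith
        have "norm (S e - scaleC (p z) e) \<le> d * norm e + \<bar>c\<bar> * ?d"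
          using c[OF z, of e] mult_right_mono[OF abs_ge_self[of c], of ?d] by simp
        then show "norm (scaleC (q z) (S e - scaleC (p z) e)) \<le> B' * (d * norm e + \<bar>c\<bar> * ?d)"
          using B'(2)[OF z] B'(1) by (simp add: mult_mono)
      qed
      also have "\<dots> = d * (M + B') * norm e + (M * c' + B' * \<bar>c\<bar>) * ?d"
        by (simp add: algebra_simps)
      also have "\<dots> \<le> r * norm e + (M * c' + B' * \<bar>c\<bar>) * ?d"
        using mult_right_mono[OF d(2), of "norm e"] by simp
      finally show ?thesis .
    qed
    then show "\<exists>c. \<forall>z\<in>circ. \<forall>e. norm (S (T e) - scaleC (p z * q z) e) \<le> r * norm e + c * norm (cesaro e - scaleC z e)"
      by blast
  qed
qed

lemma calc_scale: "calc p S \<Longrightarrow> calc (\<lambda>z. c * p z) (\<lambda>f. scaleC c (S f))"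
  by (rule calc_mult[OF calc_const])

lemma calc_diff:
  assumes "calc p S" "calc q T"
  shows "calc (\<lambda>z. p z - q z) (\<lambda>f. S f - T f)"
  using calc_add[OF assms(1) calc_scale[OF assms(2), of "-1"]] by simp

lemma calc_limit:
  assumes S: "bounded_clinear S"
    and approx: "\<And>r. r > 0 \<Longrightarrow> \<exists>q Q. calc q Q \<and> (\<forall>z\<in>circ. cmod (p z - q z) \<le> r) \<and> (\<forall>f. norm (S f - Q f) \<le> r * norm f)"
  shows "calc p S"
proof -
  obtain q Q where q: "calc q Q" "\<And>z. z \<in> circ \<Longrightarrow> cmod (p z - q z) \<le> 1"
    using approx[of 1] by auto
  obtain B where B: "\<And>z. z \<in> circ \<Longrightarrow> cmod (q z) \<le> B"
    by (rule calc_bdd[OF q(1)]) blast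
  obtain M where M: "M \<ge> 0" "\<And>f. norm (cesaro f) \<le> M * norm f"
    using bounded_clinear_ex_bound[OF bounded_clinear_cesaro] by blast
  show ?thesis
  proof (rule calcI[OF S, where B = "1 + B"])
    show "cmod (p z) \<le> 1 + B" if "z \<in> circ" for z
      using norm_triangle_ineq[of "p z - q z" "q z"] q(2)[OF that] B[OF that] by simp
    show "S (cesaro f) = cesaro (S f)" for f
    proof -
      have "norm (S (cesaro f) - cesaro (S f)) \<le> 0 + d" if d: "d > 0" for d
      proof -
        obtain r where r: "r > 0" "r * (2 * M * norm f) < d"
          using ex_small_factor[OF d, of "2 * M * norm f"] M(1) by auto
        obtain q Q where q: "calc q Q" "\<And>f. norm (S f - Q f) \<le> r * norm f"
          using approx[OF r(1)] by blast
        have "S (cesaro f) - cesaro (S f) = (S (cesaro f) - Q (cesaro f)) - cesaro (S f - Q f)"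
          by (simp add: bounded_clinear_diff[OF bounded_clinear_cesaro] calc_commute[OF q(1)])
        then have "norm (S (cesaro f) - cesaro (S f)) \<le> norm (S (cesaro f) - Q (cesaro f)) + norm (cesaro (S f - Q f))"
          by (simp only: norm_triangle_ineq4)
        also have "\<dots> \<le> r * (M * norm f) + M * (r * norm f)"
          using q(2)[of "cesaro f"] q(2)[of f] M(2)[of f] M(2)[of "S f - Q f"] r(1) M(1)
          by (intro add_mono) (auto intro: order_trans mult_left_mono)
        finally show ?thesis using r(2) by (simp add: algebra_simps)
      qed
      then have "norm (S (cesaro f) - cesaro (S f)) \<le> 0" by (rule field_le_epsilon)
      then show ?thesis by simp
    qed
    fix r :: real assume "r > 0"
    then have r: "r / 3 > 0" by simp
    obtain q Q where q: "calc q Q" "\<And>z. z \<in> circ \<Longrightarrow> cmod (p z - q z) \<le> r / 3" "\<And>f. norm (S f - Q f) \<le> r / 3 * norm f"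
      using approx[OF r] by blast
    obtain c where c: "\<And>z e. z \<in> circ \<Longrightarrow> norm (Q e - scaleC (q z) e) \<le> r / 3 * norm e + c * norm (cesaro e - scaleC z e)"
      by (rule calc_approx[OF q(1) r]) blast
    have "norm (S e - scaleC (p z) e) \<le> r * norm e + c * norm (cesaro e - scaleC z e)" if z: "z \<in> circ" for z e
    proof -
      have eq: "S e - scaleC (p z) e = (S e - Q e) + (Q e - scaleC (q z) e) - scaleC (p z - q z) e"
        by (simp add: scaleC_minus_left)
      have "norm (S e - scaleC (p z) e) \<le> norm (S e - Q e) + norm (Q e - scaleC (q z) e) + norm (scaleC (p z - q z) e)"
        unfolding eq by (rule order_trans[OF norm_triangle_ineq4 add_right_mono[OF norm_triangle_ineq]])
      moreover have "norm (scaleC (p z - q z) e) \<le> r / 3 * norm e"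
        unfolding norm_scaleC by (rule mult_right_mono[OF q(2)[OF z] norm_ge_zero])
      ultimately show ?thesis
        using q(3)[of e] c[OF z, of e] by simp
    qed
    then show "\<exists>c. \<forall>z\<in>circ. \<forall>e. norm (S e - scaleC (p z) e) \<le> r * norm e + c * norm (cesaro e - scaleC z e)"
      by blast
  qed
qed

lemma circ_one_plus_ge_1:
  assumes "z \<in> circ" "a \<ge> 0"
  shows "1 \<le> cmod (1 + complex_of_real a * z)"
  using complex_Re_le_cmod[of "1 + complex_of_real a * z"] mult_nonneg_nonneg[OF assms(2) circ_Re_nonneg[OF assms(1)]]
  by simp

text \<open>With \<open>T = resolvent a\<close>, the resolvent identity gives \<open>(1 + a z) (T - z / (1 + a z)) = (1 - a T) (C - z)\<close>, where
  \<open>C\<close> is the Cesaro operator, and \<open>\<bar>1 + a z\<bar> \<ge> 1\<close> because the circle lies in the closed right half-plane.\<close>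

lemma calc_resolvent:
  assumes "a \<ge> 0"
  shows "calc (\<lambda>z. z / (1 + complex_of_real a * z)) (resolvent a)"
proof -
  note bc = bounded_clinear_resolvent[OF assms]
  obtain B where B: "B \<ge> 0" "\<And>f. norm (resolvent a f) \<le> B * norm f"
    using bounded_clinear_ex_bound[OF bc] by blast
  show ?thesis
  proof (rule calcI_linear[where B = 2 and c = "1 + a * B"])
    show "bounded_clinear (resolvent a)" by (rule bc)
    show "resolvent a (cesaro f) = cesaro (resolvent a f)" for f
      by (rule resolvent_cesaro_commute[OF assms])
    fix z assume z: "z \<in> circ"
    let ?w = "1 + complex_of_real a * z"
    have w: "1 \<le> cmod ?w" by (rule circ_one_plus_ge_1[OF z assms])
    then have w0: "?w \<noteq> 0" by auto
    have "cmod z / cmod ?w \<le> cmod z / 1"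
      using w by (intro divide_left_mono) auto
    then show "cmod (z / ?w) \<le> 2"
      using circ_norm_le[OF z] by (simp add: norm_divide)
    fix e
    let ?T = "resolvent a"
    define d where "d = cesaro e - scaleC z e"
    have T: "?T d = cesaro (?T e) - scaleC z (?T e)"
      by (simp add: d_def bounded_clinear_diff[OF bc] bounded_clinear_scaleC[OF bc] resolvent_cesaro_commute[OF assms])
    have "scaleC (complex_of_real a) (?T d) = cesaro e - ?T e - scaleC (complex_of_real a * z) (?T e)"
      unfolding T scaleC_minus_right resolvent_identity[OF assms] by simp
    then have "scaleC ?w (?T e) = cesaro e - scaleC (complex_of_real a) (?T d)"
      by (simp add: scaleC_add_left)
    then have "scaleC ?w (?T e - scaleC (z / ?w) e) = d - scaleC (complex_of_real a) (?T d)"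
      using w0 by (simp add: scaleC_minus_right d_def)
    then have "cmod ?w * norm (?T e - scaleC (z / ?w) e) = norm (d - scaleC (complex_of_real a) (?T d))"
      by (metis norm_scaleC)
    also have "\<dots> \<le> norm d + a * norm (?T d)"
      using norm_triangle_ineq4[of d "scaleC (complex_of_real a) (?T d)"] assms by simp
    also have "\<dots> \<le> norm d + a * (B * norm d)"
      using B(2)[of d] assms by (simp add: mult_left_mono)
    finally have "cmod ?w * norm (?T e - scaleC (z / ?w) e) \<le> (1 + a * B) * norm d"
      by (simp add: algebra_simps)
    moreover have "norm (?T e - scaleC (z / ?w) e) \<le> cmod ?w * norm (?T e - scaleC (z / ?w) e)"
      using mult_right_mono[OF w, of "norm (?T e - scaleC (z / ?w) e)"] by simp
    ultimately show "norm (?T e - scaleC (z / ?w) e) \<le> (1 + a * B) * norm (cesaro e - scaleC z e)"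
      by (simp add: d_def)
  qed
qed

section \<open>Averages over roots of unity\<close>

definition shifted_cesaro :: "l2 \<Rightarrow> l2" where
  "shifted_cesaro f = cesaro f - f"

lemma bounded_clinear_shifted_cesaro: "bounded_clinear shifted_cesaro"
  unfolding shifted_cesaro_def[abs_def] by (intro bounded_clinear_minus bounded_clinear_cesaro bounded_clinear_id)

lemma cinner_shifted_cesaro: "cinner (shifted_cesaro f) (shifted_cesaro g) = cinner f g"
proof -
  have "cinner (cesaro f) (cesaro g) = cinner f (cesaro_adj g) + cinner f (cesaro g)"
    by (simp add: cinner_cesaro_adj adj_cesaro cinner_add_right)
  moreover have "cinner (cesaro f) g = cinner f (cesaro_adj g)"
    by (rule cinner_cesaro_adj)
  ultimately show ?thesis
    by (simp add: shifted_cesaro_def cinner_minus_left cinner_minus_right)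
qed

lemma cinner_shifted_cesaro_pow: "cinner ((shifted_cesaro ^^ n) f) ((shifted_cesaro ^^ n) g) = cinner f g"
  by (induction n) (simp_all add: cinner_shifted_cesaro)

lemma norm_shifted_cesaro_pow: "norm ((shifted_cesaro ^^ n) f) = norm f"
proof -
  have "complex_of_real ((norm ((shifted_cesaro ^^ n) f))\<^sup>2) = complex_of_real ((norm f)\<^sup>2)"
    unfolding cinner_self[symmetric] by (rule cinner_shifted_cesaro_pow)
  then have "(norm ((shifted_cesaro ^^ n) f))\<^sup>2 = (norm f)\<^sup>2"
    by (simp only: of_real_eq_iff)
  then show ?thesis
    by (rule power2_eq_imp_eq) auto
qed

definition unit_root :: "nat \<Rightarrow> nat \<Rightarrow> complex" where
  "unit_root N l = cis (2 * pi * real l / real N)"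

lemma unit_root_norm [simp]: "cmod (unit_root N l) = 1"
  by (simp add: unit_root_def)

lemma unit_root_cnj: "unit_root N l * cnj (unit_root N l) = 1" "cnj (unit_root N l) * unit_root N l = 1"
  by (simp_all add: complex_norm_square[symmetric] mult.commute[of "cnj (unit_root N l)"])

lemma unit_root_circ: "1 + unit_root N l \<in> circ"
  by (simp add: circ_def)

lemma sum_unit_root_orthogonal:
  assumes "j < N" "k < N"
  shows "(\<Sum>l<N. cnj (unit_root N l) ^ j * unit_root N l ^ k) = (if j = k then of_nat N else 0)"
proof (cases "j = k")
  case True
  have "cnj (unit_root N l) ^ k * unit_root N l ^ k = 1" for l
    by (simp add: power_mult_distrib[symmetric] unit_root_cnj)
  with True show ?thesis by simp
next
  case False
  define x where "x = cis (2 * pi * (real k - real j) / real N)"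
  have N: "N > 0" using assms by simp
  have "cnj (unit_root N l) ^ j * unit_root N l ^ k = x ^ l" for l
    unfolding unit_root_def x_def cis_cnj Complex.DeMoivre cis_mult
    by (intro arg_cong[where f = cis]) (simp add: field_simps diff_divide_distrib)
  then have "(\<Sum>l<N. cnj (unit_root N l) ^ j * unit_root N l ^ k) = (\<Sum>l<N. x ^ l)"
    by simp
  also have "\<dots> = 0"
  proof -
    have "x ^ N = cis (2 * pi * real_of_int (int k - int j))"
      unfolding x_def Complex.DeMoivre using N by (intro arg_cong[where f = cis]) simp
    also have "\<dots> = 1"
      by (rule cis_multiple_2pi) (rule Ints_of_int)
    finally have "x ^ N = 1" .
    moreover have "x \<noteq> 1"
    proof
      assume "x = 1"
      then have "cos (2 * pi * (real k - real j) / real N) = 1"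
        by (simp add: x_def complex_eq_iff)
      then obtain m :: int where "2 * pi * (real k - real j) / real N = real_of_int m * 2 * pi"
        using cos_one_2pi_int by blast
      then have "(2 * pi) * real_of_int (int k - int j) = (2 * pi) * real_of_int (m * int N)"
        using N by (simp add: field_simps)
      then have "real_of_int (int k - int j) = real_of_int (m * int N)"
        by (subst (asm) mult_cancel_left) simp
      then have "int k - int j = m * int N"
        by (simp only: of_int_eq_iff)
      then have "int N dvd int k - int j" by simp
      moreover have "\<bar>int k - int j\<bar> < int N"
        using assms by linarith
      ultimately show False
        using False zdvd_not_zless[of "\<bar>int k - int j\<bar>" "int N"] by simp
    qed
    ultimately show ?thesis
      by (simp add: geometric_sum)
  qed
  finally show ?thesis using False by simp
qed

text \<open>A discrete substitute for a spectral projection: \<open>root_part N l f\<close> is the part of \<open>f\<close> on which the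
  unitary operator \<open>shifted_cesaro\<close> acts approximately as multiplication by \<open>unit_root N l\<close>.\<close>

definition root_part :: "nat \<Rightarrow> nat \<Rightarrow> l2 \<Rightarrow> l2" where
  "root_part N l f = scaleC (1 / of_nat N) (\<Sum>j<N. scaleC (cnj (unit_root N l) ^ j) ((shifted_cesaro ^^ j) f))"

lemma root_part_commute:
  assumes "bounded_clinear S" "\<And>f. S (cesaro f) = cesaro (S f)"
  shows "S (root_part N l f) = root_part N l (S f)"
proof -
  have "S (shifted_cesaro f) = shifted_cesaro (S f)" for f
    by (simp add: shifted_cesaro_def bounded_clinear_diff[OF assms(1)] assms(2))
  then have "S ((shifted_cesaro ^^ j) f) = (shifted_cesaro ^^ j) (S f)" for j f
    by (induction j) simp_all
  then show ?thesis
    by (simp add: root_part_def bounded_clinear_scaleC[OF assms(1)] bounded_clinear_sum[OF assms(1)])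
qed

text \<open>Expanding both sums, only the diagonal terms survive by orthogonality of the roots of unity, and there the
  powers of the unitary operator cancel.\<close>

lemma root_part_parseval:
  assumes "N > 0"
  shows "(\<Sum>l<N. cinner (root_part N l f) (root_part N l g)) = cinner f g"
proof -
  let ?c = "\<lambda>j k. cinner ((shifted_cesaro ^^ j) f) ((shifted_cesaro ^^ k) g)"
  have "cinner (root_part N l f) (root_part N l g)
      = (1 / of_nat N) ^ 2 * (\<Sum>k<N. \<Sum>j<N. cnj (unit_root N l) ^ j * unit_root N l ^ k * ?c j k)" for l
    by (simp add: root_part_def cinner_scaleC_left cinner_scaleC_right cinner_sum_left cinner_sum_right
        power2_eq_square sum_distrib_left mult_ac)
  then have "(\<Sum>l<N. cinner (root_part N l f) (root_part N l g))
      = (1 / of_nat N) ^ 2 * (\<Sum>l<N. \<Sum>k<N. \<Sum>j<N. cnj (unit_root N l) ^ j * unit_root N l ^ k * ?c j k)"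
    by (simp only: sum_distrib_left)
  also have "(\<Sum>l<N. \<Sum>k<N. \<Sum>j<N. cnj (unit_root N l) ^ j * unit_root N l ^ k * ?c j k)
      = (\<Sum>k<N. \<Sum>l<N. \<Sum>j<N. cnj (unit_root N l) ^ j * unit_root N l ^ k * ?c j k)"
    by (rule sum.swap)
  also have "\<dots> = (\<Sum>k<N. \<Sum>j<N. \<Sum>l<N. cnj (unit_root N l) ^ j * unit_root N l ^ k * ?c j k)"
    by (intro sum.cong refl sum.swap)
  also have "\<dots> = (\<Sum>k<N. \<Sum>j<N. (if j = k then of_nat N * cinner f g else 0))"
  proof (intro sum.cong refl)
    fix j k assume "j \<in> {..<N}" "k \<in> {..<N}"
    then have "(\<Sum>l<N. cnj (unit_root N l) ^ j * unit_root N l ^ k * ?c j k) = (if j = k then of_nat N else 0) * ?c j k"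
      unfolding sum_distrib_right[symmetric] by (subst sum_unit_root_orthogonal) auto
    then show "(\<Sum>l<N. cnj (unit_root N l) ^ j * unit_root N l ^ k * ?c j k) = (if j = k then of_nat N * cinner f g else 0)"
      by (auto simp: cinner_shifted_cesaro_pow)
  qed
  also have "\<dots> = of_nat N * (of_nat N * cinner f g)"
    by (simp add: sum.delta)
  finally show ?thesis
    using assms by (simp add: power2_eq_square)
qed

lemma root_part_mass:
  assumes "N > 0"
  shows "(\<Sum>l<N. (norm (root_part N l f))\<^sup>2) = (norm f)\<^sup>2"
proof -
  have "complex_of_real (\<Sum>l<N. (norm (root_part N l f))\<^sup>2) = complex_of_real ((norm f)\<^sup>2)"
    unfolding of_real_sum cinner_self[symmetric] by (rule root_part_parseval[OF assms])
  then show ?thesis by (simp only: of_real_eq_iff)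
qed

text \<open>Applying \<open>shifted_cesaro\<close> shifts the summation index, so that only the two boundary terms of the sum fail
  to cancel.\<close>

lemma root_part_approx:
  assumes "N > 0"
  shows "norm (cesaro (root_part N l f) - scaleC (1 + unit_root N l) (root_part N l f)) \<le> 2 * norm f / real N"
proof -
  let ?r = "unit_root N l" and ?U = "\<lambda>j. (shifted_cesaro ^^ j) f"
  define g where "g j = scaleC (cnj ?r ^ j) (?U j)" for j
  have step: "scaleC (cnj ?r ^ j) (shifted_cesaro (?U j)) = scaleC ?r (g (Suc j))" for j
    by (simp add: g_def mult.assoc[symmetric] unit_root_cnj)
  have "shifted_cesaro (root_part N l f) = scaleC (1 / of_nat N) (\<Sum>j<N. scaleC ?r (g (Suc j)))"
    by (simp add: root_part_def bounded_clinear_scaleC[OF bounded_clinear_shifted_cesaro] bounded_clinear_sum[OF bounded_clinear_shifted_cesaro] step)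
  also have "\<dots> = scaleC ?r (scaleC (1 / of_nat N) (\<Sum>j<N. g (Suc j)))"
    by (simp add: scaleC_sum_right mult.commute)
  also have "(\<Sum>j<N. g (Suc j)) = (\<Sum>j<N. g j) + (g N - g 0)"
    by (induction N) simp_all
  also have "scaleC (1 / of_nat N) ((\<Sum>j<N. g j) + (g N - g 0)) = root_part N l f + scaleC (1 / of_nat N) (g N - g 0)"
    by (simp add: scaleC_add_right root_part_def g_def)
  finally have "shifted_cesaro (root_part N l f) - scaleC ?r (root_part N l f) = scaleC ?r (scaleC (1 / of_nat N) (g N - g 0))"
    by (simp add: scaleC_add_right)
  then have "norm (shifted_cesaro (root_part N l f) - scaleC ?r (root_part N l f)) = norm (g N - g 0) / real N"
    by (simp add: norm_divide)
  also have "\<dots> \<le> 2 * norm f / real N"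
  proof (rule divide_right_mono)
    have "norm (g j) = norm f" for j
      by (simp add: g_def norm_power norm_shifted_cesaro_pow)
    then show "norm (g N - g 0) \<le> 2 * norm f"
      using norm_triangle_ineq4[of "g N" "g 0"] by simp
  qed simp
  finally show ?thesis
    by (simp add: shifted_cesaro_def scaleC_add_left diff_diff_eq add.commute)
qed

text \<open>The parts may have norms of order \<open>\<parallel>f\<parallel> / sqrt N\<close>, so their sum need not stay bounded; the inequality between
  arithmetic and geometric means shows that it grows at most like \<open>sqrt N\<close>.\<close>

lemma sum_norm_root_part:
  assumes "N > 0"
  shows "(\<Sum>l<N. norm (root_part N l f) / real N) \<le> ((norm f)\<^sup>2 + 1) / sqrt (real N)"
proof -
  have "norm (root_part N l f) / real N \<le> ((norm (root_part N l f))\<^sup>2 + 1 / real N) / sqrt (real N)" for l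
  proof -
    let ?v = "norm (root_part N l f)" and ?s = "sqrt (real N)"
    have s: "?s > 0" "real N = ?s * ?s" using assms by simp_all
    have "0 \<le> (?v - 1 / ?s)\<^sup>2" by simp
    also have "(?v - 1 / ?s)\<^sup>2 = ?v\<^sup>2 + 1 / real N - 2 * (?v / ?s)"
      using s by (simp add: power2_diff power_divide)
    finally have "2 * (?v / ?s) \<le> ?v\<^sup>2 + 1 / real N" by linarith
    moreover have "0 \<le> ?v / ?s" using s by simp
    ultimately have "?v / ?s \<le> ?v\<^sup>2 + 1 / real N" by linarith
    then have "?v / ?s / ?s \<le> (?v\<^sup>2 + 1 / real N) / ?s"
      using s(1) by (intro divide_right_mono) auto
    then show ?thesis
      by (simp add: divide_divide_eq_left)
  qed
  then have "(\<Sum>l<N. norm (root_part N l f) / real N) \<le> (\<Sum>l<N. ((norm (root_part N l f))\<^sup>2 + 1 / real N) / sqrt (real N))"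
    by (rule sum_mono)
  also have "\<dots> = ((norm f)\<^sup>2 + 1) / sqrt (real N)"
    using assms by (simp add: sum_divide_distrib[symmetric] sum.distrib root_part_mass)
  finally show ?thesis .
qed

text \<open>The substitute for the spectral theorem. By Parseval's identity \<open>cinner (S f) (T f)\<close> is the sum of the
  \<open>cinner (S v) (T v)\<close> over the parts \<open>v\<close> of \<open>f\<close>, and each part is an approximate eigenvector of \<open>S\<close> and \<open>T\<close>.
  The error of a part has a summand proportional to \<open>\<parallel>v\<parallel>\<^sup>2\<close>, with an arbitrarily small constant,
  and one proportional to \<open>\<parallel>v\<parallel> / N\<close>; the latter add up to a term of order \<open>1 / sqrt N\<close>.\<close>

lemma calc_trace_pair:
  assumes S: "calc p S" and T: "calc q T"
  shows "(\<lambda>N. \<Sum>l<N. p (1 + unit_root N l) * cnj (q (1 + unit_root N l)) * complex_of_real ((norm (root_part N l f))\<^sup>2))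
    \<longlonglongrightarrow> cinner (S f) (T f)"
proof (rule LIMSEQ_I)
  fix r :: real assume r: "r > 0"
  obtain B where B: "B \<ge> 0" "\<And>z. z \<in> circ \<Longrightarrow> cmod (p z) \<le> B"
    by (rule calc_bdd[OF S]) blast
  obtain M where M: "M \<ge> 0" "\<And>f. norm (T f) \<le> M * norm f"
    using bounded_clinear_ex_bound[OF calc_bounded_clinear[OF T]] by blast
  obtain d where d: "d > 0" "d * ((M + B) * (norm f)\<^sup>2) < r / 2"
    using ex_small_factor[of "r / 2" "(M + B) * (norm f)\<^sup>2"] r B(1) M(1) by auto
  obtain c where c: "c \<ge> 0" "\<And>z e. z \<in> circ \<Longrightarrow> norm (S e - scaleC (p z) e) \<le> d * norm e + c * norm (cesaro e - scaleC z e)"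
    by (rule calc_approx[OF S d(1)]) blast
  obtain c' where c': "c' \<ge> 0" "\<And>z e. z \<in> circ \<Longrightarrow> norm (T e - scaleC (q z) e) \<le> d * norm e + c' * norm (cesaro e - scaleC z e)"
    by (rule calc_approx[OF T d(1)]) blast
  define D where "D = (c * M + B * c') * (2 * norm f)"
  have D: "D \<ge> 0" using c(1) c'(1) M B by (simp add: D_def)
  let ?a = "\<lambda>N l. p (1 + unit_root N l) * cnj (q (1 + unit_root N l)) * complex_of_real ((norm (root_part N l f))\<^sup>2)"
  have bound: "cmod ((\<Sum>l<N. ?a N l) - cinner (S f) (T f)) \<le> d * ((M + B) * (norm f)\<^sup>2) + D * (((norm f)\<^sup>2 + 1) / sqrt (real N))"
    if N: "N > 0" for N
  proof -
    have part: "cmod (?a N l - cinner (S (root_part N l f)) (T (root_part N l f)))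
        \<le> d * ((M + B) * (norm (root_part N l f))\<^sup>2) + D * (norm (root_part N l f) / real N)" for l
    proof -
      let ?z = "1 + unit_root N l" and ?v = "root_part N l f"
      have e: "norm (cesaro ?v - scaleC ?z ?v) \<le> 2 * norm f / real N"
        by (rule root_part_approx[OF N])
      have eS: "norm (S ?v - scaleC (p ?z) ?v) \<le> d * norm ?v + c * (2 * norm f / real N)"
        using c(2)[OF unit_root_circ, of ?v N l] mult_left_mono[OF e c(1)] by linarith
      have eT: "norm (T ?v - scaleC (q ?z) ?v) \<le> d * norm ?v + c' * (2 * norm f / real N)"
        using c'(2)[OF unit_root_circ, of ?v N l] mult_left_mono[OF e c'(1)] by linarith
      have "?a N l = cinner (scaleC (p ?z) ?v) (scaleC (q ?z) ?v)"
        by (simp add: cinner_scaleC_left cinner_scaleC_right cinner_self)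
      then have "cinner (S ?v) (T ?v) - ?a N l
          = cinner (S ?v - scaleC (p ?z) ?v) (T ?v) + cinner (scaleC (p ?z) ?v) (T ?v - scaleC (q ?z) ?v)"
        by (simp add: cinner_minus_left cinner_minus_right)
      then have "cmod (cinner (S ?v) (T ?v) - ?a N l)
          \<le> cmod (cinner (S ?v - scaleC (p ?z) ?v) (T ?v)) + cmod (cinner (scaleC (p ?z) ?v) (T ?v - scaleC (q ?z) ?v))"
        by (simp only: norm_triangle_ineq)
      also have "\<dots> \<le> norm (S ?v - scaleC (p ?z) ?v) * norm (T ?v) + norm (scaleC (p ?z) ?v) * norm (T ?v - scaleC (q ?z) ?v)"
        by (intro add_mono cmod_cinner_le)
      also have "\<dots> \<le> (d * norm ?v + c * (2 * norm f / real N)) * (M * norm ?v)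
          + (B * norm ?v) * (d * norm ?v + c' * (2 * norm f / real N))"
        using eS eT M(2)[of ?v] B(2)[OF unit_root_circ, of N l] B(1) c(1) d(1)
        by (intro add_mono mult_mono) (auto intro: mult_right_mono)
      also have "\<dots> = d * ((M + B) * (norm ?v)\<^sup>2) + D * (norm ?v / real N)"
        by (simp add: D_def power2_eq_square algebra_simps add_divide_distrib)
      finally show ?thesis
        by (simp add: norm_minus_commute)
    qed
    have "cinner (S f) (T f) = (\<Sum>l<N. cinner (S (root_part N l f)) (T (root_part N l f)))"
      by (simp add: root_part_commute[OF calc_bounded_clinear[OF S] calc_commute[OF S]]
          root_part_commute[OF calc_bounded_clinear[OF T] calc_commute[OF T]] root_part_parseval[OF N])
    then have "(\<Sum>l<N. ?a N l) - cinner (S f) (T f) = (\<Sum>l<N. ?a N l - cinner (S (root_part N l f)) (T (root_part N l f)))"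
      by (simp only: sum_subtractf)
    then have "cmod ((\<Sum>l<N. ?a N l) - cinner (S f) (T f))
        \<le> (\<Sum>l<N. d * ((M + B) * (norm (root_part N l f))\<^sup>2) + D * (norm (root_part N l f) / real N))"
      by (simp only:) (rule sum_norm_le[OF part])
    also have "\<dots> = d * ((M + B) * (norm f)\<^sup>2) + D * (\<Sum>l<N. norm (root_part N l f) / real N)"
      by (simp only: sum.distrib sum_distrib_left[symmetric] root_part_mass[OF N])
    also have "\<dots> \<le> d * ((M + B) * (norm f)\<^sup>2) + D * (((norm f)\<^sup>2 + 1) / sqrt (real N))"
      by (intro add_left_mono mult_left_mono sum_norm_root_part N D)
    finally show ?thesis .
  qed
  have "(\<lambda>N. (D * ((norm f)\<^sup>2 + 1)) * inverse (sqrt (real N))) \<longlonglongrightarrow> (D * ((norm f)\<^sup>2 + 1)) * 0"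
    by (intro tendsto_mult tendsto_const tendsto_inverse_0_at_top
        filterlim_compose[OF sqrt_at_top filterlim_real_sequentially])
  then have "\<forall>\<^sub>F N in sequentially. (D * ((norm f)\<^sup>2 + 1)) * inverse (sqrt (real N)) < r / 2"
    using r by (intro order_tendstoD(2)) auto
  then obtain N0 where N0: "\<And>N. N \<ge> N0 \<Longrightarrow> D * (((norm f)\<^sup>2 + 1) / sqrt (real N)) < r / 2"
    unfolding eventually_sequentially divide_inverse mult.assoc by blast
  have "cmod ((\<Sum>l<N. ?a N l) - cinner (S f) (T f)) < r" if "N \<ge> max 1 N0" for N
  proof -
    have "N > 0" "N \<ge> N0" using that by simp_all
    then show ?thesis using bound[of N] N0[of N] d(2) by linarith
  qed
  then show "\<exists>N0. \<forall>N\<ge>N0. norm ((\<Sum>l<N. ?a N l) - cinner (S f) (T f)) < r"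
    by blast
qed

text \<open>For \<open>p = q\<close> the sums in \<open>calc_trace_pair\<close> are averages of \<open>\<bar>p\<bar>\<^sup>2\<close> with weights of total mass \<open>\<parallel>f\<parallel>\<^sup>2\<close>.\<close>

lemma calc_bound:
  assumes "calc p S" and bound: "\<And>z. z \<in> circ \<Longrightarrow> cmod (p z) \<le> M"
  shows "norm (S f) \<le> M * norm f"
proof -
  have "cmod (p 2) \<le> M" by (rule bound) (simp add: circ_def)
  then have M: "M \<ge> 0" using norm_ge_zero[of "p 2"] by linarith
  let ?A = "\<lambda>N. \<Sum>l<N. (cmod (p (1 + unit_root N l)))\<^sup>2 * (norm (root_part N l f))\<^sup>2"
  have "p z * cnj (p z) * complex_of_real x = complex_of_real ((cmod (p z))\<^sup>2 * x)" for z x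
    by (simp only: of_real_mult complex_norm_square)
  then have "(\<lambda>N. complex_of_real (?A N)) \<longlonglongrightarrow> complex_of_real ((norm (S f))\<^sup>2)"
    using calc_trace_pair[OF assms(1,1), of f] by (simp only: cinner_self of_real_sum)
  then have lim: "?A \<longlonglongrightarrow> (norm (S f))\<^sup>2"
    by (simp only: tendsto_of_real_iff)
  have "?A N \<le> (M * norm f)\<^sup>2" if "N > 0" for N
  proof -
    have "?A N \<le> (\<Sum>l<N. M\<^sup>2 * (norm (root_part N l f))\<^sup>2)"
      using bound[OF unit_root_circ] by (intro sum_mono mult_right_mono power_mono) auto
    also have "\<dots> = (M * norm f)\<^sup>2"
      by (simp only: sum_distrib_left[symmetric] root_part_mass[OF that] power_mult_distrib)
    finally show ?thesis .
  qed
  then have "(norm (S f))\<^sup>2 \<le> (M * norm f)\<^sup>2"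
    by (intro LIMSEQ_le_const2[OF lim]) (auto intro: exI[of _ 1])
  then show ?thesis
    by (rule power2_le_imp_le) (use M in simp)
qed

section \<open>The continuous functional calculus\<close>

lemma calc_unique:
  assumes "calc p S" "calc q T" "\<And>z. z \<in> circ \<Longrightarrow> p z = q z"
  shows "S = T"
proof
  fix f
  have "norm (S f - T f) \<le> 0 * norm f"
    by (rule calc_bound[OF calc_diff[OF assms(1,2)]]) (simp add: assms(3))
  then show "S f = T f" by simp
qed

text \<open>An approximation of the integral of \<open>p\<close> against the spectral measure of \<open>f\<close>.\<close>

definition spectral_mean :: "nat \<Rightarrow> l2 \<Rightarrow> (complex \<Rightarrow> complex) \<Rightarrow> complex" where
  "spectral_mean N f p = (\<Sum>l<N. p (1 + unit_root N l) * complex_of_real ((norm (root_part N l f))\<^sup>2))"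

lemma spectral_mean_bound:
  assumes "\<And>z. z \<in> circ \<Longrightarrow> cmod (p z) \<le> b"
  shows "cmod (spectral_mean N f p) \<le> b * (norm f)\<^sup>2"
proof -
  have "cmod (p 2) \<le> b" by (rule assms) (simp add: circ_def)
  then have b: "b \<ge> 0" using norm_ge_zero[of "p 2"] by linarith
  show ?thesis
  proof (cases "N = 0")
    case False
    have "cmod (spectral_mean N f p) \<le> (\<Sum>l<N. b * (norm (root_part N l f))\<^sup>2)"
      unfolding spectral_mean_def
    proof (rule sum_norm_le)
      fix l
      show "cmod (p (1 + unit_root N l) * complex_of_real ((norm (root_part N l f))\<^sup>2)) \<le> b * (norm (root_part N l f))\<^sup>2"
        using assms[OF unit_root_circ, of N l] by (simp add: norm_mult norm_power mult_right_mono)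
    qed
    also have "\<dots> = b * (norm f)\<^sup>2"
      using False by (simp add: sum_distrib_left[symmetric] root_part_mass)
    finally show ?thesis .
  qed (use b in \<open>simp add: spectral_mean_def\<close>)
qed

lemma calc_trace:
  assumes "calc p S"
  shows "(\<lambda>N. spectral_mean N f p) \<longlonglongrightarrow> cinner (S f) f"
  using calc_trace_pair[OF assms calc_const[of 1], of f] by (simp add: spectral_mean_def)

text \<open>The means of \<open>cnj p\<close> are the conjugates of those of \<open>p\<close>, so both sides agree on the diagonal, which suffices
  by polarisation.\<close>

lemma calc_adjoint:
  assumes "calc p S" "calc (\<lambda>z. cnj (p z)) T"
  shows "cinner (S f) g = cinner f (T g)"
proof -
  note S = calc_bounded_clinear[OF assms(1)] and T = calc_bounded_clinear[OF assms(2)]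
  have diag: "cinner (S f) f = cinner f (T f)" for f
  proof -
    have "spectral_mean N f (\<lambda>z. cnj (p z)) = cnj (spectral_mean N f p)" for N
      by (simp add: spectral_mean_def)
    then have "(\<lambda>N. cnj (spectral_mean N f p)) \<longlonglongrightarrow> cinner (T f) f"
      using calc_trace[OF assms(2), of f] by simp
    moreover have "(\<lambda>N. cnj (spectral_mean N f p)) \<longlonglongrightarrow> cnj (cinner (S f) f)"
      by (intro tendsto_cnj calc_trace[OF assms(1)])
    ultimately have "cinner (T f) f = cnj (cinner (S f) f)"
      by (rule LIMSEQ_unique)
    then show ?thesis
      by (subst (2) cinner_commute) simp
  qed
  have "cinner (S f) g - cinner f (T g) = 0"
    by (rule sesquilinear_eq_0[where s = "\<lambda>f g. cinner (S f) g - cinner f (T g)"])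
      (simp_all add: bounded_clinear_add[OF S] bounded_clinear_add[OF T] bounded_clinear_scaleC[OF S]
        bounded_clinear_scaleC[OF T] cinner_add_left cinner_add_right cinner_scaleC_left cinner_scaleC_right
        diag algebra_simps)
  then show ?thesis by simp
qed

subsection \<open>Existence\<close>

text \<open>Polynomials in \<open>z\<close> and \<open>cnj z\<close>, as functions. For them an operator can be written down.\<close>

inductive cpoly :: "(complex \<Rightarrow> complex) \<Rightarrow> bool" where
  const: "cpoly (\<lambda>_. c)"
| ident: "cpoly (\<lambda>z. z)"
| conj: "cpoly cnj"
| plus: "cpoly p \<Longrightarrow> cpoly q \<Longrightarrow> cpoly (\<lambda>z. p z + q z)"
| times: "cpoly p \<Longrightarrow> cpoly q \<Longrightarrow> cpoly (\<lambda>z. p z * q z)"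

lemma cpoly_continuous: "cpoly p \<Longrightarrow> continuous_on A p"
  by (induction rule: cpoly.induct) (auto intro!: continuous_intros)

lemma cpoly_imp_calc: "cpoly p \<Longrightarrow> \<exists>S. calc p S"
  by (induction rule: cpoly.induct)
    (blast intro: calc_const calc_cesaro calc_adj calc_add calc_mult)+

text \<open>The Stone--Weierstrass theorem for real functions, applied to the real and the imaginary part with the
  algebra of the real-valued polynomials; these contain the two coordinates.\<close>

lemma cpoly_dense:
  assumes p: "continuous_on circ p" and "e > 0"
  shows "\<exists>q. cpoly q \<and> (\<forall>z\<in>circ. cmod (p z - q z) \<le> e)"
proof -
  let ?R = "{g :: complex \<Rightarrow> real. cpoly (\<lambda>z. complex_of_real (g z))}"
  have "(\<lambda>z. complex_of_real (Re z)) = (\<lambda>z. (1/2) * (z + cnj z))"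
    by (simp add: fun_eq_iff complex_eq_iff)
  then have Re: "Re \<in> ?R"
    using cpoly.times[OF cpoly.const[of "1/2"] cpoly.plus[OF cpoly.ident cpoly.conj]] by simp
  have "(\<lambda>z. complex_of_real (Im z)) = (\<lambda>z. (- \<i> / 2) * (z + (- 1) * cnj z))"
    by (simp add: fun_eq_iff complex_eq_iff)
  then have Im: "Im \<in> ?R"
    using cpoly.times[OF cpoly.const[of "- \<i> / 2"] cpoly.plus[OF cpoly.ident cpoly.times[OF cpoly.const[of "-1"] cpoly.conj]]]
    by simp
  interpret function_ring_on ?R circ
  proof
    show "compact circ" by (rule compact_circ)
    fix f assume f: "f \<in> ?R"
    then have "continuous_on circ (\<lambda>z. Re (complex_of_real (f z)))"
      by (intro continuous_intros cpoly_continuous) simp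
    then show "continuous_on circ f" by simp
    fix g assume "g \<in> ?R"
    with f show "(\<lambda>x. f x + g x) \<in> ?R" "(\<lambda>x. f x * g x) \<in> ?R"
      by (auto intro: cpoly.plus cpoly.times)
  next
    show "(\<lambda>_. c) \<in> ?R" for c by (simp add: cpoly.const)
    fix x y :: complex assume "x \<noteq> y"
    then have "Re x \<noteq> Re y \<or> Im x \<noteq> Im y" by (simp add: complex_eq_iff)
    then show "\<exists>f\<in>?R. f x \<noteq> f y" using Re Im by blast
  qed
  have e: "e / 2 > 0" using \<open>e > 0\<close> by simp
  have "continuous_on circ (\<lambda>z. Re (p z))" "continuous_on circ (\<lambda>z. Im (p z))"
    by (intro continuous_intros p)+
  then obtain g h where g: "g \<in> ?R" "\<And>z. z \<in> circ \<Longrightarrow> \<bar>Re (p z) - g z\<bar> < e / 2"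
    and h: "h \<in> ?R" "\<And>z. z \<in> circ \<Longrightarrow> \<bar>Im (p z) - h z\<bar> < e / 2"
    using Stone_Weierstrass_basic[OF _ e] by metis
  let ?q = "\<lambda>z. complex_of_real (g z) + \<i> * complex_of_real (h z)"
  have "cpoly ?q"
    using g(1) h(1) by (intro cpoly.plus cpoly.times cpoly.const) auto
  moreover have "cmod (p z - ?q z) \<le> e" if "z \<in> circ" for z
    using cmod_le[of "p z - ?q z"] g(2)[OF that] h(2)[OF that] by simp
  ultimately show ?thesis by blast
qed

text \<open>By \<open>calc_bound\<close> the operators that belong to polynomials converging uniformly to \<open>p\<close> form a Cauchy sequence,
  uniformly on bounded sets of vectors.\<close>

lemma calc_exists:
  assumes p: "continuous_on circ p"
  shows "\<exists>S. calc p S"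
proof -
  let ?d = "\<lambda>n. 1 / real (Suc n)"
  have "\<exists>q Q. calc q Q \<and> (\<forall>z\<in>circ. cmod (p z - q z) \<le> ?d n)" for n
  proof -
    obtain q where "cpoly q" "\<forall>z\<in>circ. cmod (p z - q z) \<le> ?d n"
      using cpoly_dense[OF p, of "?d n"] by auto
    then show ?thesis using cpoly_imp_calc[of q] by blast
  qed
  then obtain q Q where q: "\<And>n. calc (q n) (Q n)" "\<And>n z. z \<in> circ \<Longrightarrow> cmod (p z - q n z) \<le> ?d n"
    by metis
  have diff: "norm (Q n f - Q m f) \<le> (?d n + ?d m) * norm f" for n m f
  proof (rule calc_bound[OF calc_diff[OF q(1)[of n] q(1)[of m]]])
    fix z assume z: "z \<in> circ"
    show "cmod (q n z - q m z) \<le> ?d n + ?d m"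
      using norm_triangle_ineq4[of "p z - q m z" "p z - q n z"] q(2)[OF z, of n] q(2)[OF z, of m]
      by (simp add: algebra_simps)
  qed
  have d0: "?d \<longlonglongrightarrow> 0"
    using LIMSEQ_inverse_real_of_nat by (simp add: inverse_eq_divide)
  have conv: "convergent (\<lambda>n. Q n f)" for f
  proof (rule Cauchy_convergent, rule CauchyI)
    fix e :: real assume e: "e > 0"
    have "(\<lambda>n. 2 * ?d n * norm f) \<longlonglongrightarrow> 2 * 0 * norm f"
      by (intro tendsto_intros d0)
    then have "\<forall>\<^sub>F n in sequentially. 2 * ?d n * norm f < e"
      using e by (intro order_tendstoD) auto
    then obtain N where N: "2 * ?d N * norm f < e"
      by (auto simp: eventually_sequentially)
    have "norm (Q m f - Q n f) < e" if "m \<ge> N" "n \<ge> N" for m n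
    proof -
      have "?d m + ?d n \<le> 2 * ?d N"
        using that frac_le[of 1 1 "real (Suc N)" "real (Suc m)"] frac_le[of 1 1 "real (Suc N)" "real (Suc n)"] by simp
      then have "(?d m + ?d n) * norm f \<le> 2 * ?d N * norm f"
        by (intro mult_right_mono) auto
      then show ?thesis using diff[of m f n] N by linarith
    qed
    then show "\<exists>M. \<forall>m\<ge>M. \<forall>n\<ge>M. norm (Q m f - Q n f) < e" by blast
  qed
  define S where "S f = lim (\<lambda>n. Q n f)" for f
  have S: "(\<lambda>n. Q n f) \<longlonglongrightarrow> S f" for f
    using conv[of f] by (simp add: S_def convergent_LIMSEQ_iff)
  have near: "norm (S f - Q n f) \<le> ?d n * norm f" for n f
  proof (rule LIMSEQ_le[OF tendsto_norm[OF tendsto_diff[OF S tendsto_const]]])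
    have "(\<lambda>m. (?d m + ?d n) * norm f) \<longlonglongrightarrow> (0 + ?d n) * norm f"
      by (intro tendsto_intros d0)
    then show "(\<lambda>m. (?d m + ?d n) * norm f) \<longlonglongrightarrow> ?d n * norm f" by simp
    show "\<exists>N. \<forall>m\<ge>N. norm (Q m f - Q n f) \<le> (?d m + ?d n) * norm f"
      using diff by blast
  qed
  have bc: "bounded_clinear (Q n)" for n
    using q(1)[of n] by (simp add: calc_def)
  obtain B where B: "\<And>f. norm (Q 0 f) \<le> B * norm f"
    using bounded_clinear_ex_bound[OF bc[of 0]] by blast
  have "bounded_clinear S"
  proof (rule bounded_clinearI)
    fix f g c
    show "S (f + g) = S f + S g"
      using S[of "f + g"] tendsto_add[OF S[of f] S[of g]]
      by (simp add: bounded_clinear_add[OF bc] LIMSEQ_unique)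
    show "S (scaleC c f) = scaleC c (S f)"
      using S[of "scaleC c f"] bounded_clinear_tendsto[OF bounded_clinear_scaleC_const S[of f], of c]
      by (simp add: bounded_clinear_scaleC[OF bc] LIMSEQ_unique)
    show "norm (S f) \<le> (B + 1) * norm f"
      using norm_triangle_ineq[of "S f - Q 0 f" "Q 0 f"] near[of f 0] B[of f] by (simp add: algebra_simps)
  qed
  moreover have "\<exists>q Q. calc q Q \<and> (\<forall>z\<in>circ. cmod (p z - q z) \<le> e) \<and> (\<forall>f. norm (S f - Q f) \<le> e * norm f)"
    if e: "e > 0" for e
  proof -
    obtain n where n: "?d n < e"
      using e by (metis reals_Archimedean inverse_eq_divide)
    have "norm (S f - Q n f) \<le> e * norm f" for f
      using near[of f n] mult_right_mono[of "?d n" e "norm f"] n by simp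
    moreover have "cmod (p z - q n z) \<le> e" if "z \<in> circ" for z
      using q(2)[OF that, of n] n by linarith
    ultimately show ?thesis using q(1) by blast
  qed
  ultimately have "calc p S" by (rule calc_limit)
  then show ?thesis by blast
qed

definition calc_op :: "(complex \<Rightarrow> complex) \<Rightarrow> l2 \<Rightarrow> l2" where
  "calc_op p = (THE S. calc p S)"

lemma calc_op_eqI: "calc p S \<Longrightarrow> calc_op p = S"
  unfolding calc_op_def by (rule the_equality) (auto intro: calc_unique)

lemma calc_calc_op:
  assumes "continuous_on circ p"
  shows "calc p (calc_op p)"
  using calc_exists[OF assms] calc_op_eqI by metis

subsection \<open>The spectrum of the Cesaro operator\<close>

text \<open>The values of the symbol of the Cesaro operator, see \<open>symbol_cesaro\<close>. They exhaust the circle except for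
  the point \<open>0\<close>, which is approached for \<open>s\<close> tending to infinity.\<close>

definition circ_point :: "real \<Rightarrow> complex" where
  "circ_point s = 1 / (1/2 - \<i> * complex_of_real s)"

lemma circ_point_in_circ: "circ_point s \<in> circ"
proof -
  let ?w = "1/2 - \<i> * complex_of_real s"
  have w: "?w \<noteq> 0" by (simp add: complex_eq_iff)
  have "circ_point s - 1 = cnj ?w / ?w"
    using w by (simp add: circ_point_def field_simps)
  then have "cmod (circ_point s - 1) = cmod (cnj ?w) / cmod ?w"
    by (simp only: norm_divide)
  also have "\<dots> = 1"
    using w by (simp only: complex_mod_cnj) simp
  finally show ?thesis by (simp add: circ_def)
qed

lemma circ_point_surj:
  assumes "z \<in> circ" "z \<noteq> 0"
  shows "\<exists>s. z = circ_point s"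
proof
  have "Re z \<noteq> 0"
    using circ_norm[OF assms(1)] assms(2) by auto
  then have "Re (1 / z) = 1/2"
    using circ_norm[OF assms(1)] by (simp add: Re_divide cmod_power2[symmetric])
  then have "1 / z = 1/2 - \<i> * complex_of_real (- Im (1 / z))"
    by (simp add: complex_eq_iff)
  then show "z = circ_point (- Im (1 / z))"
    unfolding circ_point_def by (metis divide_divide_eq_right div_by_1 mult.left_neutral)
qed

text \<open>Since \<open>A C = A + C\<close> for the adjoint \<open>A\<close> of the Cesaro operator \<open>C\<close>, the square of the norm is a polynomial in
  \<open>c = cinner (C e) e\<close> and \<open>cnj c\<close> for a unit vector \<open>e\<close>. For the waves \<open>c\<close> tends to \<open>z = circ_point s\<close>, and the
  polynomial tends to \<open>z + cnj z - z cnj z = 0\<close>.\<close>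

lemma wave_eigen: "(\<lambda>n. norm (cesaro (wave s n) - scaleC (circ_point s) (wave s n))) \<longlonglongrightarrow> 0"
proof -
  let ?e = "wave s" and ?z = "circ_point s"
  define c where "c n = cinner (cesaro (?e n)) (?e n)" for n
  have c: "c \<longlonglongrightarrow> ?z"
    using wave_symbol[OF admissible_res_kernel[of 0], of s]
    by (simp add: c_def[abs_def] cesaro_eq_hausdorff symbol_cesaro circ_point_def)
  have eq: "complex_of_real ((norm (cesaro (?e n) - scaleC ?z (?e n)))\<^sup>2)
      = c n + cnj (c n) - cnj ?z * c n - ?z * cnj (c n) + ?z * cnj ?z" for n
  proof -
    have "cinner (?e n) (cesaro (?e n)) = cnj (c n)"
      unfolding c_def by (rule cinner_commute)
    moreover have "cinner (cesaro (?e n)) (cesaro (?e n)) = c n + cnj (c n)"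
    proof -
      have "cinner (cesaro (?e n)) (cesaro (?e n)) = cinner (?e n) (cesaro_adj (?e n)) + cinner (?e n) (cesaro (?e n))"
        by (simp add: cinner_cesaro_adj adj_cesaro cinner_add_right)
      then show ?thesis
        using \<open>cinner (?e n) (cesaro (?e n)) = cnj (c n)\<close> by (simp add: c_def cinner_cesaro_adj)
    qed
    moreover have "cinner (?e n) (?e n) = 1"
      by (simp add: cinner_self)
    ultimately show ?thesis
      unfolding cinner_self[symmetric] by (simp add: cinner_minus_left cinner_minus_right cinner_scaleC_left
          cinner_scaleC_right c_def[symmetric] algebra_simps)
  qed
  have "(\<lambda>n. c n + cnj (c n) - cnj ?z * c n - ?z * cnj (c n) + ?z * cnj ?z)
      \<longlonglongrightarrow> ?z + cnj ?z - cnj ?z * ?z - ?z * cnj ?z + ?z * cnj ?z"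
    by (intro tendsto_intros c tendsto_cnj)
  moreover have "?z + cnj ?z - cnj ?z * ?z - ?z * cnj ?z + ?z * cnj ?z = complex_of_real 0"
    using circ_cnj[OF circ_point_in_circ[of s]] by (simp add: mult.commute)
  ultimately have "(\<lambda>n. complex_of_real ((norm (cesaro (?e n) - scaleC ?z (?e n)))\<^sup>2)) \<longlonglongrightarrow> complex_of_real 0"
    by (simp only: eq)
  then have "(\<lambda>n. (norm (cesaro (?e n) - scaleC ?z (?e n)))\<^sup>2) \<longlonglongrightarrow> 0"
    by (simp only: tendsto_of_real_iff)
  from tendsto_real_sqrt[OF this] show ?thesis by simp
qed

lemma circ_approx_eigenvector:
  assumes "z \<in> circ" "d > 0"
  shows "\<exists>e. norm e = 1 \<and> norm (cesaro e - scaleC z e) < d"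
proof -
  obtain s where s: "cmod (circ_point s - z) < d / 2"
  proof (cases "z = 0")
    case True
    \<comment> \<open>the point \<open>0\<close> is not a value of \<open>circ_point\<close>, but \<open>circ_point s\<close> has modulus at most \<open>1 / s\<close> for \<open>s > 0\<close>\<close>
    have "cmod (circ_point (4 / d)) \<le> 1 / (4 / d)"
    proof -
      have "4 / d \<le> cmod (1/2 - \<i> * complex_of_real (4 / d))"
        using abs_Im_le_cmod[of "1/2 - \<i> * complex_of_real (4 / d)"] assms(2) by simp
      then show ?thesis
        unfolding circ_point_def norm_divide using assms(2) by (intro frac_le) auto
    qed
    with True assms(2) show ?thesis by (intro that[of "4 / d"]) auto
  next
    case False
    then obtain s where "z = circ_point s" using circ_point_surj assms(1) by blast
    then show ?thesis using assms(2) by (intro that[of s]) auto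
  qed
  have "\<forall>\<^sub>F n in sequentially. norm (cesaro (wave s n) - scaleC (circ_point s) (wave s n)) < d / 2"
    using wave_eigen assms(2) by (intro order_tendstoD) auto
  then obtain n where n: "norm (cesaro (wave s n) - scaleC (circ_point s) (wave s n)) < d / 2"
    by (auto simp: eventually_sequentially)
  have eq: "cesaro (wave s n) - scaleC z (wave s n) = (cesaro (wave s n) - scaleC (circ_point s) (wave s n))
      + scaleC (circ_point s - z) (wave s n)"
    by (simp add: scaleC_minus_left)
  have "norm (cesaro (wave s n) - scaleC z (wave s n)) < d"
    unfolding eq using norm_triangle_ineq[of "cesaro (wave s n) - scaleC (circ_point s) (wave s n)" "scaleC (circ_point s - z) (wave s n)"] n s
    by simp
  then show ?thesis using norm_wave by blast
qed

text \<open>Approximate eigenvectors exclude a bounded inverse for \<open>z\<close> on the circle; for other \<open>z\<close> the function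
  \<open>1 / (z - w)\<close> is continuous on the circle and belongs to the inverse.\<close>

lemma spectrum_cesaro: "spectrum cesaro = circ"
proof
  show "circ \<subseteq> spectrum cesaro"
  proof
    fix z assume z: "z \<in> circ"
    have False if S: "bounded_clinear S" "\<And>f. S (scaleC z f - cesaro f) = f" for S
    proof -
      obtain B where B: "B \<ge> 0" "\<And>f. norm (S f) \<le> B * norm f"
        using bounded_clinear_ex_bound[OF S(1)] by blast
      obtain e where e: "norm e = 1" "norm (cesaro e - scaleC z e) < 1 / (B + 1)"
        using circ_approx_eigenvector[OF z, of "1 / (B + 1)"] B(1) by auto
      have "1 \<le> B * norm (cesaro e - scaleC z e)"
        using B(2)[of "scaleC z e - cesaro e"] e(1) by (simp add: S(2) norm_minus_commute)
      also have "\<dots> \<le> B * (1 / (B + 1))"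
        using e(2) B(1) by (intro mult_left_mono) auto
      also have "\<dots> < 1" using B(1) by simp
      finally show False by simp
    qed
    then show "z \<in> spectrum cesaro"
      unfolding spectrum_def by blast
  qed
  show "spectrum cesaro \<subseteq> circ"
  proof
    fix z assume "z \<in> spectrum cesaro"
    show "z \<in> circ"
    proof (rule ccontr)
      assume z: "z \<notin> circ"
      let ?p = "\<lambda>w. 1 / (z - w)"
      have "continuous_on circ ?p"
        using z by (intro continuous_intros) auto
      note S = calc_calc_op[OF this]
      have zc: "calc (\<lambda>w. z - w) (\<lambda>f. scaleC z f - cesaro f)"
        by (rule calc_diff[OF calc_const calc_cesaro])
      have "(\<lambda>f. calc_op ?p (scaleC z f - cesaro f)) = id"
        by (rule calc_unique[OF calc_mult[OF S zc] calc_one]) (use z in auto)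
      moreover have "(\<lambda>f. scaleC z (calc_op ?p f) - cesaro (calc_op ?p f)) = id"
        by (rule calc_unique[OF calc_mult[OF zc S] calc_one]) (use z in auto)
      ultimately have "z \<notin> spectrum cesaro"
        unfolding spectrum_def using calc_bounded_clinear[OF S] by (auto simp: fun_eq_iff)
      with \<open>z \<in> spectrum cesaro\<close> show False by simp
    qed
  qed
qed

lemma functional_calculus_calc_op: "functional_calculus cesaro calc_op"
  unfolding functional_calculus_def spectrum_cesaro
proof (intro conjI allI impI)
  fix p q :: "complex \<Rightarrow> complex" and c f g
  show "calc_op p = calc_op q" if "continuous_on circ p \<and> (\<forall>z\<in>circ. p z = q z)"
  proof -
    have "calc q (calc_op p)"
      using that calc_calc_op[of p] calc_cong[of p q "calc_op p"] by blast
    then show ?thesis by (rule calc_op_eqI[symmetric])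
  qed
  show "bounded_clinear (calc_op p)" if "continuous_on circ p"
    by (rule calc_bounded_clinear[OF calc_calc_op[OF that]])
  show "calc_op (\<lambda>z. p z + q z) f = calc_op p f + calc_op q f" "calc_op (\<lambda>z. p z * q z) f = calc_op p (calc_op q f)"
    if "continuous_on circ p \<and> continuous_on circ q"
    using that by (simp_all add: calc_op_eqI[OF calc_add[OF calc_calc_op calc_calc_op]] calc_op_eqI[OF calc_mult[OF calc_calc_op calc_calc_op]])
  show "calc_op (\<lambda>z. c * p z) f = scaleC c (calc_op p f)" if "continuous_on circ p"
    by (simp add: calc_op_eqI[OF calc_scale[OF calc_calc_op[OF that]]])
  show "cinner (calc_op p f) g = cinner f (calc_op (\<lambda>z. cnj (p z)) g)" if "continuous_on circ p"
    by (rule calc_adjoint[OF calc_calc_op[OF that] calc_calc_op]) (intro continuous_intros that)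
qed (simp_all add: calc_op_eqI[OF calc_one] calc_op_eqI[OF calc_cesaro])

text \<open>A functional calculus is automatically contractive: if \<open>\<bar>p\<bar> \<le> M\<close> then \<open>M\<^sup>2 - \<bar>p\<bar>\<^sup>2\<close> is the square of a
  continuous function \<open>q\<close>, and \<open>\<parallel>\<Phi> p f\<parallel>\<^sup>2 + \<parallel>\<Phi> q f\<parallel>\<^sup>2 = M\<^sup>2 \<parallel>f\<parallel>\<^sup>2\<close>.
  So \<open>\<Phi>\<close> is determined by its values on polynomials in \<open>z\<close> and \<open>cnj z\<close>, and those are prescribed.\<close>

lemma functional_calculus_unique:
  assumes \<Phi>: "functional_calculus cesaro \<Phi>" and p: "continuous_on circ p"
  shows "\<Phi> p = calc_op p"
proof -
  note F = \<Phi>[unfolded functional_calculus_def spectrum_cesaro]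
  have bc: "bounded_clinear (\<Phi> p)" if "continuous_on circ p" for p
    using F that by blast
  have add: "\<Phi> (\<lambda>z. p z + q z) f = \<Phi> p f + \<Phi> q f" and mult: "\<Phi> (\<lambda>z. p z * q z) f = \<Phi> p (\<Phi> q f)"
    if "continuous_on circ p" "continuous_on circ q" for p q f
    using F that by blast+
  have cmult: "\<Phi> (\<lambda>z. c * p z) f = scaleC c (\<Phi> p f)" if "continuous_on circ p" for c p f
    using F that by blast
  have adjoint: "cinner (\<Phi> p f) g = cinner f (\<Phi> (\<lambda>z. cnj (p z)) g)" if "continuous_on circ p" for p f g
    using F that by blast
  have one: "\<Phi> (\<lambda>_. 1) = id" and ident: "\<Phi> (\<lambda>z. z) = cesaro"
    using F by blast+
  have const: "\<Phi> (\<lambda>_. c) f = scaleC c f" for c f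
    using cmult[OF continuous_on_const[of _ 1], of c f] by (simp add: one)
  have square: "complex_of_real ((norm (\<Phi> p f))\<^sup>2) = cinner f (\<Phi> (\<lambda>z. cnj (p z) * p z) f)"
    if "continuous_on circ p" for p f
    by (simp only: cinner_self[symmetric] adjoint[OF that] mult[OF continuous_on_cnj[OF that] that])
  have bound: "norm (\<Phi> p f) \<le> M * norm f"
    if p: "continuous_on circ p" and M: "\<And>z. z \<in> circ \<Longrightarrow> cmod (p z) \<le> M" for p M f
  proof -
    have "cmod (p 2) \<le> M" by (rule M) (simp add: circ_def)
    then have "M \<ge> 0" using norm_ge_zero[of "p 2"] by linarith
    define q where "q z = complex_of_real (sqrt (M\<^sup>2 - (cmod (p z))\<^sup>2))" for z
    have q: "continuous_on circ q"
      unfolding q_def by (intro continuous_intros p)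
    have "cnj (p z) * p z + cnj (q z) * q z = complex_of_real (M\<^sup>2)" if "z \<in> circ" for z
    proof -
      have "(cmod (p z))\<^sup>2 \<le> M\<^sup>2" using M[OF that] by (intro power_mono) auto
      then have "cnj (q z) * q z = complex_of_real (M\<^sup>2 - (cmod (p z))\<^sup>2)"
        by (simp add: q_def del: of_real_diff of_real_power flip: of_real_mult)
      moreover have "cnj (p z) * p z = complex_of_real ((cmod (p z))\<^sup>2)"
        by (simp only: complex_norm_square mult.commute)
      ultimately show ?thesis by simp
    qed
    then have "\<Phi> (\<lambda>z. cnj (p z) * p z + cnj (q z) * q z) = \<Phi> (\<lambda>_. complex_of_real (M\<^sup>2))"
      using F p q by (intro F[THEN conjunct2, THEN conjunct1, rule_format]) (auto intro!: continuous_intros)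
    then have "\<Phi> (\<lambda>z. cnj (p z) * p z) f + \<Phi> (\<lambda>z. cnj (q z) * q z) f = scaleC (complex_of_real (M\<^sup>2)) f"
      using p q by (subst add[symmetric]) (auto intro!: continuous_intros simp: const)
    then have "complex_of_real ((norm (\<Phi> p f))\<^sup>2) + complex_of_real ((norm (\<Phi> q f))\<^sup>2)
        = complex_of_real (M\<^sup>2 * (norm f)\<^sup>2)"
      unfolding square[OF p] square[OF q] cinner_add_right[symmetric]
      by (simp add: cinner_scaleC_right cinner_self)
    then have "(norm (\<Phi> p f))\<^sup>2 + (norm (\<Phi> q f))\<^sup>2 = M\<^sup>2 * (norm f)\<^sup>2"
      by (simp only: of_real_add[symmetric] of_real_eq_iff)
    then have "(norm (\<Phi> p f))\<^sup>2 \<le> (M * norm f)\<^sup>2"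
      unfolding power_mult_distrib using zero_le_power2[of "norm (\<Phi> q f)"] by linarith
    then show ?thesis by (rule power2_le_imp_le) (use \<open>M \<ge> 0\<close> in simp)
  qed
  have conj: "\<Phi> cnj = cesaro_adj"
  proof (intro ext cinner_eqI)
    fix f g
    have "cinner f (\<Phi> cnj g) = cinner f (cesaro_adj g)"
      using adjoint[OF continuous_on_id, of f g] by (simp add: ident cinner_cesaro_adj)
    then show "cinner (\<Phi> cnj g) f = cinner (cesaro_adj g) f"
      by (metis cinner_commute)
  qed
  have poly: "calc q (\<Phi> q)" if "cpoly q" for q
    using that
  proof induction
    case (const c)
    have "\<Phi> (\<lambda>_. c) = scaleC c" by (rule ext) (rule \<open>\<And>c f. \<Phi> (\<lambda>_. c) f = scaleC c f\<close>)
    then show ?case by (simp add: calc_const)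
  next
    case ident
    then show ?case using \<open>\<Phi> (\<lambda>z. z) = cesaro\<close> by (simp add: calc_cesaro)
  next
    case conj
    then show ?case using \<open>\<Phi> cnj = cesaro_adj\<close> by (simp add: calc_adj)
  next
    case (plus p q)
    then have "\<Phi> (\<lambda>z. p z + q z) = (\<lambda>f. \<Phi> p f + \<Phi> q f)"
      by (intro ext add cpoly_continuous)
    with plus show ?case by (simp add: calc_add)
  next
    case (times p q)
    then have "\<Phi> (\<lambda>z. p z * q z) = (\<lambda>f. \<Phi> p (\<Phi> q f))"
      by (intro ext mult cpoly_continuous)
    with times show ?case by (simp add: calc_mult)
  qed
  have "calc p (\<Phi> p)"
  proof (rule calc_limit[OF bc[OF p]])
    fix e :: real assume "e > 0"
    then obtain q where q: "cpoly q" "\<And>z. z \<in> circ \<Longrightarrow> cmod (p z - q z) \<le> e"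
      using cpoly_dense[OF p] by blast
    have cq: "continuous_on circ q" "continuous_on circ (\<lambda>z. - 1 * q z)"
      using cpoly_continuous[OF q(1)] by (auto intro!: continuous_intros)
    have "\<Phi> (\<lambda>z. p z + - 1 * q z) f = \<Phi> p f - \<Phi> q f" for f
      using add[OF p cq(2)] cmult[OF cq(1), of "-1" f] by simp
    moreover have "norm (\<Phi> (\<lambda>z. p z + - 1 * q z) f) \<le> e * norm f" for f
      by (rule bound) (use q p cq in \<open>auto intro!: continuous_intros\<close>)
    ultimately have "norm (\<Phi> p f - \<Phi> q f) \<le> e * norm f" for f by simp
    then show "\<exists>q Q. calc q Q \<and> (\<forall>z\<in>circ. cmod (p z - q z) \<le> e) \<and> (\<forall>f. norm (\<Phi> p f - Q f) \<le> e * norm f)"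
      using poly[OF q(1)] q(2) by blast
  qed
  from calc_op_eqI[OF this] show ?thesis by simp
qed

lemma apply_fun_cesaro:
  assumes "continuous_on circ p"
  shows "apply_fun p cesaro = calc_op p"
  unfolding apply_fun_def
  by (rule the_equality) (use functional_calculus_calc_op functional_calculus_unique[OF _ assms] in blast)+

text \<open>The spectral means are finite sums and commute with the integral over \<open>y\<close>. As they are bounded by
  \<open>b y * \<parallel>f\<parallel>\<^sup>2\<close>, dominated convergence carries this over to their limits.\<close>

lemma calc_integral:
  fixes b :: "real \<Rightarrow> real"
  assumes S: "calc p S" and T: "\<And>y. calc (q y) (T y)"
    and meas: "\<And>z. z \<in> circ \<Longrightarrow> (\<lambda>y. q y z) \<in> borel_measurable borel"
    and bound: "\<And>y z. z \<in> circ \<Longrightarrow> cmod (q y z) \<le> b y" and b: "integrable lborel b"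
    and p: "\<And>z. z \<in> circ \<Longrightarrow> p z = (LINT y|lborel. q y z)"
  shows "cinner (S f) f = (LINT y|lborel. cinner (T y f) f)"
proof -
  have int: "integrable lborel (\<lambda>y. q y z)" if "z \<in> circ" for z
    by (rule Bochner_Integration.integrable_bound[OF b])
      (use meas[OF that] bound[OF that] in \<open>auto intro!: AE_I2 order_trans[OF _ abs_ge_self]\<close>)
  have mean: "spectral_mean N f p = (LINT y|lborel. spectral_mean N f (q y))" for N
    unfolding spectral_mean_def using int[OF unit_root_circ] by (simp add: p[OF unit_root_circ])
  have lim: "(\<lambda>N. spectral_mean N f (q y)) \<longlonglongrightarrow> cinner (T y f) f" for y
    by (rule calc_trace[OF T])
  have m: "(\<lambda>y. spectral_mean N f (q y)) \<in> borel_measurable borel" for N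
    unfolding spectral_mean_def using meas[OF unit_root_circ] by measurable
  have "(\<lambda>N. LINT y|lborel. spectral_mean N f (q y)) \<longlonglongrightarrow> (LINT y|lborel. cinner (T y f) f)"
  proof (rule integral_dominated_convergence)
    show "(\<lambda>y. cinner (T y f) f) \<in> borel_measurable lborel"
      by (rule borel_measurable_LIMSEQ_metric[OF _ lim]) (use m in simp)
    show "integrable lborel (\<lambda>y. b y * (norm f)\<^sup>2)" using b by simp
    show "AE y in lborel. norm (spectral_mean N f (q y)) \<le> b y * (norm f)\<^sup>2" for N
      by (intro AE_I2 spectral_mean_bound bound)
  qed (use m lim in auto)
  moreover have "(\<lambda>N. LINT y|lborel. spectral_mean N f (q y)) \<longlonglongrightarrow> cinner (S f) f"
    using calc_trace[OF S, of f] by (simp only: mean)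
  ultimately show ?thesis by (intro LIMSEQ_unique)
qed

text \<open>The waves are approximate eigenvectors of the Cesaro operator for the eigenvalue \<open>circ_point s\<close>, hence of every
  function of it.\<close>

lemma calc_wave:
  assumes "calc p S"
  shows "(\<lambda>n. cinner (S (wave s n)) (wave s n)) \<longlonglongrightarrow> p (circ_point s)"
proof (rule LIMSEQ_I)
  let ?e = "wave s" and ?z = "circ_point s"
  fix r :: real assume "r > 0"
  then have r: "r / 2 > 0" by simp
  obtain c where c: "\<And>z e. z \<in> circ \<Longrightarrow> norm (S e - scaleC (p z) e) \<le> r / 2 * norm e + c * norm (cesaro e - scaleC z e)"
    by (rule calc_approx[OF assms r]) blast
  have "(\<lambda>n. c * norm (cesaro (?e n) - scaleC ?z (?e n))) \<longlonglongrightarrow> c * 0"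
    by (intro tendsto_mult tendsto_const wave_eigen)
  then have "\<forall>\<^sub>F n in sequentially. c * norm (cesaro (?e n) - scaleC ?z (?e n)) < r / 2"
    using r by (intro order_tendstoD(2)) auto
  then obtain N where N: "\<And>n. n \<ge> N \<Longrightarrow> c * norm (cesaro (?e n) - scaleC ?z (?e n)) < r / 2"
    by (auto simp: eventually_sequentially)
  have "cmod (cinner (S (?e n)) (?e n) - p ?z) < r" if "n \<ge> N" for n
  proof -
    have "cinner (S (?e n)) (?e n) - p ?z = cinner (S (?e n) - scaleC (p ?z) (?e n)) (?e n)"
      by (simp add: cinner_minus_left cinner_scaleC_left cinner_self)
    then show ?thesis
      using cmod_cinner_le[of "S (?e n) - scaleC (p ?z) (?e n)" "?e n"]
        c[OF circ_point_in_circ, of "?e n" s] N[OF that] by simp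
  qed
  then show "\<exists>N. \<forall>n\<ge>N. norm (cinner (S (?e n)) (?e n) - p ?z) < r" by blast
qed

section \<open>An integral representation of the reciprocal logarithm\<close>

definition cauchy_density :: "real \<Rightarrow> real" where
  "cauchy_density y = 1 / (pi\<^sup>2 + y\<^sup>2)"

lemma cauchy_density_pos: "cauchy_density y > 0"
  by (simp add: cauchy_density_def add_pos_nonneg)

lemma cauchy_density_measurable [measurable]: "cauchy_density \<in> borel_measurable borel"
  unfolding cauchy_density_def by measurable

lemma integrable_cauchy_density: "integrable lborel cauchy_density"
proof (rule Bochner_Integration.integrable_bound)
  let ?q = "\<lambda>y::real. indicator {-1..1} y + (if 1 < \<bar>y\<bar> then \<bar>y\<bar> powr (-1 - 2 * (1/2)) else 0)"
  show "integrable lborel ?q"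
    by (intro Bochner_Integration.integrable_add tail_integral(1)) (auto simp: emeasure_lborel_Icc_eq)
  show "AE y in lborel. norm (cauchy_density y) \<le> norm (?q y)"
  proof (rule AE_I2)
    fix y :: real
    have pi: "1 \<le> pi\<^sup>2"
      using power_mono[of 1 pi 2] pi_gt3 by simp
    show "norm (cauchy_density y) \<le> norm (?q y)"
    proof (cases "1 < \<bar>y\<bar>")
      case True
      then have "cauchy_density y \<le> 1 / y\<^sup>2"
        unfolding cauchy_density_def by (intro divide_left_mono) (auto intro!: mult_pos_pos add_pos_nonneg)
      also have "1 / y\<^sup>2 = ?q y"
        using True by (auto simp: powr_minus_divide powr_realpow indicator_def)
      finally show ?thesis using cauchy_density_pos[of y] by simp
    next
      case False
      have "1 \<le> pi\<^sup>2 + y\<^sup>2"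
        using pi zero_le_power2[of y] by linarith
      then have "cauchy_density y \<le> 1"
        unfolding cauchy_density_def by simp
      also have "1 = ?q y" using False by (auto simp: indicator_def abs_le_iff)
      finally show ?thesis using cauchy_density_pos[of y] by simp
    qed
  qed
qed measurable

lemma contour_integral_horizontal:
  assumes "a < b"
  shows "contour_integral (linepath (Complex a c) (Complex b c)) f = integral {a..b} (\<lambda>x. f (Complex x c))"
proof -
  let ?c = "\<i> * complex_of_real c"
  have "linepath (Complex a c) (Complex b c) x = linepath (complex_of_real a) (complex_of_real b) x + ?c" for x
    by (simp add: linepath_def complex_eq_iff algebra_simps)
  then have "contour_integral (linepath (Complex a c) (Complex b c)) f
      = contour_integral (linepath (complex_of_real a) (complex_of_real b)) (\<lambda>z. f (z + ?c))"
    by (simp add: contour_integral_integral Complex_eq)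
  also have "\<dots> = integral {a..b} (\<lambda>x. f (complex_of_real x + ?c))"
    using assms by (subst contour_integral_linepath_Reals_eq) auto
  finally show ?thesis by (simp add: Complex_eq)
qed

lemma norm_exp_add_ge:
  assumes "Re w > 0"
  shows "exp y \<le> cmod (complex_of_real (exp y) + w)" "complex_of_real (exp y) + w \<noteq> 0"
proof -
  show le: "exp y \<le> cmod (complex_of_real (exp y) + w)"
    using complex_Re_le_cmod[of "complex_of_real (exp y) + w"] assms by simp
  then show "complex_of_real (exp y) + w \<noteq> 0"
    using exp_gt_zero[of y] by (metis norm_zero not_less)
qed

text \<open>The function \<open>exp \<zeta> / ((exp \<zeta> - w) \<zeta>)\<close> has the poles \<open>0\<close> and \<open>Ln w\<close> in the strip \<open>\<bar>Im \<zeta>\<bar> \<le> \<pi>\<close>, and on the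
  two boundary lines \<open>exp \<zeta>\<close> takes the same negative values, so that the contributions of the
  lines differ only in \<open>1 / \<zeta>\<close> and combine to the integral on the right.\<close>

lemma inverse_Ln_integral:
  assumes w: "Re w > 0" "w \<noteq> 1"
  shows "1 / Ln w = 1 / (w - 1) +
    (LINT y|lborel. complex_of_real (cauchy_density y) * (complex_of_real (exp y) / (complex_of_real (exp y) + w)))"
proof -
  define L where "L = Ln w"
  have w0: "w \<noteq> 0" using w(1) by auto
  have expL: "exp L = w" using w0 by (simp add: L_def)
  have L0: "L \<noteq> 0" using expL w(2) by auto
  have ImL: "\<bar>Im L\<bar> < pi / 2"
    using Re_Ln_pos_lt[OF w0] w(1) by (simp add: L_def)
  define f where "f z = exp z / ((exp z - w) * z)" for z
  \<comment> \<open>an open strip that contains the rectangles below; as \<open>\<bar>Im L\<bar> < pi / 2\<close>, it contains no other logarithm of \<open>w\<close>\<close>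
  define S where "S = {z. \<bar>Im z\<bar> < 3 * pi / 2}"
  have S_eq: "S = {z. Im z < 3 * pi / 2} \<inter> {z. - (3 * pi / 2) < Im z}"
    by (auto simp: S_def)
  have S: "open S" "convex S"
    unfolding S_eq by (intro open_Int open_halfspace_Im_lt open_halfspace_Im_gt convex_Int convex_halfspace_Im_lt convex_halfspace_Im_gt)+
  have zero: "z = L" if z: "z \<in> S" "exp z = w" for z
  proof -
    have "exp z = exp L" using z expL by simp
    then obtain n :: int where n: "z = L + complex_of_real (real_of_int (2 * n) * pi) * \<i>"
      using exp_eq by blast
    then have "Im z = Im L + 2 * of_int n * pi" by simp
    moreover have "\<bar>Im z\<bar> < 3 * pi / 2"
      using z(1) by (simp add: S_def)
    ultimately have "\<bar>2 * of_int n * pi\<bar> < 2 * pi"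
      using ImL by linarith
    then have "\<bar>real_of_int n\<bar> < 1"
      by (simp add: abs_mult)
    then have "n = 0" by linarith
    with n show ?thesis by simp
  qed
  have holo: "f holomorphic_on S - {0, L}"
    unfolding f_def using zero by (auto intro!: holomorphic_intros)
  have res0: "residue f 0 = 1 / (1 - w)"
  proof (rule residue_simple')
    show "open (S - {L})" "0 \<in> S - {L}" using S L0 by (auto simp: S_def open_delete)
    show "f holomorphic_on S - {L} - {0}" by (rule holomorphic_on_subset[OF holo]) auto
    have "isCont (\<lambda>z. exp z / (exp z - w)) 0"
      using w(2) by (intro continuous_intros) auto
    then have "((\<lambda>z. exp z / (exp z - w)) \<longlongrightarrow> 1 / (1 - w)) (at 0)"
      by (simp add: isCont_def)
    then show "((\<lambda>z. f z * (z - 0)) \<longlongrightarrow> 1 / (1 - w)) (at 0)"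
      by (rule Lim_transform_eventually) (auto simp: f_def eventually_at_filter)
  qed
  have resL: "residue f L = 1 / L"
  proof (rule residue_simple')
    show "open (S - {0})" "L \<in> S - {0}" using S L0 ImL by (auto simp: S_def open_delete)
    show "f holomorphic_on S - {0} - {L}" by (rule holomorphic_on_subset[OF holo]) auto
    have "(exp has_field_derivative w) (at L)"
      using DERIV_exp[of L] expL by simp
    then have "((\<lambda>z. (exp z - w) / (z - L)) \<longlongrightarrow> w) (at L)"
      by (simp add: has_field_derivative_iff expL)
    then have "((\<lambda>z. exp z / z / ((exp z - w) / (z - L))) \<longlongrightarrow> exp L / L / w) (at L)"
      using w0 L0 by (intro tendsto_intros) auto
    then have "((\<lambda>z. exp z / z / ((exp z - w) / (z - L))) \<longlongrightarrow> 1 / L) (at L)"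
      using expL w0 by simp
    then show "((\<lambda>z. f z * (z - L)) \<longlongrightarrow> 1 / L) (at L)"
      by (rule Lim_transform_eventually) (auto simp: f_def eventually_at_filter field_simps)
  qed
  let ?g = "\<lambda>y. complex_of_real (cauchy_density y) * (complex_of_real (exp y) / (complex_of_real (exp y) + w))"
  have int: "integrable lborel ?g"
  proof (rule Bochner_Integration.integrable_bound[OF integrable_cauchy_density])
    show "AE y in lborel. norm (?g y) \<le> norm (cauchy_density y)"
    proof (rule AE_I2)
      fix y
      have "cmod (complex_of_real (exp y) / (complex_of_real (exp y) + w)) \<le> 1"
        using norm_exp_add_ge[OF w(1), of y] by (simp add: norm_divide divide_le_eq_1)
      then show "norm (?g y) \<le> norm (cauchy_density y)"
        unfolding norm_mult norm_of_real real_norm_def by (rule mult_left_le) simp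
    qed
  qed measurable
  have exp_line: "exp (Complex y pi) = - complex_of_real (exp y)" "exp (Complex y (- pi)) = - complex_of_real (exp y)" for y
    by (simp_all add: exp_eq_polar cis.ctr complex_eq_iff)
  have lines: "f (Complex y (- pi)) - f (Complex y pi) = 2 * pi * \<i> * ?g y" for y
  proof -
    define a b where "a = Complex y pi" and "b = Complex y (- pi)"
    have ab: "a \<noteq> 0" "b \<noteq> 0" "a - b = 2 * pi * \<i>" "a * b = complex_of_real (pi\<^sup>2 + y\<^sup>2)"
      by (auto simp: a_def b_def complex_eq_iff power2_eq_square)
    have fl: "f c = complex_of_real (exp y) / (complex_of_real (exp y) + w) * (1 / c)"
      if "exp c = - complex_of_real (exp y)" for c
    proof -
      have "f c = (- complex_of_real (exp y)) / (- ((complex_of_real (exp y) + w) * c))"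
        unfolding f_def that by (simp add: algebra_simps)
      also have "\<dots> = complex_of_real (exp y) / ((complex_of_real (exp y) + w) * c)"
        by (simp only: minus_divide_divide)
      finally show ?thesis by simp
    qed
    have "f b - f a = complex_of_real (exp y) / (complex_of_real (exp y) + w) * (1 / b - 1 / a)"
      using fl[of a] fl[of b] exp_line by (simp add: a_def b_def right_diff_distrib)
    also have "1 / b - 1 / a = (a - b) / (a * b)"
      using ab by (simp add: field_simps)
    also have "\<dots> = 2 * pi * \<i> * complex_of_real (cauchy_density y)"
      unfolding ab by (simp add: cauchy_density_def)
    finally show ?thesis by (simp add: a_def b_def mult_ac)
  qed
  \<comment> \<open>the two vertical sides of the rectangle\<close>
  define V where "V n = contour_integral (linepath (Complex (real n) (- pi)) (Complex (real n) pi)) f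
     + contour_integral (linepath (Complex (- real n) pi) (Complex (- real n) (- pi))) f" for n
  \<comment> \<open>beyond \<open>B\<close> the rectangle contains \<open>L\<close>, and on its vertical sides \<open>exp\<close> is far from \<open>w\<close>\<close>
  define B where "B = cmod L + 2 * cmod w + 2 / cmod w + 2"
  have rect: "2 * pi * \<i> * (1 / (1 - w) + 1 / L) = 2 * pi * \<i> * (LINT y|lborel. indicator {- real n..real n} y *\<^sub>R ?g y) + V n"
    and V: "cmod (V n) \<le> 8 * pi / real n"
    if n: "real n > B" for n
  proof -
    let ?a1 = "Complex (- real n) (- pi)" and ?a2 = "Complex (real n) (- pi)"
      and ?a3 = "Complex (real n) pi" and ?a4 = "Complex (- real n) pi"
    have wpos: "cmod w > 0" using w0 by simp
    then have "2 / cmod w > 0" by simp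
    with n have n2: "real n > cmod L" "real n > 2" "real n > 2 * cmod w" "real n > 2 / cmod w"
      using norm_ge_zero[of L] wpos unfolding B_def by linarith+
    have box: "0 \<in> box ?a1 ?a3" "L \<in> box ?a1 ?a3"
      using n2 ImL abs_Re_le_cmod[of L] pi_gt_zero by (auto simp: in_box_complex_iff abs_less_iff)
    have path: "path_image (rectpath ?a1 ?a3) = cbox ?a1 ?a3 - box ?a1 ?a3"
      by (rule path_image_rectpath_cbox_minus_box) auto
    have sub: "cbox ?a1 ?a3 \<subseteq> S"
    proof
      fix z assume "z \<in> cbox ?a1 ?a3"
      then have "\<bar>Im z\<bar> \<le> pi" by (auto simp: in_cbox_complex_iff abs_le_iff)
      then have "\<bar>Im z\<bar> < 3 * pi / 2" using pi_gt_zero by linarith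
      then show "z \<in> S" by (simp add: S_def)
    qed
    have pim: "path_image (rectpath ?a1 ?a3) \<subseteq> S - {0, L}"
      unfolding path using box sub by auto
    have segs: "closed_segment ?a1 ?a2 \<union> closed_segment ?a2 ?a3 \<union> closed_segment ?a3 ?a4 \<union> closed_segment ?a4 ?a1 \<subseteq> S - {0, L}"
      using pim by (auto simp: rectpath_def Let_def path_image_join)
    have cont: "continuous_on (S - {0, L}) f"
      by (rule holomorphic_on_imp_continuous_on[OF holo])
    have ci: "f contour_integrable_on linepath ?a1 ?a2" "f contour_integrable_on linepath ?a2 ?a3"
      "f contour_integrable_on linepath ?a3 ?a4" "f contour_integrable_on linepath ?a4 ?a1"
      using segs by (auto intro!: contour_integrable_continuous_linepath continuous_on_subset[OF cont])
    have "contour_integral (rectpath ?a1 ?a3) f = 2 * pi * \<i> * (\<Sum>p\<in>{0, L}. winding_number (rectpath ?a1 ?a3) p * residue f p)"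
    proof (rule Residue_theorem[OF S(1) convex_connected[OF S(2)] _ holo])
      show "\<forall>z. z \<notin> S \<longrightarrow> winding_number (rectpath ?a1 ?a3) z = 0"
        using sub by (auto intro!: winding_number_rectpath_outside)
    qed (use pim in auto)
    also have "(\<Sum>p\<in>{0, L}. winding_number (rectpath ?a1 ?a3) p * residue f p) = 1 / (1 - w) + 1 / L"
      using L0 box by (simp add: winding_number_rectpath res0 resL)
    finally have "2 * pi * \<i> * (1 / (1 - w) + 1 / L) = contour_integral (rectpath ?a1 ?a3) f" ..
    also have "\<dots> = contour_integral (linepath ?a1 ?a2) f + contour_integral (linepath ?a2 ?a3) f
        + contour_integral (linepath ?a3 ?a4) f + contour_integral (linepath ?a4 ?a1) f"
      using ci by (simp add: rectpath_def Let_def)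
    also have "contour_integral (linepath ?a3 ?a4) f = - contour_integral (linepath ?a4 ?a3) f"
      using contour_integral_reversepath[of "linepath ?a4 ?a3" f] by simp
    also have "contour_integral (linepath ?a1 ?a2) f = integral {- real n..real n} (\<lambda>y. f (Complex y (- pi)))"
      using n2 by (intro contour_integral_horizontal) linarith
    also have "contour_integral (linepath ?a4 ?a3) f = integral {- real n..real n} (\<lambda>y. f (Complex y pi))"
      using n2 by (intro contour_integral_horizontal) linarith
    finally have "2 * pi * \<i> * (1 / (1 - w) + 1 / L) = integral {- real n..real n} (\<lambda>y. f (Complex y (- pi)))
        - integral {- real n..real n} (\<lambda>y. f (Complex y pi)) + V n"
      by (simp add: V_def)
    also have "integral {- real n..real n} (\<lambda>y. f (Complex y (- pi))) - integral {- real n..real n} (\<lambda>y. f (Complex y pi))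
        = integral {- real n..real n} (\<lambda>y. 2 * pi * \<i> * ?g y)"
    proof -
      have c: "continuous_on {- real n..real n} (\<lambda>y. f (Complex y c))" if "c = pi \<or> c = - pi" for c
      proof (rule continuous_on_compose2[OF cont])
        show "continuous_on {- real n..real n} (\<lambda>y. Complex y c)"
          by (intro continuous_intros)
        show "(\<lambda>y. Complex y c) ` {- real n..real n} \<subseteq> S - {0, L}"
          using that ImL pi_gt_zero by (auto simp: S_def complex_eq_iff)
      qed
      show ?thesis
        by (subst Henstock_Kurzweil_Integration.integral_diff[symmetric]) (auto intro!: integrable_continuous_interval c simp: lines)
    qed
    also have "\<dots> = 2 * pi * \<i> * (LINT y|lborel. indicator {- real n..real n} y *\<^sub>R ?g y)"
    proof -
      have "set_integrable lborel {- real n..real n} ?g"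
        unfolding set_integrable_def by (rule integrable_mult_indicator[OF _ int]) simp
      from set_borel_integral_eq_integral(2)[OF this] show ?thesis
        by (simp only: set_lebesgue_integral_def Henstock_Kurzweil_Integration.integral_mult_right)
    qed
    finally show "2 * pi * \<i> * (1 / (1 - w) + 1 / L) = 2 * pi * \<i> * (LINT y|lborel. indicator {- real n..real n} y *\<^sub>R ?g y) + V n" .
    have "1 + real n \<le> exp (real n)" by (rule exp_ge_add_one_self)
    with n2 have small: "2 * cmod w \<le> exp (real n)" and "2 / cmod w \<le> exp (real n)" by linarith+
    then have small': "2 * exp (- real n) \<le> cmod w"
      using wpos by (simp add: exp_minus field_simps)
    have bound: "cmod (f z) \<le> 2 / real n" if z: "Re z = real n \<or> Re z = - real n" for z
    proof -
      have zn: "real n \<le> cmod z" using abs_Re_le_cmod[of z] z by auto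
      have ez: "cmod (exp z) = exp (Re z)" by simp
      have le: "cmod (exp z) \<le> 2 * cmod (exp z - w)"
        using z
      proof
        assume "Re z = real n"
        then show ?thesis
          using norm_triangle_ineq2[of "exp z" w] small ez by simp
      next
        assume "Re z = - real n"
        then show ?thesis
          using norm_triangle_ineq3[of "exp z" w] small' ez by simp
      qed
      have pos: "cmod (exp z - w) > 0"
        using le by (smt (verit) exp_not_eq_zero norm_le_zero_iff zero_less_norm_iff)
      have "cmod (f z) = cmod (exp z) / cmod (exp z - w) / cmod z"
        by (simp add: f_def norm_divide norm_mult)
      also have "\<dots> \<le> 2 / real n"
        using le pos zn n2 by (intro frac_le) (auto simp: divide_le_eq)
      finally show ?thesis .
    qed
    have "cmod (contour_integral (linepath ?a2 ?a3) f) \<le> 2 / real n * cmod (?a3 - ?a2)"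
      by (rule contour_integral_bound_linepath[OF ci(2)])
        (auto intro!: bound simp: closed_segment_same_Re)
    moreover have "cmod (contour_integral (linepath ?a4 ?a1) f) \<le> 2 / real n * cmod (?a1 - ?a4)"
      by (rule contour_integral_bound_linepath[OF ci(4)])
        (auto intro!: bound simp: closed_segment_same_Re)
    moreover have "cmod (?a3 - ?a2) = 2 * pi" "cmod (?a1 - ?a4) = 2 * pi"
      by (simp_all add: cmod_def real_sqrt_mult)
    ultimately show "cmod (V n) \<le> 8 * pi / real n"
      unfolding V_def by (intro norm_triangle_le) simp
  qed
  obtain N where N: "real N > B"
    using reals_Archimedean2 by blast
  have ev: "\<forall>\<^sub>F n in sequentially. real n > B"
    using N by (intro eventually_sequentiallyI[of N]) (auto intro: less_le_trans)
  have "(\<lambda>n. 8 * pi * inverse (real n)) \<longlonglongrightarrow> 8 * pi * 0"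
    by (intro tendsto_mult tendsto_const lim_inverse_n)
  then have "(\<lambda>n. 8 * pi / real n) \<longlonglongrightarrow> 0" by (simp add: divide_inverse)
  then have V0: "V \<longlonglongrightarrow> 0"
    by (rule Lim_null_comparison[rotated]) (use eventually_mono[OF ev V] in simp)
  have I: "(\<lambda>n. LINT y|lborel. indicator {- real n..real n} y *\<^sub>R ?g y) \<longlonglongrightarrow> (LINT y|lborel. ?g y)"
  proof (rule integral_dominated_convergence)
    show "integrable lborel (\<lambda>y. norm (?g y))" using int by (rule integrable_norm)
    show "AE y in lborel. (\<lambda>n. indicator {- real n..real n} y *\<^sub>R ?g y) \<longlonglongrightarrow> ?g y"
    proof (rule AE_I2)
      fix y :: real
      obtain k where "\<bar>y\<bar> \<le> real k" using real_arch_simple by blast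
      then have "\<forall>\<^sub>F n in sequentially. indicator {- real n..real n} y *\<^sub>R ?g y = ?g y"
        by (intro eventually_sequentiallyI[of k]) (auto simp: indicator_def abs_le_iff)
      then show "(\<lambda>n. indicator {- real n..real n} y *\<^sub>R ?g y) \<longlonglongrightarrow> ?g y"
        by (rule tendsto_eventually)
    qed
  qed (auto simp: indicator_def)
  have "(\<lambda>n. 2 * pi * \<i> * (LINT y|lborel. indicator {- real n..real n} y *\<^sub>R ?g y) + V n)
      \<longlonglongrightarrow> 2 * pi * \<i> * (LINT y|lborel. ?g y) + 0"
    by (intro tendsto_add tendsto_mult tendsto_const I V0)
  moreover have "(\<lambda>n. 2 * pi * \<i> * (LINT y|lborel. indicator {- real n..real n} y *\<^sub>R ?g y) + V n)
      \<longlonglongrightarrow> 2 * pi * \<i> * (1 / (1 - w) + 1 / L)"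
    by (rule tendsto_eventually) (use eventually_mono[OF ev rect] in \<open>simp add: eq_commute\<close>)
  ultimately have "2 * pi * \<i> * (1 / (1 - w) + 1 / L) = 2 * pi * \<i> * (LINT y|lborel. ?g y) + 0"
    by (intro LIMSEQ_unique)
  then have "1 / (1 - w) + 1 / L = (LINT y|lborel. ?g y)"
    by (simp only: add_0_right mult_cancel_left) simp
  moreover have "1 / (1 - w) = - (1 / (w - 1))"
    by (metis minus_diff_eq minus_divide_right)
  ultimately show ?thesis by (simp add: L_def algebra_simps)
qed

section \<open>The inverse of the logarithm as a function of the Cesaro operator\<close>

text \<open>The value at \<open>0\<close>, a point of the circle, is the limit of \<open>1 / Ln z\<close> there.\<close>

definition inv_log :: "complex \<Rightarrow> complex" where
  "inv_log z = (if z = 0 then 0 else 1 / Ln z)"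

lemma inv_log_0 [simp]: "inv_log 0 = 0"
  by (simp add: inv_log_def)

lemma circ_nonpos_Reals: "z \<in> circ \<Longrightarrow> z \<noteq> 0 \<Longrightarrow> z \<notin> \<real>\<^sub>\<le>\<^sub>0"
proof
  assume z: "z \<in> circ" "z \<noteq> 0" "z \<in> \<real>\<^sub>\<le>\<^sub>0"
  then have "Re z \<le> 0" "Im z = 0" by (auto simp: complex_nonpos_Reals_iff)
  with circ_Re_nonneg[OF z(1)] z(2) show False by (simp add: complex_eq_iff)
qed

lemma circ_Ln_nonzero: "z \<in> circ \<Longrightarrow> z \<noteq> 0 \<Longrightarrow> Ln z \<noteq> 0"
proof
  assume z: "z \<in> circ" "z \<noteq> 0" "Ln z = 0"
  then have "z = 1" using exp_Ln[OF z(2)] unfolding z(3) by simp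
  with z(1) show False by (simp add: circ_def)
qed

lemma continuous_on_inv_log: "continuous_on circ inv_log"
  unfolding continuous_on_def
proof
  fix z assume z: "z \<in> circ"
  show "(inv_log \<longlongrightarrow> inv_log z) (at z within circ)"
  proof (cases "z = 0")
    case False
    have "isCont (\<lambda>z. 1 / Ln z) z"
      using circ_nonpos_Reals[OF z False] circ_Ln_nonzero[OF z False]
      by (intro continuous_intros) auto
    then have "((\<lambda>z. 1 / Ln z) \<longlongrightarrow> inv_log z) (at z within circ)"
      using False by (auto simp: isCont_def inv_log_def intro: tendsto_within_subset)
    moreover have "\<forall>\<^sub>F x in at z within circ. x \<noteq> 0"
      using tendsto_imp_eventually_ne[OF tendsto_ident_at False] .
    then have "\<forall>\<^sub>F x in at z within circ. 1 / Ln x = inv_log x"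
      by eventually_elim (simp add: inv_log_def)
    ultimately show ?thesis
      by (rule Lim_transform_eventually)
  next
    case True
    have "((\<lambda>z::complex. cmod z) \<longlongrightarrow> 0) (at 0)"
      by (intro tendsto_norm_zero tendsto_ident_at)
    then have "filterlim cmod (at_right 0) (at 0)"
      unfolding filterlim_at by (auto simp: eventually_at_filter)
    then have "filterlim (\<lambda>z::complex. ln (cmod z)) at_bot (at 0)"
      by (rule filterlim_compose[OF ln_at_0])
    then have "((\<lambda>z::complex. inverse (ln (cmod z))) \<longlongrightarrow> 0) (at 0)"
      by (rule filterlim_compose[OF tendsto_inverse_0 filterlim_at_bot_imp_at_infinity])
    then have lim: "((\<lambda>z::complex. \<bar>inverse (ln (cmod z))\<bar>) \<longlongrightarrow> 0) (at 0)"
      by (rule tendsto_rabs_zero)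
    have ev: "\<forall>\<^sub>F z in at 0. norm (inv_log z) \<le> \<bar>inverse (ln (cmod z))\<bar>"
    proof -
      have "norm (inv_log z) \<le> \<bar>inverse (ln (cmod z))\<bar>" if "z \<noteq> 0" "cmod z < 1" for z
      proof -
        have ln: "ln (cmod z) < 0" using that by simp
        have "\<bar>ln (cmod z)\<bar> \<le> cmod (Ln z)"
          using abs_Re_le_cmod[of "Ln z"] that by simp
        then have "inverse (cmod (Ln z)) \<le> inverse \<bar>ln (cmod z)\<bar>"
          using ln by (intro le_imp_inverse_le) auto
        then show ?thesis
          using that(1) by (simp add: inv_log_def norm_divide inverse_eq_divide)
      qed
      then show ?thesis
        unfolding eventually_at by (intro exI[of _ 1]) (auto simp: dist_norm)
    qed
    from Lim_null_comparison[OF ev lim] show ?thesis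
      using True by (auto intro: tendsto_within_subset)
  qed
qed

lemma continuous_on_powr_circ: "h > 0 \<Longrightarrow> continuous_on circ (\<lambda>z. z powr complex_of_real h)"
  by (rule continuous_on_powr_complex) (auto dest: circ_Re_nonneg intro: continuous_intros)

text \<open>The case \<open>w = 1 / z\<close> of \<open>inverse_Ln_integral\<close>. On the circle \<open>1 / (1 / z - 1) = z / (1 - z) = - cnj z\<close>, which is the
  function that belongs to the adjoint of the Cesaro operator.\<close>

lemma inv_log_integral:
  assumes z: "z \<in> circ"
  shows "cnj z - inv_log z = (LINT y|lborel. complex_of_real (cauchy_density y * exp y) *
    (z / (1 + complex_of_real (exp y) * z)))"
proof (cases "z = 0")
  case False
  let ?w = "1 / z"
  have np: "z \<notin> \<real>\<^sub>\<le>\<^sub>0" by (rule circ_nonpos_Reals[OF z False])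
  have "Re z \<noteq> 0"
    using circ_norm[OF z] False by auto
  then have "Re ?w = 1/2"
    using circ_norm[OF z] by (simp add: Re_divide cmod_power2[symmetric])
  moreover have z1: "z \<noteq> 1" using z by (auto simp: circ_def)
  then have w1: "?w \<noteq> 1" using False by (simp add: field_simps)
  ultimately have "1 / Ln ?w = 1 / (?w - 1) + (LINT y|lborel. complex_of_real (cauchy_density y) *
      (complex_of_real (exp y) / (complex_of_real (exp y) + ?w)))"
    by (intro inverse_Ln_integral) auto
  moreover have "1 / Ln ?w = - inv_log z"
    using Ln_inverse[OF np] False by (simp add: inv_log_def inverse_eq_divide)
  moreover have "1 / (?w - 1) = - cnj z"
  proof -
    have "(1 - z) * cnj z = - z"
      using circ_cnj[OF z] by (simp add: algebra_simps)
    moreover have "?w - 1 = (1 - z) / z" using False by (simp add: field_simps)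
    ultimately show ?thesis
      using z1 False by (simp add: field_simps)
  qed
  moreover have "complex_of_real (cauchy_density y) * (complex_of_real (exp y) / (complex_of_real (exp y) + ?w))
      = complex_of_real (cauchy_density y * exp y) * (z / (1 + complex_of_real (exp y) * z))" for y
  proof -
    have "complex_of_real (exp y) + ?w = (1 + complex_of_real (exp y) * z) / z"
      using False by (simp add: field_simps)
    then show ?thesis by simp
  qed
  ultimately show ?thesis by (simp add: algebra_simps)
qed simp

text \<open>The kernels of the operators that belong to the terms in \<open>inv_log_integral\<close>.\<close>

definition inv_log_kernel :: "real \<Rightarrow> complex" where
  "inv_log_kernel u = adj_kernel u
     - (LINT y|lborel. complex_of_real (cauchy_density y * exp y) * res_kernel (exp y) u)"

text \<open>Both sides have the same quadratic form: the functional calculus integrates the functions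
  \<open>z / (1 + exp y * z)\<close> over \<open>y\<close>, and \<open>hausdorff_mixture\<close> integrates the corresponding kernels. The factor \<open>exp y\<close>
  is compensated in both integrals, by \<open>\<bar>exp y * z\<bar> \<le> \<bar>1 + exp y * z\<bar>\<close> and by the weighted norm
  \<open>1 / (exp y + 1/2)\<close> of the kernel.\<close>

lemma inv_log_hausdorff:
  shows "admissible_kernel inv_log_kernel" "hausdorff_op inv_log_kernel = calc_op inv_log"
proof -
  let ?k = "\<lambda>y u. complex_of_real (cauchy_density y * exp y) * res_kernel (exp y) u"
  let ?M = "\<lambda>u. LINT y|lborel. ?k y u"
  have meas: "case_prod ?k \<in> borel_measurable (borel \<Otimes>\<^sub>M borel)"
    by measurable
  have adm: "admissible_kernel (?k y)" for y
    by (intro hausdorff_op_cmult admissible_res_kernel) simp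
  have bound: "(LINT u|lborel. cmod (?k y u) * \<bar>u\<bar> powr (-1/2)) \<le> cauchy_density y" for y
  proof -
    have "(LINT u|lborel. cmod (?k y u) * \<bar>u\<bar> powr (-1/2)) = (LINT u|lborel. cauchy_density y * exp y * (cmod (res_kernel (exp y) u) * \<bar>u\<bar> powr (-1/2)))"
      using cauchy_density_pos[of y] by (simp add: norm_mult mult.assoc)
    also have "\<dots> = cauchy_density y * (exp y / (exp y + 1/2))"
      by (simp only: integral_mult_right_zero res_kernel_weight(2)[OF less_imp_le[OF exp_gt_zero]]) simp
    also have "\<dots> \<le> cauchy_density y"
      using cauchy_density_pos[of y] exp_gt_zero[of y] by (intro mult_left_le) (auto simp: divide_le_eq add_pos_pos)
    finally show ?thesis .
  qed
  note mix = hausdorff_mixture[OF meas adm bound integrable_cauchy_density]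
  show admK: "admissible_kernel inv_log_kernel"
    unfolding inv_log_kernel_def[abs_def] by (intro admissible_kernel_diff admissible_adj_kernel mix(1))
  have K: "hausdorff_op inv_log_kernel f = cesaro_adj f - hausdorff_op ?M f" for f
    unfolding inv_log_kernel_def[abs_def] cesaro_adj_def by (rule hausdorff_op_diff[OF admissible_adj_kernel mix(1)])
  have calcr: "calc inv_log (calc_op inv_log)"
    by (rule calc_calc_op[OF continuous_on_inv_log])
  let ?q = "\<lambda>y z. complex_of_real (cauchy_density y * exp y) * (z / (1 + complex_of_real (exp y) * z))"
  have int_eq: "cinner (cesaro_adj f - calc_op inv_log f) f = (LINT y|lborel. cinner (hausdorff_op (?k y) f) f)" for f
  proof (rule calc_integral[where q = ?q and p = "\<lambda>z. cnj z - inv_log z"])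
    show "calc (\<lambda>z. cnj z - inv_log z) (\<lambda>f. cesaro_adj f - calc_op inv_log f)"
      by (rule calc_diff[OF calc_adj calcr])
    have "hausdorff_op (?k y) = (\<lambda>f. scaleC (complex_of_real (cauchy_density y * exp y)) (resolvent (exp y) f))" for y
      unfolding resolvent_def by (rule ext, rule hausdorff_op_cmult, rule admissible_res_kernel) simp
    then show "calc (?q y) (hausdorff_op (?k y))" for y
      by (simp only:) (intro calc_scale calc_resolvent, simp)
    show "cmod (?q y z) \<le> cauchy_density y" if z: "z \<in> circ" for y z
    proof -
      have pos: "1 \<le> cmod (1 + complex_of_real (exp y) * z)"
        using circ_one_plus_ge_1[OF z, of "exp y"] by simp
      have "(exp y * cmod z)\<^sup>2 \<le> (cmod (1 + complex_of_real (exp y) * z))\<^sup>2"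
        using circ_Re_nonneg[OF z] unfolding power_mult_distrib cmod_power2
        by (simp add: power2_eq_square algebra_simps)
      then have "exp y * cmod z \<le> cmod (1 + complex_of_real (exp y) * z)"
        by (rule power2_le_imp_le) simp
      then have "exp y * cmod z / cmod (1 + complex_of_real (exp y) * z) \<le> 1"
        using pos by (simp add: divide_le_eq_1)
      then have "cauchy_density y * (exp y * cmod z / cmod (1 + complex_of_real (exp y) * z)) \<le> cauchy_density y"
        using cauchy_density_pos[of y] by (intro mult_left_le) auto
      then show ?thesis
        using cauchy_density_pos[of y] by (simp add: norm_mult norm_divide mult.assoc)
    qed
    show "(\<lambda>y. ?q y z) \<in> borel_measurable borel" for z
      by measurable
  qed (rule integrable_cauchy_density, rule inv_log_integral)
  have "cinner (hausdorff_op inv_log_kernel f) f = cinner (calc_op inv_log f) f" for f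
    by (simp only: K cinner_minus_left mix(2) int_eq[symmetric]) simp
  then show "hausdorff_op inv_log_kernel = calc_op inv_log"
    by (intro bounded_clinear_eqI bounded_clinear_hausdorff admK calc_bounded_clinear[OF calcr])
qed

section \<open>The range of the Cesaro operator\<close>

text \<open>The orthogonal complement of the range is trivial: a vector in it is annihilated by the adjoint \<open>A\<close>, hence
  by the Cesaro operator \<open>C\<close> because of \<open>C = A C - A\<close>, and \<open>C\<close> is injective. The residual of the best
  approximation of \<open>f\<close> from the closure of the range, which exists by the parallelogram law, is such a vector.\<close>

lemma cesaro_range_dense:
  assumes "e > 0"
  shows "\<exists>g. norm (f - cesaro g) < e"
proof -
  note bc = bounded_clinear_cesaro
  define d where "d = (INF g. (norm (f - cesaro g))\<^sup>2)"
  have bdd: "bdd_below (range (\<lambda>g. (norm (f - cesaro g))\<^sup>2))"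
    by (auto intro: bdd_belowI[of _ 0])
  have d: "d \<le> (norm (f - cesaro g))\<^sup>2" for g
    unfolding d_def by (rule cINF_lower[OF bdd]) simp
  have "\<exists>g. (norm (f - cesaro g))\<^sup>2 < d + inverse (real (Suc n))" for n
    using cINF_less_iff[OF _ bdd, of "d + inverse (real (Suc n))"] by (simp add: d_def)
  then obtain g where g: "\<And>n. (norm (f - cesaro (g n)))\<^sup>2 < d + inverse (real (Suc n))"
    by metis
  define h where "h n = f - cesaro (g n)" for n
  have close: "(norm (h m - h n))\<^sup>2 \<le> 2 * inverse (real (Suc m)) + 2 * inverse (real (Suc n))" for m n
  proof -
    have "f - cesaro (scaleC (1/2) (g m + g n)) = scaleC (1/2) (h m + h n)"
      unfolding h_def bounded_clinear_scaleC[OF bc] bounded_clinear_add[OF bc]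
      using scaleC_add_left[of "1/2" "1/2" f] by (simp add: scaleC_add_right scaleC_minus_right algebra_simps)
    then have "4 * d \<le> (norm (h m + h n))\<^sup>2"
      using d[of "scaleC (1/2) (g m + g n)"] by (simp add: power_divide)
    moreover have "(norm (h m - h n))\<^sup>2 = 2 * (norm (h m))\<^sup>2 + 2 * (norm (h n))\<^sup>2 - (norm (h m + h n))\<^sup>2"
      by (simp add: power2_norm_eq_inner inner_add inner_diff inner_commute)
    ultimately show ?thesis
      using g[of m] g[of n] by (simp add: h_def)
  qed
  have "Cauchy h"
  proof (rule CauchyI)
    fix r :: real assume r: "r > 0"
    obtain N where N: "inverse (real (Suc N)) < r\<^sup>2 / 4"
      using reals_Archimedean[of "r\<^sup>2 / 4"] r by auto
    have "norm (h m - h n) < r" if "m \<ge> N" "n \<ge> N" for m n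
    proof (rule power2_less_imp_less)
      have "inverse (real (Suc m)) \<le> inverse (real (Suc N))" "inverse (real (Suc n)) \<le> inverse (real (Suc N))"
        using that by (auto intro!: le_imp_inverse_le)
      then show "(norm (h m - h n))\<^sup>2 < r\<^sup>2"
        using close[of m n] N by linarith
    qed (use r in simp)
    then show "\<exists>M. \<forall>m\<ge>M. \<forall>n\<ge>M. norm (h m - h n) < r" by blast
  qed
  then obtain k where k: "h \<longlonglongrightarrow> k"
    using Cauchy_convergent convergent_def by blast
  have min: "(norm k)\<^sup>2 \<le> (norm (k - cesaro g'))\<^sup>2" for g'
  proof (rule order_trans)
    have "(\<lambda>n. d + inverse (real (Suc n))) \<longlonglongrightarrow> d + 0"
      by (intro tendsto_intros LIMSEQ_inverse_real_of_nat)
    moreover have "(\<lambda>n. (norm (h n))\<^sup>2) \<longlonglongrightarrow> (norm k)\<^sup>2"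
      by (intro tendsto_intros k)
    ultimately have "(norm k)\<^sup>2 \<le> d + 0"
      using g by (intro LIMSEQ_le[of "\<lambda>n. (norm (h n))\<^sup>2"]) (auto simp: h_def intro: less_imp_le)
    then show "(norm k)\<^sup>2 \<le> d" by simp
    have "d \<le> (norm (h n - cesaro g'))\<^sup>2" for n
      using d[of "g n + g'"] by (simp add: h_def bounded_clinear_add[OF bc] diff_diff_eq)
    then show "d \<le> (norm (k - cesaro g'))\<^sup>2"
      by (intro LIMSEQ_le_const[of "\<lambda>n. (norm (h n - cesaro g'))\<^sup>2"] tendsto_intros k) auto
  qed
  have orth: "k \<bullet> cesaro g' = 0" for g'
  proof -
    \<comment> \<open>the step length \<open>s\<close> nearly minimises the quadratic function of \<open>s\<close>; adding \<open>1\<close> avoids a vanishing denominator\<close>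
    define x N where "x = k \<bullet> cesaro g'" and "N = cesaro g' \<bullet> cesaro g'"
    define s where "s = x / (N + 1)"
    have N: "N \<ge> 0" by (simp add: N_def)
    have "cesaro (s *\<^sub>R g') = s *\<^sub>R cesaro g'"
      by (simp add: scaleR_scaleC bounded_clinear_scaleC[OF bc])
    then have "(norm (k - cesaro (s *\<^sub>R g')))\<^sup>2 = (norm k)\<^sup>2 - 2 * s * x + s * s * N"
      by (simp add: power2_norm_eq_inner inner_diff inner_commute x_def N_def)
    then have "2 * s * x \<le> s * s * N"
      using min[of "s *\<^sub>R g'"] by linarith
    moreover have "x = s * (N + 1)" using N by (simp add: s_def)
    ultimately have "s\<^sup>2 * (N + 2) \<le> 0" by (simp add: power2_eq_square algebra_simps)
    then have "s = 0" using N by (simp add: mult_le_0_iff)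
    with \<open>x = s * (N + 1)\<close> show ?thesis by (simp add: x_def)
  qed
  have "cesaro_adj k = 0"
    using orth[of "cesaro_adj k"] inner_commute[of k "cesaro (cesaro_adj k)"]
    by (simp add: inner_l2_def cinner_cesaro_adj cinner_self del: of_real_power)
  then have "cesaro k = 0"
    using adj_cesaro[of k] by (simp add: adj_cesaro_commute bounded_clinear_zero[OF bc])
  then have "h \<longlonglongrightarrow> 0" using cesaro_eq_0_imp k by blast
  then have "\<forall>\<^sub>F n in sequentially. norm (h n) < e"
    using assms by (intro order_tendstoD(2)[OF tendsto_norm_zero])
  then show ?thesis
    by (auto simp: eventually_sequentially h_def)
qed

section \<open>The generator\<close>

lemma cesaro_power_eq: "h > 0 \<Longrightarrow> cesaro_power h = calc_op (\<lambda>z. z powr complex_of_real h)"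
  by (simp add: cesaro_power_def apply_fun_cesaro continuous_on_powr_circ)

text \<open>The function that belongs to the difference quotient of the semigroup times the inverse of the logarithm.\<close>

definition log_quotient :: "real \<Rightarrow> complex \<Rightarrow> complex" where
  "log_quotient h z = complex_of_real (1 / h) * ((z powr complex_of_real h - 1) * inv_log z)"

lemma calc_log_quotient:
  assumes "h > 0"
  shows "calc (log_quotient h) (\<lambda>f. (cesaro_power h (calc_op inv_log f) - calc_op inv_log f) /\<^sub>R h)"
    and "calc (log_quotient h) (\<lambda>f. calc_op inv_log ((cesaro_power h f - f) /\<^sub>R h))"
proof -
  have d: "calc (\<lambda>z. z powr complex_of_real h - 1) (\<lambda>f. cesaro_power h f - f)"
    using calc_diff[OF calc_calc_op[OF continuous_on_powr_circ[OF assms]] calc_one]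
    by (simp add: cesaro_power_eq[OF assms])
  note r = calc_calc_op[OF continuous_on_inv_log]
  show "calc (log_quotient h) (\<lambda>f. (cesaro_power h (calc_op inv_log f) - calc_op inv_log f) /\<^sub>R h)"
    using calc_scale[OF calc_mult[OF d r], of "complex_of_real (1 / h)"]
    by (simp add: log_quotient_def[abs_def] scaleR_scaleC inverse_eq_divide)
  have "calc (\<lambda>z. inv_log z * (complex_of_real (1 / h) * (z powr complex_of_real h - 1)))
      (\<lambda>f. calc_op inv_log (scaleC (complex_of_real (1 / h)) (cesaro_power h f - f)))"
    by (rule calc_mult[OF r calc_scale[OF d]])
  moreover have "(\<lambda>z. inv_log z * (complex_of_real (1 / h) * (z powr complex_of_real h - 1))) = log_quotient h"
    by (simp add: log_quotient_def fun_eq_iff mult_ac)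
  ultimately show "calc (log_quotient h) (\<lambda>f. calc_op inv_log ((cesaro_power h f - f) /\<^sub>R h))"
    by (simp add: scaleR_scaleC inverse_eq_divide)
qed

text \<open>With \<open>v = h Ln z\<close> the quotient is \<open>(exp v - 1) / v\<close>. For \<open>\<bar>v\<bar> \<le> 1\<close> it is controlled by Taylor's formula,
  otherwise by \<open>\<bar>exp v\<bar> \<le> 2\<close>, which holds because \<open>\<bar>z\<bar> \<le> 2\<close> on the circle and \<open>h \<le> 1\<close>. The second
  bound uses that \<open>z Ln z\<close> is bounded on the circle.\<close>

lemma log_quotient_bounds:
  assumes z: "z \<in> circ" and h: "0 < h" "h \<le> 1"
  shows "cmod (log_quotient h z) \<le> 4" "cmod ((log_quotient h z - 1) * z) \<le> 4 * h * (4 + 2 * pi)"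
proof -
  have "cmod (log_quotient h z) \<le> 4 \<and> cmod ((log_quotient h z - 1) * z) \<le> 4 * h * (4 + 2 * pi)"
  proof (cases "z = 0")
    case True
    then show ?thesis using h by (simp add: log_quotient_def)
  next
    case False
    define v where "v = complex_of_real h * Ln z"
    have v0: "v \<noteq> 0" using circ_Ln_nonzero[OF z False] h by (simp add: v_def)
    have q: "log_quotient h z = (exp v - 1) / v"
      using False h by (simp add: log_quotient_def inv_log_def powr_def v_def field_simps)
    have q1: "log_quotient h z - 1 = (exp v - 1 - v) / v"
      using v0 by (simp add: q field_simps)
    have main: "cmod (exp v - 1) \<le> 4 * cmod v \<and> cmod (exp v - 1 - v) \<le> 4 * cmod v * cmod v"
    proof (cases "cmod v \<le> 1")
      case True
      have "cmod (exp v - (1 + v)) \<le> exp \<bar>Re v\<bar> * cmod v ^ 2"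
        using Taylor_exp[of v 1] by (simp add: numeral_2_eq_2)
      also have "\<dots> \<le> 3 * cmod v ^ 2"
      proof (rule mult_right_mono)
        have "\<bar>Re v\<bar> \<le> 1" using abs_Re_le_cmod[of v] True by linarith
        then have "exp \<bar>Re v\<bar> \<le> exp 1" by simp
        then show "exp \<bar>Re v\<bar> \<le> 3" using exp_le by linarith
      qed simp
      finally have 1: "cmod (exp v - 1 - v) \<le> 3 * (cmod v * cmod v)"
        by (simp add: power2_eq_square diff_diff_eq)
      moreover have "cmod v * cmod v \<le> 1 * cmod v"
        using True by (intro mult_right_mono) auto
      moreover have "cmod (exp v - 1) \<le> cmod (exp v - 1 - v) + cmod v"
        using norm_triangle_ineq[of "exp v - 1 - v" v] by simp
      moreover have "0 \<le> cmod v * cmod v" by simp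
      ultimately have "cmod (exp v - 1) \<le> 4 * cmod v" "cmod (exp v - 1 - v) \<le> 4 * (cmod v * cmod v)"
        by linarith+
      then show ?thesis by (simp add: mult.assoc)
    next
      case False
      have "Re v \<le> ln 2"
      proof -
        have "ln (cmod z) \<le> ln 2"
          using \<open>z \<noteq> 0\<close> circ_norm_le[OF z] by simp
        then have "h * ln (cmod z) \<le> h * ln 2" using h by (intro mult_left_mono) auto
        also have "\<dots> \<le> 1 * ln 2" using h by (intro mult_right_mono) auto
        finally show ?thesis using \<open>z \<noteq> 0\<close> by (simp add: v_def)
      qed
      then have "exp (Re v) \<le> exp (ln 2)" by (simp only: exp_le_cancel_iff)
      then have "cmod (exp v) \<le> 2" by simp
      then have 1: "cmod (exp v - 1) \<le> 3"
        using norm_triangle_ineq4[of "exp v" 1] by simp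
      have 2: "cmod (exp v - 1 - v) \<le> 3 + cmod v"
        using norm_triangle_ineq4[of "exp v - 1" v] 1 by simp
      have "cmod v * 1 \<le> cmod v * cmod v" using False by (intro mult_left_mono) auto
      then show ?thesis using 1 2 False by (simp add: mult.assoc)
    qed
    have vpos: "cmod v > 0" using v0 by simp
    have A: "cmod (log_quotient h z) \<le> 4"
      using main vpos by (simp add: q norm_divide divide_le_eq)
    have B: "cmod (log_quotient h z - 1) \<le> 4 * cmod v"
      using main vpos by (simp add: q1 norm_divide divide_le_eq)
    have zp: "cmod z > 0" using False by simp
    have "\<bar>ln (cmod z)\<bar> * cmod z \<le> 4"
    proof (cases "cmod z \<ge> 1")
      case True
      then have "\<bar>ln (cmod z)\<bar> \<le> cmod z" using ln_le_minus_one[OF zp] by simp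
      then have "\<bar>ln (cmod z)\<bar> * cmod z \<le> 2 * 2"
        using circ_norm_le[OF z] by (intro mult_mono) auto
      then show ?thesis by simp
    next
      case False
      then have "\<bar>ln (cmod z)\<bar> = ln (1 / cmod z)"
        using zp by (simp add: ln_div)
      also have "\<dots> \<le> 1 / cmod z"
        using ln_le_minus_one[of "1 / cmod z"] zp by simp
      finally have "\<bar>ln (cmod z)\<bar> * cmod z \<le> 1 / cmod z * cmod z"
        using zp by (intro mult_right_mono) auto
      then show ?thesis using zp by simp
    qed
    moreover have "cmod (Ln z) \<le> \<bar>ln (cmod z)\<bar> + pi"
    proof -
      have "\<bar>Im (Ln z)\<bar> \<le> pi"
        using mpi_less_Im_Ln[OF False] Im_Ln_le_pi[OF False] by linarith
      then show ?thesis using cmod_le[of "Ln z"] False by simp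
    qed
    then have "cmod (Ln z) * cmod z \<le> (\<bar>ln (cmod z)\<bar> + pi) * cmod z"
      by (intro mult_right_mono) auto
    moreover have "pi * cmod z \<le> pi * 2"
      using circ_norm_le[OF z] by (intro mult_left_mono) auto
    ultimately have C: "cmod (Ln z) * cmod z \<le> 4 + 2 * pi"
      unfolding distrib_right by linarith
    have "cmod ((log_quotient h z - 1) * z) = cmod (log_quotient h z - 1) * cmod z" by (rule norm_mult)
    also have "\<dots> \<le> 4 * cmod v * cmod z" using B by (intro mult_right_mono) auto
    also have "\<dots> = 4 * h * (cmod (Ln z) * cmod z)" using h by (simp add: v_def norm_mult)
    also have "\<dots> \<le> 4 * h * (4 + 2 * pi)" using C h by (intro mult_left_mono) auto
    finally show ?thesis using A by simp
  qed
  then show "cmod (log_quotient h z) \<le> 4" "cmod ((log_quotient h z - 1) * z) \<le> 4 * h * (4 + 2 * pi)" by auto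
qed

text \<open>The difference quotients converge to \<open>1\<close> uniformly only after multiplication by \<open>z\<close>, since all of them
  vanish at \<open>0\<close>; this gives convergence on the range of the Cesaro operator, and the
  uniform bound extends it to the closure of the range.\<close>

lemma log_quotient_tendsto:
  assumes T: "\<And>h. h > 0 \<Longrightarrow> calc (log_quotient h) (T h)"
  shows "((\<lambda>h. T h f) \<longlongrightarrow> f) (at_right 0)"
proof (rule tendstoI)
  fix e :: real assume e: "e > 0"
  then obtain g where g: "norm (f - cesaro g) < e / 10"
    using cesaro_range_dense[of "e / 10"] by auto
  define C where "C = 4 * (4 + 2 * pi) * norm g"
  have C: "C \<ge> 0" by (simp add: C_def add_nonneg_nonneg)
  define d where "d = min 1 (e / (4 * (C + 1)))"
  have d: "d > 0" "d \<le> 1" using e C by (auto simp: d_def add_nonneg_pos)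
  have "dist (T h f) f < e" if h: "0 < h" "h < d" for h
  proof -
    have h1: "h \<le> 1" using h d by simp
    note bc = calc_bounded_clinear[OF T[OF h(1)]]
    have 1: "norm (T h (f - cesaro g)) \<le> 4 * norm (f - cesaro g)"
      by (rule calc_bound[OF T[OF h(1)]]) (rule log_quotient_bounds(1)[OF _ h(1) h1])
    \<comment> \<open>the error \<open>T h - 1\<close> is small after the Cesaro operator\<close>
    have "calc (\<lambda>z. log_quotient h z * z - z) (\<lambda>f. T h (cesaro f) - cesaro f)"
      by (rule calc_diff[OF calc_mult[OF T[OF h(1)] calc_cesaro] calc_cesaro])
    then have 2: "norm (T h (cesaro g) - cesaro g) \<le> 4 * h * (4 + 2 * pi) * norm g"
    proof (rule calc_bound)
      fix z assume "z \<in> circ"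
      from log_quotient_bounds(2)[OF this h(1) h1] show "cmod (log_quotient h z * z - z) \<le> 4 * h * (4 + 2 * pi)"
        by (simp add: left_diff_distrib)
    qed
    have "4 * h * (4 + 2 * pi) * norm g = h * C" by (simp add: C_def)
    also have "\<dots> \<le> e / (4 * (C + 1)) * (C + 1)"
      using h C e by (intro mult_mono) (auto simp: d_def)
    also have "\<dots> = e / 4"
      using C by (simp add: field_simps)
    finally have 3: "norm (T h (cesaro g) - cesaro g) \<le> e / 4" using 2 by linarith
    have eq: "T h f - f = T h (f - cesaro g) + (T h (cesaro g) - cesaro g) + (cesaro g - f)"
      by (simp add: bounded_clinear_diff[OF bc])
    have "norm (T h f - f) \<le> norm (T h (f - cesaro g)) + norm (T h (cesaro g) - cesaro g) + norm (cesaro g - f)"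
      unfolding eq by (rule order_trans[OF norm_triangle_ineq add_right_mono[OF norm_triangle_ineq]])
    also have "\<dots> < e"
      using 1 3 g e norm_minus_commute[of "cesaro g" f] by linarith
    finally show ?thesis by (simp add: dist_norm)
  qed
  then show "\<forall>\<^sub>F h in at_right 0. dist (T h f) f < e"
    using d(1) by (intro eventually_at_rightI[of 0 d]) auto
qed

text \<open>That \<open>R = calc_op inv_log\<close> is a right inverse is the convergence of the difference quotients at \<open>R g\<close>. For the
  other side, the bounded operator \<open>R\<close> is applied to the convergent difference quotients at \<open>f\<close>; these
  then are again of the form treated in \<open>log_quotient_tendsto\<close> and converge to \<open>f\<close>.\<close>

lemma is_bounded_inverse_inv_log: "is_bounded_inverse log_cesaro_dom log_cesaro (calc_op inv_log)"
  unfolding is_bounded_inverse_def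
proof (intro conjI allI ballI)
  let ?R = "calc_op inv_log"
  show bc: "bounded_clinear ?R"
    by (rule calc_bounded_clinear[OF calc_calc_op[OF continuous_on_inv_log]])
  fix g
  have lim: "((\<lambda>h. (cesaro_power h (?R g) - ?R g) /\<^sub>R h) \<longlongrightarrow> g) (at_right 0)"
    by (rule log_quotient_tendsto[OF calc_log_quotient(1)])
  show "?R g \<in> log_cesaro_dom"
    unfolding log_cesaro_dom_def generator_dom_def using lim by blast
  show "log_cesaro (?R g) = g"
    unfolding log_cesaro_def generator_def by (rule tendsto_Lim[OF _ lim]) simp
next
  let ?R = "calc_op inv_log"
  have bc: "bounded_clinear ?R"
    by (rule calc_bounded_clinear[OF calc_calc_op[OF continuous_on_inv_log]])
  fix f assume "f \<in> log_cesaro_dom"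
  then obtain g where g: "((\<lambda>h. (cesaro_power h f - f) /\<^sub>R h) \<longlongrightarrow> g) (at_right 0)"
    unfolding log_cesaro_dom_def generator_dom_def by blast
  have "log_cesaro f = g"
    unfolding log_cesaro_def generator_def by (rule tendsto_Lim[OF _ g]) simp
  moreover have "?R g = f"
  proof (rule tendsto_unique)
    show "((\<lambda>h. ?R ((cesaro_power h f - f) /\<^sub>R h)) \<longlongrightarrow> ?R g) (at_right 0)"
      by (rule bounded_clinear_tendsto[OF bc g])
    show "((\<lambda>h. ?R ((cesaro_power h f - f) /\<^sub>R h)) \<longlongrightarrow> f) (at_right 0)"
      by (rule log_quotient_tendsto[OF calc_log_quotient(2)])
  qed simp
  ultimately show "?R (log_cesaro f) = f" by simp
qed

text \<open>The limit of \<open>cinner (R e) e\<close> along the waves \<open>e\<close> is the symbol by \<open>wave_symbol\<close> and the value of \<open>inv_log\<close> at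
  \<open>1 / (1/2 - \<i> s)\<close> by \<open>calc_wave\<close>.\<close>

lemma scalar_symbol_inv_log: "scalar_symbol (calc_op inv_log) s = - (1 / Ln (1/2 - \<i> * complex_of_real s))"
proof -
  let ?w = "1/2 - \<i> * complex_of_real s"
  have "scalar_symbol (calc_op inv_log) s = symbol inv_log_kernel s"
    using scalar_symbol_hausdorff[OF inv_log_hausdorff(1)] by (simp add: inv_log_hausdorff(2))
  also have "\<dots> = inv_log (circ_point s)"
    using wave_symbol[OF inv_log_hausdorff(1), of s] calc_wave[OF calc_calc_op[OF continuous_on_inv_log], of s]
    unfolding inv_log_hausdorff(2) by (rule LIMSEQ_unique)
  also have "\<dots> = - (1 / Ln ?w)"
  proof -
    have "?w \<notin> \<real>\<^sub>\<le>\<^sub>0" by (simp add: complex_nonpos_Reals_iff)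
    moreover have "?w \<noteq> 0" by (simp add: complex_eq_iff)
    ultimately show ?thesis
      using Ln_inverse[of ?w] by (simp add: inv_log_def circ_point_def inverse_eq_divide)
  qed
  finally show ?thesis .
qed

theorem theorem13:
  "\<exists>R. is_bounded_inverse log_cesaro_dom log_cesaro R \<and>
       R \<in> hausdorff_algebra \<and>
       (\<forall>s::real. scalar_symbol R s = - (1 / Ln (1/2 - \<i> * complex_of_real s)))"
proof (intro exI conjI allI)
  show "is_bounded_inverse log_cesaro_dom log_cesaro (calc_op inv_log)"
    by (rule is_bounded_inverse_inv_log)
  show "calc_op inv_log \<in> hausdorff_algebra"
    unfolding hausdorff_algebra_def
    using inv_log_hausdorff by (auto intro!: exI[of _ inv_log_kernel])
  show "scalar_symbol (calc_op inv_log) s = - (1 / Ln (1/2 - \<i> * complex_of_real s))" for s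
    by (rule scalar_symbol_inv_log)
qed

end
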